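(* Let $n\geq 2$ be an integer, $G=SL(n,\mathbf{Z})$, and let $S=S^{-1}\subset G$ be a finite symmetric generating set of $G$. Let $(X_k)_{k\geq 0}$ be the simple left-invariant random walk on $G$: $X_0=1$ and $X_{k+1}=X_k\xi_{k+1}$ for $k\geq 0$, where $(\xi_k)_{k\geq 1}$ is a sequence of independent $S$-valued random variables with $\mathbf{P}(\xi_k=s)=1/|S|$ for all $s\in S$. Then, almost surely, there are only finitely many $k$ for which the characteristic polynomial $\det(X_k-T)\in\mathbf{Z}[T]$ is reducible. *)

theory Defs
  imports "Jordan_Normal_Form.Determinant" "HOL-Computational_Algebra.Polynomial_Factorial"
    "HOL-Probability.Probability"
begin

definition SL_int :: "nat \<Rightarrow> int mat set" where
  "SL_int n = {A \<in> carrier_mat n n. Determinant.det A = 1}"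

inductive_set gen_by :: "nat \<Rightarrow> int mat set \<Rightarrow> int mat set" for n S where
  one: "1\<^sub>m n \<in> gen_by n S"
| mult: "A \<in> gen_by n S \<Longrightarrow> s \<in> S \<Longrightarrow> A * s \<in> gen_by n S"
| mult_inv: "A \<in> gen_by n S \<Longrightarrow> s \<in> S \<Longrightarrow> B \<in> carrier_mat n n \<Longrightarrow> s * B = 1\<^sub>m n
     \<Longrightarrow> A * B \<in> gen_by n S"

definition charpoly_T :: "int mat \<Rightarrow> int poly" where
  "charpoly_T A = Determinant.det (map_mat (\<lambda>a. [:a:]) A - [:0,1:] \<cdot>\<^sub>m 1\<^sub>m (dim_row A))"

definition walk :: "nat \<Rightarrow> (nat \<Rightarrow> 'w \<Rightarrow> int mat) \<Rightarrow> nat \<Rightarrow> 'w \<Rightarrow> int mat" where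
  "walk n \<xi> k w = foldl (*) (1\<^sub>m n) (map (\<lambda>i. \<xi> i w) [1..<Suc k])"

end

theory Submission
  imports Defs "HOL-Algebra.Product_Groups" "HOL-Real_Asymp.Real_Asymp" "Jordan_Normal_Form.Char_Poly"
    "HOL-Number_Theory.Cong"
begin

text \<open>
  If the characteristic polynomial of \<open>X\<^sub>k\<close> is reducible, then for some \<open>0 < d < n\<close> it has a factor of
  degree \<open>d\<close> modulo every prime. Modulo a prime \<open>p > 6\<close> this fails for a proportion at least
  \<open>\<delta> = 1 / (2 (2n)^(n-1))\<close> of the elements of \<open>SL(n, p)\<close>, so for \<open>X\<^sub>k\<close> equidistributed modulo \<open>r\<close> distinct primes
  the event has probability at most \<open>(1 - \<delta>)^r\<close>, which is \<open>k^(-2)\<close> for \<open>r = (2 / \<delta>) ln k\<close>; by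
  Borel--Cantelli this is good enough.

  No uniform spectral gap is needed for the equidistribution, because all \<open>r\<close> primes can be taken below \<open>r\<^sup>2\<close>:
  the Cayley graph of the product of the groups \<open>SL(n, p)\<close> then has a diameter polynomial in \<open>r\<close>, hence a
  spectral gap polynomial in \<open>1 / ln k\<close>, whereas the logarithm of the order of the group is only polynomial
  in \<open>ln k\<close>. To bound the diameter one needs short words that are trivial modulo all but one of the
  primes. They are found as iterated commutators: if \<open>x\<close> is trivial modulo the primes in \<open>A\<close> and \<open>y\<close> modulo those
  in \<open>B\<close>, then the commutator of \<open>x\<close> and \<open>y\<close> is trivial modulo those in \<open>A \<union> B\<close>, so about \<open>log r\<close> doubling
  steps suffice.
\<close>

section \<open>Mixing of symmetric random walks on finite groups\<close>

text \<open>Fixing the factor degree d before reducing gives the bad event product form: it becomes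
  a box of local bad sets in the product of the groups SL(n, p), and only n - 1 degrees have to be
  summed over. Asking for a missing factor of degree d, instead of irreducibility, permits an
  elementary count: pairs (g, h) are no more numerous than candidate products, so every polynomial
  with two factorizations forces a candidate with none. Passing from polynomials to matrices uses
  the basis v, gv, g^2 v, ... of a cyclic vector v, without conjugacy class sizes or the exact order
  of SL(n, p). Parity shapes the walk estimate: an eigenvalue near -1 is excluded by controlling
  pairs of steps, hence all diameters are stated with words of one even length. Polynomial losses
  are harmless throughout: the words have length O(r^9), so the gap is of order r^(-18) with r of
  order ln k, against time k.\<close>

definition words :: "'s set \<Rightarrow> nat \<Rightarrow> 's list set" where
  "words S k = {xs. set xs \<subseteq> S \<and> length xs = k}"

lemma finite_words [simp]: "finite S \<Longrightarrow> finite (words S k)"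
  unfolding words_def by (rule finite_lists_length_eq)

lemma card_words: "finite S \<Longrightarrow> card (words S k) = card S ^ k"
  unfolding words_def by (rule card_lists_length_eq)

lemma words_0 [simp]: "words S 0 = {[]}"
  unfolding words_def by auto

lemma words_append: "xs \<in> words S k \<Longrightarrow> ys \<in> words S l \<Longrightarrow> xs @ ys \<in> words S (k + l)"
  unfolding words_def by auto

lemma sum_words_Suc:
  fixes F :: "'s list \<Rightarrow> real"
  shows "(\<Sum>xs\<in>words S (Suc k). F xs) = (\<Sum>xs\<in>words S k. \<Sum>s\<in>S. F (xs @ [s]))"
proof -
  have "bij_betw (\<lambda>(xs, s). xs @ [s]) (words S k \<times> S) (words S (Suc k))"
  proof (rule bij_betwI[where g = "\<lambda>xs. (butlast xs, last xs)"])
    show "(\<lambda>xs. (butlast xs, last xs)) \<in> words S (Suc k) \<rightarrow> words S k \<times> S"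
      unfolding words_def
      by (auto dest: in_set_butlastD) (metis last_in_set length_0_conv nat.distinct(1) subsetD)
  qed (auto simp: words_def, metis append_butlast_last_id length_0_conv nat.distinct(1))
  then have "(\<Sum>xs\<in>words S (Suc k). F xs) = (\<Sum>(xs, s)\<in>words S k \<times> S. F (xs @ [s]))"
    by (subst sum.reindex_bij_betw[symmetric]) (auto simp: case_prod_unfold)
  then show ?thesis by (simp add: sum.cartesian_product)
qed

text \<open>The generators are labelled through \<open>\<sigma>\<close> because distinct elements of
  \<open>S\<close> may coincide in a finite quotient; counting words over the labels keeps the exact
  law of the integer walk.\<close>

locale finite_sym_walk = group G for G (structure) +
  fixes S :: "'s set" and \<sigma> :: "'s \<Rightarrow> 'a"
  assumes fin_G: "finite (carrier G)"
    and fin_S: "finite S" and S_ne: "S \<noteq> {}"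
    and \<sigma>_closed: "\<And>s. s \<in> S \<Longrightarrow> \<sigma> s \<in> carrier G"
    and \<sigma>_sym: "\<And>s. s \<in> S \<Longrightarrow> \<exists>s'\<in>S. \<sigma> s' = inv (\<sigma> s)"
begin

definition wprod :: "'s list \<Rightarrow> 'a" where
  "wprod xs = foldl (\<lambda>x s. x \<otimes> \<sigma> s) \<one> xs"

lemma card_pos: "card (carrier G) > 0"
  using fin_G one_closed by (auto simp: card_gt_0_iff)

lemma wprod_snoc: "wprod (xs @ [s]) = wprod xs \<otimes> \<sigma> s"
  by (simp add: wprod_def)

lemma wprod_closed: "set xs \<subseteq> S \<Longrightarrow> wprod xs \<in> carrier G"
  by (induction xs rule: rev_induct) (auto simp: wprod_snoc \<sigma>_closed, simp add: wprod_def)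

lemma sum_translate:
  fixes F :: "'a \<Rightarrow> real"
  assumes "g \<in> carrier G"
  shows "(\<Sum>x\<in>carrier G. F (x \<otimes> g)) = (\<Sum>x\<in>carrier G. F x)"
proof (rule sum.reindex_bij_witness[where i = "\<lambda>x. x \<otimes> inv g" and j = "\<lambda>x. x \<otimes> g"])
qed (use assms in \<open>auto simp: m_assoc\<close>)

lemma sum_left_translate:
  fixes F :: "'a \<Rightarrow> real"
  assumes "g \<in> carrier G"
  shows "(\<Sum>x\<in>carrier G. F (g \<otimes> x)) = (\<Sum>x\<in>carrier G. F x)"
proof (rule sum.reindex_bij_witness[where i = "\<lambda>x. inv g \<otimes> x" and j = "\<lambda>x. g \<otimes> x"])
qed (use assms in \<open>auto simp: m_assoc[symmetric]\<close>)

section \<open>Displacements, the averaging operator and its contraction\<close>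

definition displacement :: "('a \<Rightarrow> real) \<Rightarrow> 'a \<Rightarrow> real" where
  "displacement f g = L2_set (\<lambda>x. f x - f (x \<otimes> g)) (carrier G)"

lemma displacement_sq: "(displacement f g)\<^sup>2 = (\<Sum>x\<in>carrier G. (f x - f (x \<otimes> g))\<^sup>2)"
  unfolding displacement_def L2_set_def by (simp add: sum_nonneg)

text \<open>Right translation preserves the L2 norm, so the difference telescoped along
  \<open>g\<close> and then \<open>h\<close> obeys the triangle inequality.\<close>

lemma displacement_mult:
  assumes "g \<in> carrier G" "h \<in> carrier G"
  shows "displacement f (g \<otimes> h) \<le> displacement f g + displacement f h"
proof -
  have "displacement f (g \<otimes> h) = L2_set (\<lambda>x. (f x - f (x \<otimes> g)) + (f (x \<otimes> g) - f (x \<otimes> g \<otimes> h))) (carrier G)"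
    unfolding displacement_def by (rule L2_set_cong) (use assms in \<open>auto simp: m_assoc\<close>)
  also have "\<dots> \<le> displacement f g + L2_set (\<lambda>x. f (x \<otimes> g) - f (x \<otimes> g \<otimes> h)) (carrier G)"
    unfolding displacement_def by (rule L2_set_triangle_ineq)
  also have "L2_set (\<lambda>x. f (x \<otimes> g) - f (x \<otimes> g \<otimes> h)) (carrier G) = displacement f h"
    unfolding displacement_def L2_set_def
    using sum_translate[OF assms(1), of "\<lambda>x. (f x - f (x \<otimes> h))\<^sup>2"] by simp
  finally show ?thesis .
qed

text \<open>Substituting y = x g turns the double sum into one over all pairs (x, y), whose cross
  terms vanish by mean zero. This is how bounds on displacements become bounds on the norm of
  f.\<close>

lemma sum_displacement_sq:
  fixes f :: "'a \<Rightarrow> real"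
  assumes "(\<Sum>x\<in>carrier G. f x) = 0"
  shows "(\<Sum>g\<in>carrier G. (displacement f g)\<^sup>2) = 2 * card (carrier G) * (\<Sum>x\<in>carrier G. (f x)\<^sup>2)"
proof -
  let ?C = "carrier G"
  have "(\<Sum>g\<in>?C. (displacement f g)\<^sup>2) = (\<Sum>x\<in>?C. \<Sum>g\<in>?C. (f x - f (x \<otimes> g))\<^sup>2)"
    unfolding displacement_sq by (rule sum.swap)
  also have "\<dots> = (\<Sum>x\<in>?C. \<Sum>y\<in>?C. (f x - f y)\<^sup>2)"
    by (intro sum.cong refl sum_left_translate)
  also have "\<dots> = (\<Sum>x\<in>?C. \<Sum>y\<in>?C. (f x)\<^sup>2 + (f y)\<^sup>2 - 2 * (f x * f y))"
    by (simp add: power2_diff algebra_simps)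
  also have "\<dots> = 2 * card ?C * (\<Sum>x\<in>?C. (f x)\<^sup>2) - 2 * ((\<Sum>x\<in>?C. f x) * (\<Sum>y\<in>?C. f y))"
    unfolding sum_product by (simp add: sum.distrib sum_subtractf sum_distrib_left[symmetric])
  finally show ?thesis using assms by simp
qed

text \<open>The transition operator on densities: the inverse makes it carry the law at time k to
  the law at time k + 1, see \<open>walk_law_Suc\<close>.\<close>

definition avg :: "('a \<Rightarrow> real) \<Rightarrow> 'a \<Rightarrow> real" where
  "avg f x = (\<Sum>s\<in>S. f (x \<otimes> inv (\<sigma> s))) / card S"

text \<open>At each x this is the variance identity for the numbers f(x \<sigma>(s)^-1) with s in
  \<open>S\<close>. On summing over x, translation invariance replaces every shifted square sum by
  that of f.\<close>

lemma avg_energy: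
  fixes f :: "'a \<Rightarrow> real"
  shows
  "(\<Sum>x\<in>carrier G. (f x)\<^sup>2) - (\<Sum>x\<in>carrier G. (avg f x)\<^sup>2)
   = (\<Sum>s\<in>S. \<Sum>t\<in>S. \<Sum>x\<in>carrier G. (f (x \<otimes> inv (\<sigma> s)) - f (x \<otimes> inv (\<sigma> t)))\<^sup>2) / (2 * (card S)\<^sup>2)"
proof -
  let ?C = "carrier G" and ?N = "real (card S)"
  have N: "?N > 0" using fin_S S_ne by (simp add: card_gt_0_iff)
  have var: "(\<Sum>s\<in>S. \<Sum>t\<in>S. (a s - a t)\<^sup>2) = 2 * ?N * (\<Sum>s\<in>S. (a s)\<^sup>2) - 2 * (\<Sum>s\<in>S. a s)\<^sup>2"
    for a :: "'s \<Rightarrow> real"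
  proof -
    have "(\<Sum>s\<in>S. \<Sum>t\<in>S. (a s - a t)\<^sup>2) = (\<Sum>s\<in>S. \<Sum>t\<in>S. (a s)\<^sup>2 + (a t)\<^sup>2 - 2 * (a s * a t))"
      by (simp add: power2_diff algebra_simps)
    also have "\<dots> = 2 * ?N * (\<Sum>s\<in>S. (a s)\<^sup>2) - 2 * ((\<Sum>s\<in>S. a s) * (\<Sum>t\<in>S. a t))"
      unfolding sum_product by (simp add: sum.distrib sum_subtractf sum_distrib_left[symmetric])
    finally show ?thesis by (simp add: power2_eq_square)
  qed
  have "(\<Sum>s\<in>S. \<Sum>t\<in>S. \<Sum>x\<in>?C. (f (x \<otimes> inv (\<sigma> s)) - f (x \<otimes> inv (\<sigma> t)))\<^sup>2)
      = (\<Sum>x\<in>?C. \<Sum>s\<in>S. \<Sum>t\<in>S. (f (x \<otimes> inv (\<sigma> s)) - f (x \<otimes> inv (\<sigma> t)))\<^sup>2)"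
  proof -
    have "(\<Sum>s\<in>S. \<Sum>t\<in>S. \<Sum>x\<in>?C. (f (x \<otimes> inv (\<sigma> s)) - f (x \<otimes> inv (\<sigma> t)))\<^sup>2)
      = (\<Sum>s\<in>S. \<Sum>x\<in>?C. \<Sum>t\<in>S. (f (x \<otimes> inv (\<sigma> s)) - f (x \<otimes> inv (\<sigma> t)))\<^sup>2)"
      by (intro sum.cong refl sum.swap)
    also have "\<dots> = (\<Sum>x\<in>?C. \<Sum>s\<in>S. \<Sum>t\<in>S. (f (x \<otimes> inv (\<sigma> s)) - f (x \<otimes> inv (\<sigma> t)))\<^sup>2)"
      by (rule sum.swap)
    finally show ?thesis .
  qed
  also have "\<dots> = (\<Sum>x\<in>?C. 2 * ?N * (\<Sum>s\<in>S. (f (x \<otimes> inv (\<sigma> s)))\<^sup>2) - 2 * ?N\<^sup>2 * (avg f x)\<^sup>2)"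
    unfolding var using N by (simp add: avg_def power_divide)
  also have "\<dots> = 2 * ?N * (\<Sum>s\<in>S. \<Sum>x\<in>?C. (f (x \<otimes> inv (\<sigma> s)))\<^sup>2) - 2 * ?N\<^sup>2 * (\<Sum>x\<in>?C. (avg f x)\<^sup>2)"
    unfolding sum_subtractf sum_distrib_left[symmetric] by (subst sum.swap) (rule refl)
  also have "(\<Sum>s\<in>S. \<Sum>x\<in>?C. (f (x \<otimes> inv (\<sigma> s)))\<^sup>2) = (\<Sum>s\<in>S. \<Sum>x\<in>?C. (f x)\<^sup>2)"
    by (intro sum.cong refl sum_translate[where F = "\<lambda>x. (f x)\<^sup>2"]) (simp add: \<sigma>_closed)
  finally show ?thesis using N by (simp add: field_simps power2_eq_square)
qed

text \<open>The energy loss compares two neighbours of one point, which differ by two generators, so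
  it controls products of two generators. Single steps cannot be controlled this way: on a bipartite
  Cayley graph the sign function loses no energy.\<close>

lemma displacement_pair:
  assumes "s \<in> S" "t \<in> S"
  shows "displacement f (\<sigma> s \<otimes> \<sigma> t)
    \<le> sqrt (2 * (card S)\<^sup>2 * ((\<Sum>x\<in>carrier G. (f x)\<^sup>2) - (\<Sum>x\<in>carrier G. (avg f x)\<^sup>2)))"
proof (rule real_le_rsqrt)
  let ?C = "carrier G"
  define E where "E s t = (\<Sum>x\<in>?C. (f (x \<otimes> inv (\<sigma> s)) - f (x \<otimes> inv (\<sigma> t)))\<^sup>2)" for s t
  have N: "real (card S) > 0" using fin_S S_ne by (simp add: card_gt_0_iff)
  obtain t' where t': "t' \<in> S" "\<sigma> t' = inv (\<sigma> t)" using \<sigma>_sym assms by blast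
  have cl: "\<sigma> s \<in> ?C" "\<sigma> t \<in> ?C" using assms \<sigma>_closed by auto
  \<comment> \<open>With x \<sigma>(s) as base point, both arguments are neighbours of it, one
    through s and one through t'.\<close>
  have "(displacement f (\<sigma> s \<otimes> \<sigma> t))\<^sup>2 = (\<Sum>x\<in>?C. (f (x \<otimes> \<sigma> s \<otimes> inv (\<sigma> s)) - f (x \<otimes> \<sigma> s \<otimes> inv (\<sigma> t')))\<^sup>2)"
    unfolding displacement_sq by (rule sum.cong) (use cl t' in \<open>auto simp: m_assoc\<close>)
  also have "\<dots> = E s t'"
    unfolding E_def
    using sum_translate[OF cl(1), of "\<lambda>x. (f (x \<otimes> inv (\<sigma> s)) - f (x \<otimes> inv (\<sigma> t')))\<^sup>2"] by simp
  also have "\<dots> \<le> (\<Sum>t\<in>S. E s t)"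
    by (rule member_le_sum) (auto simp: t' fin_S E_def intro: sum_nonneg)
  also have "\<dots> \<le> (\<Sum>s\<in>S. \<Sum>t\<in>S. E s t)"
    by (rule member_le_sum[where f = "\<lambda>s. \<Sum>t\<in>S. E s t"])
       (auto simp: assms fin_S E_def intro!: sum_nonneg)
  also have "\<dots> = 2 * (card S)\<^sup>2 * ((\<Sum>x\<in>?C. (f x)\<^sup>2) - (\<Sum>x\<in>?C. (avg f x)\<^sup>2))"
    unfolding avg_energy E_def using N by simp
  finally show "(displacement f (\<sigma> s \<otimes> \<sigma> t))\<^sup>2 \<le> \<dots>" by simp
qed

text \<open>A Poincare inequality: each g is a product of m pairs of generators, so its displacement
  is at most m times the bound of \<open>displacement_pair\<close>; averaging the squares over g
  compares the norm of f with its loss under \<open>avg\<close>. The factor |S|^2 comes from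
  bounding one term of the energy by the whole sum.\<close>

lemma avg_contracts:
  assumes m: "m > 0"
    and diam: "\<And>g. g \<in> carrier G \<Longrightarrow> \<exists>xs\<in>words S (2 * m). wprod xs = g"
    and mean0: "(\<Sum>x\<in>carrier G. f x) = 0"
  shows "(\<Sum>x\<in>carrier G. (avg f x)\<^sup>2) \<le> (1 - 1 / (m * card S)\<^sup>2) * (\<Sum>x\<in>carrier G. (f x)\<^sup>2)"
proof -
  let ?C = "carrier G"
  define D where "D = (\<Sum>x\<in>?C. (f x)\<^sup>2) - (\<Sum>x\<in>?C. (avg f x)\<^sup>2)"
  define e where "e = sqrt (2 * (card S)\<^sup>2 * D)"
  have N: "real (card S) > 0" using fin_S S_ne by (simp add: card_gt_0_iff)
  have "D \<ge> 0" unfolding D_def avg_energy by (intro divide_nonneg_nonneg sum_nonneg) auto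
  have word: "displacement f (wprod xs) \<le> j * e" if "xs \<in> words S (2 * j)" for xs j
    using that
  proof (induction j arbitrary: xs)
    case 0
    then show ?case by (simp add: wprod_def displacement_def L2_set_def)
  next
    case (Suc j)
    then obtain ys t where ys: "xs = ys @ [t]" "t \<in> S" "ys \<in> words S (Suc (2 * j))"
      unfolding words_def by (cases xs rule: rev_cases) auto
    then obtain zs s where zs: "xs = zs @ [s] @ [t]" "s \<in> S" "zs \<in> words S (2 * j)"
      unfolding words_def by (cases ys rule: rev_cases) auto
    have cl: "wprod zs \<in> ?C" "\<sigma> s \<in> ?C" "\<sigma> t \<in> ?C"
      using zs ys wprod_closed \<sigma>_closed by (auto simp: words_def)
    have "wprod xs = wprod zs \<otimes> (\<sigma> s \<otimes> \<sigma> t)"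
      unfolding zs(1) append_assoc[symmetric] wprod_snoc using cl by (simp add: m_assoc)
    then have "displacement f (wprod xs) \<le> displacement f (wprod zs) + displacement f (\<sigma> s \<otimes> \<sigma> t)"
      using displacement_mult cl by simp
    also have "\<dots> \<le> j * e + e"
      using Suc.IH[OF zs(3)] displacement_pair[OF zs(2) ys(2), of f] unfolding e_def D_def by simp
    finally show ?case by (simp add: algebra_simps)
  qed
  have "2 * card ?C * (\<Sum>x\<in>?C. (f x)\<^sup>2) = (\<Sum>g\<in>?C. (displacement f g)\<^sup>2)"
    using sum_displacement_sq[OF mean0] by simp
  also have "\<dots> \<le> (\<Sum>g\<in>?C. (m * e)\<^sup>2)"
  proof (rule sum_mono)
    fix g assume "g \<in> ?C"
    then obtain xs where "xs \<in> words S (2 * m)" "wprod xs = g" using diam by blast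
    then have "displacement f g \<le> m * e" using word by blast
    moreover have "displacement f g \<ge> 0" by (simp add: displacement_def L2_set_nonneg)
    ultimately show "(displacement f g)\<^sup>2 \<le> (m * e)\<^sup>2" by (simp add: power_mono)
  qed
  also have "\<dots> = 2 * card ?C * ((m * card S)\<^sup>2 * D)"
    using \<open>D \<ge> 0\<close> by (simp add: e_def power_mult_distrib)
  finally have "(\<Sum>x\<in>?C. (f x)\<^sup>2) \<le> (m * card S)\<^sup>2 * D"
    using card_pos by simp
  then have "(\<Sum>x\<in>?C. (f x)\<^sup>2) / (m * card S)\<^sup>2 \<le> D"
    using m N by (simp add: divide_le_eq mult.commute)
  then show ?thesis unfolding D_def left_diff_distrib by simp
qed

section \<open>The law of the walk and its distance to the uniform law\<close>

definition walk_law :: "nat \<Rightarrow> 'a \<Rightarrow> real" where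
  "walk_law k x = (\<Sum>xs\<in>words S k. of_bool (wprod xs = x)) / card S ^ k"

lemma walk_law_Suc:
  assumes "x \<in> carrier G"
  shows "walk_law (Suc k) x = avg (walk_law k) x"
proof -
  have "(\<Sum>xs\<in>words S (Suc k). of_bool (wprod xs = x) :: real)
      = (\<Sum>xs\<in>words S k. \<Sum>s\<in>S. of_bool (wprod xs = x \<otimes> inv (\<sigma> s)))"
    unfolding sum_words_Suc wprod_snoc
  proof (intro sum.cong refl)
    fix xs s assume "xs \<in> words S k" "s \<in> S"
    then have "wprod xs \<in> carrier G" "\<sigma> s \<in> carrier G" by (auto simp: words_def wprod_closed \<sigma>_closed)
    then have "wprod xs \<otimes> \<sigma> s = x \<longleftrightarrow> wprod xs = x \<otimes> inv (\<sigma> s)"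
      using assms by (auto simp: m_assoc)
    then show "of_bool (wprod xs \<otimes> \<sigma> s = x) = (of_bool (wprod xs = x \<otimes> inv (\<sigma> s)) :: real)"
      by simp
  qed
  also have "\<dots> = (\<Sum>s\<in>S. \<Sum>xs\<in>words S k. of_bool (wprod xs = x \<otimes> inv (\<sigma> s)))" by (rule sum.swap)
  finally show ?thesis by (simp add: walk_law_def avg_def sum_divide_distrib field_simps)
qed

lemma sum_walk_law:
  assumes "B \<subseteq> carrier G"
  shows "(\<Sum>x\<in>B. walk_law k x) = card {xs \<in> words S k. wprod xs \<in> B} / card S ^ k"
proof -
  have "finite B" using assms fin_G finite_subset by blast
  have "(\<Sum>x\<in>B. \<Sum>xs\<in>words S k. of_bool (wprod xs = x)) = (\<Sum>xs\<in>words S k. \<Sum>x\<in>B. of_bool (wprod xs = x) :: real)"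
    by (rule sum.swap)
  also have "\<dots> = (\<Sum>xs\<in>words S k. of_bool (wprod xs \<in> B))"
    using \<open>finite B\<close> by (intro sum.cong refl) (auto simp: of_bool_def)
  also have "\<dots> = card {xs \<in> words S k. wprod xs \<in> B}"
    using fin_S by (simp add: of_bool_def sum.If_cases Int_def)
  finally show ?thesis by (simp add: walk_law_def sum_divide_distrib[symmetric])
qed

text \<open>Law minus uniform has mean zero at every time, so its squared norm contracts
  geometrically from a value at most 1. Cauchy-Schwarz on \<open>B\<close> then costs a factor sqrt
  |B|, which is at most sqrt |G|.\<close>

theorem mixing:
  assumes m: "m > 0"
    and diam: "\<And>g. g \<in> carrier G \<Longrightarrow> \<exists>xs\<in>words S (2 * m). wprod xs = g"
    and B: "B \<subseteq> carrier G"
  shows "card {xs \<in> words S k. wprod xs \<in> B} / card S ^ k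
    \<le> card B / card (carrier G) + sqrt (card (carrier G) * (1 - 1 / (m * card S)\<^sup>2) ^ k)"
proof -
  let ?C = "carrier G" and ?N = "real (card (carrier G))"
  have N: "?N > 0" using card_pos by simp
  have cS: "card S > 0" using fin_S S_ne by (simp add: card_gt_0_iff)
  define q where "q = 1 - 1 / (real (m * card S))\<^sup>2"
  have "m * card S \<ge> 1" using m cS by (simp add: Suc_le_eq)
  then have "(real (m * card S))\<^sup>2 \<ge> 1" by (metis of_nat_1 of_nat_mono one_le_power)
  then have q: "q \<ge> 0" unfolding q_def using m cS by (simp add: divide_le_eq_1)
  define f where "f k x = walk_law k x - 1 / ?N" for k x
  have mean0: "(\<Sum>x\<in>?C. f k x) = 0" for k
  proof -
    have "{xs \<in> words S k. wprod xs \<in> ?C} = words S k" by (auto simp: words_def wprod_closed)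
    then have "(\<Sum>x\<in>?C. walk_law k x) = 1"
      using sum_walk_law[of ?C k] cS fin_S S_ne by (simp add: card_words)
    then show ?thesis using N by (simp add: f_def sum_subtractf)
  qed
  have decay: "(\<Sum>x\<in>?C. (f k x)\<^sup>2) \<le> q ^ k" for k
  proof (induction k)
    case 0
    have d0: "walk_law 0 x = of_bool (x = \<one>)" for x by (auto simp: walk_law_def wprod_def)
    have "(\<Sum>x\<in>?C. (f 0 x)\<^sup>2) = (\<Sum>x\<in>?C. (1 - 2 / ?N) * of_bool (x = \<one>) + 1 / ?N\<^sup>2)"
      by (intro sum.cong refl) (auto simp: f_def d0 power2_diff power_divide)
    also have "\<dots> = 1 - 2 / ?N + ?N / ?N\<^sup>2"
      using fin_G by (simp add: sum.distrib sum_distrib_left[symmetric] of_bool_def)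
    also have "\<dots> = 1 - 1 / ?N" using N by (simp add: power2_eq_square field_simps)
    also have "\<dots> \<le> 1" using N by simp
    finally show ?case by simp
  next
    case (Suc k)
    have "(\<Sum>x\<in>?C. (f (Suc k) x)\<^sup>2) = (\<Sum>x\<in>?C. (avg (f k) x)\<^sup>2)"
    proof (intro sum.cong refl)
      fix x assume "x \<in> ?C"
      have "avg (f k) x = avg (walk_law k) x - 1 / ?N"
        using cS by (simp add: avg_def f_def sum_subtractf field_simps)
      then show "(f (Suc k) x)\<^sup>2 = (avg (f k) x)\<^sup>2" by (simp add: f_def walk_law_Suc[OF \<open>x \<in> ?C\<close>])
    qed
    also have "\<dots> \<le> q * (\<Sum>x\<in>?C. (f k x)\<^sup>2)"
      unfolding q_def using avg_contracts[OF m diam mean0] by simp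
    also have "\<dots> \<le> q * q ^ k" using Suc q by (rule mult_left_mono)
    finally show ?case by simp
  qed
  have "(\<Sum>x\<in>B. f k x) \<le> (\<Sum>x\<in>B. \<bar>f k x\<bar> * \<bar>1\<bar>)" by (rule sum_mono) auto
  also have "\<dots> \<le> L2_set (f k) B * L2_set (\<lambda>_. 1) B" by (rule L2_set_mult_ineq)
  also have "\<dots> \<le> sqrt (q ^ k) * sqrt ?N"
  proof (intro mult_mono)
    have "(\<Sum>x\<in>B. (f k x)\<^sup>2) \<le> (\<Sum>x\<in>?C. (f k x)\<^sup>2)"
      using B fin_G by (intro sum_mono2) auto
    then show "L2_set (f k) B \<le> sqrt (q ^ k)"
      unfolding L2_set_def using decay[of k] by simp
    show "L2_set (\<lambda>_. 1) B \<le> sqrt ?N"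
      unfolding L2_set_def using B fin_G by (simp add: card_mono)
  qed (use q in \<open>auto intro: L2_set_nonneg\<close>)
  also have "\<dots> = sqrt (?N * q ^ k)" by (simp add: real_sqrt_mult)
  finally have "(\<Sum>x\<in>B. walk_law k x) \<le> card B / ?N + sqrt (?N * q ^ k)"
    by (simp add: f_def sum_subtractf)
  then show ?thesis unfolding sum_walk_law[OF B] q_def by simp
qed

end

section \<open>The law of the walk\<close>

definition mprod :: "nat \<Rightarrow> int mat list \<Rightarrow> int mat" where
  "mprod n xs = foldl (*) (1\<^sub>m n) xs"

lemma walk_eq_mprod: "walk n \<xi> k w = mprod n (map (\<lambda>i. \<xi> i w) [1..<Suc k])"
  by (simp add: walk_def mprod_def)

text \<open>The first k steps form a uniform word: the event splits into disjoint cylinders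
  \<open>E xs\<close>, each of probability |S|^(-k) by independence. With k >= 1 a cylinder is an
  intersection over a nonempty index set; the empty one would be \<open>UNIV\<close> instead of
  \<open>space M\<close>.\<close>

lemma (in prob_space) walk_distribution:
  fixes \<xi> :: "nat \<Rightarrow> 'a \<Rightarrow> int mat"
  assumes indep: "indep_vars (\<lambda>_. count_space UNIV) \<xi> {1..}"
    and valued: "\<forall>k\<ge>1. \<forall>w\<in>space M. \<xi> k w \<in> S"
    and unif: "\<forall>k\<ge>1. \<forall>s\<in>S. prob {w \<in> space M. \<xi> k w = s} = 1 / real (card S)"
    and fin: "finite S" and k: "k \<ge> 1"
  shows "{w \<in> space M. walk n \<xi> k w \<in> B} \<in> events"
    and "prob {w \<in> space M. walk n \<xi> k w \<in> B} = card {xs \<in> words S k. mprod n xs \<in> B} / card S ^ k"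
proof -
  define E where "E xs = {w \<in> space M. map (\<lambda>i. \<xi> i w) [1..<Suc k] = xs}" for xs
  have meas: "\<xi> i \<in> measurable M (count_space UNIV)" if "i \<ge> 1" for i
    using indep that unfolding indep_vars_def by auto
  have E_eq: "E xs = (\<Inter>i\<in>{1..k}. \<xi> i -` {xs ! (i - 1)} \<inter> space M)" if "xs \<in> words S k" for xs
  proof -
    have len: "length xs = k" using that by (simp add: words_def)
    have "map (\<lambda>i. \<xi> i w) [1..<Suc k] = xs \<longleftrightarrow> (\<forall>i\<in>{1..k}. \<xi> i w = xs ! (i - 1))" for w
    proof
      assume eq: "map (\<lambda>i. \<xi> i w) [1..<Suc k] = xs"
      show "\<forall>i\<in>{1..k}. \<xi> i w = xs ! (i - 1)"
        unfolding eq[symmetric] by (auto simp del: upt_Suc)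
    next
      assume all: "\<forall>i\<in>{1..k}. \<xi> i w = xs ! (i - 1)"
      show "map (\<lambda>i. \<xi> i w) [1..<Suc k] = xs"
        by (rule nth_equalityI) (use all len in \<open>auto simp del: upt_Suc\<close>)
    qed
    then show ?thesis using k by (auto simp: E_def)
  qed
  have E_meas: "E xs \<in> events" if "xs \<in> words S k" for xs
    unfolding E_eq[OF that]
    by (rule sets.finite_INT) (use k in \<open>auto intro!: measurable_sets[OF meas]\<close>)
  have E_prob: "prob (E xs) = 1 / card S ^ k" if xs: "xs \<in> words S k" for xs
  proof -
    have "prob (E xs) = (\<Prod>i\<in>{1..k}. prob (\<xi> i -` {xs ! (i - 1)} \<inter> space M))"
      unfolding E_eq[OF xs] by (rule indep_varsD[OF indep]) (use k in auto)
    also have "\<dots> = (\<Prod>i\<in>{1..k}. 1 / real (card S))"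
    proof (rule prod.cong[OF refl])
      fix i assume i: "i \<in> {1..k}"
      then have "i - 1 < length xs" using xs by (auto simp: words_def)
      then have "xs ! (i - 1) \<in> S" using xs by (auto simp: words_def)
      moreover have "\<xi> i -` {xs ! (i - 1)} \<inter> space M = {w \<in> space M. \<xi> i w = xs ! (i - 1)}" by auto
      ultimately show "prob (\<xi> i -` {xs ! (i - 1)} \<inter> space M) = 1 / real (card S)"
        using unif i by simp
    qed
    also have "\<dots> = 1 / card S ^ k" by (simp add: power_divide)
    finally show ?thesis .
  qed
  define W where "W = {xs \<in> words S k. mprod n xs \<in> B}"
  have W: "finite W" "W \<subseteq> words S k" using fin by (auto simp: W_def)
  have ev: "{w \<in> space M. walk n \<xi> k w \<in> B} = (\<Union>xs\<in>W. E xs)"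
  proof -
    have "map (\<lambda>i. \<xi> i w) [1..<Suc k] \<in> words S k" if "w \<in> space M" for w
      using valued that by (auto simp: words_def)
    then show ?thesis by (auto simp: W_def E_def walk_eq_mprod simp del: upt_Suc)
  qed
  show "{w \<in> space M. walk n \<xi> k w \<in> B} \<in> events"
    unfolding ev using W E_meas by (intro sets.finite_UN) auto
  have "prob (\<Union>xs\<in>W. E xs) = (\<Sum>xs\<in>W. prob (E xs))"
    by (rule finite_measure_finite_Union) (use W E_meas in \<open>auto simp: disjoint_family_on_def E_def\<close>)
  also have "\<dots> = (\<Sum>xs\<in>W. 1 / card S ^ k)"
    by (rule sum.cong) (use W E_prob in auto)
  finally show "prob {w \<in> space M. walk n \<xi> k w \<in> B} = card {xs \<in> words S k. mprod n xs \<in> B} / card S ^ k"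
    unfolding ev W_def by simp
qed

section \<open>Integer matrices modulo p\<close>

text \<open>General in the ring because it serves both for integer matrices modulo p and for
  characteristic matrices modulo the constant polynomial \<open>[:p:]\<close>.\<close>

definition mat_cong :: "'a::comm_ring_1 \<Rightarrow> 'a mat \<Rightarrow> 'a mat \<Rightarrow> bool" where
  "mat_cong m A B \<longleftrightarrow> dim_row A = dim_row B \<and> dim_col A = dim_col B \<and>
     (\<forall>i<dim_row A. \<forall>j<dim_col A. m dvd A $$ (i, j) - B $$ (i, j))"

lemma mat_congI:
  assumes "A \<in> carrier_mat r c" "B \<in> carrier_mat r c"
    and "\<And>i j. i < r \<Longrightarrow> j < c \<Longrightarrow> m dvd A $$ (i, j) - B $$ (i, j)"
  shows "mat_cong m A B"
  using assms by (auto simp: mat_cong_def)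

lemma mat_congD:
  assumes "mat_cong m A B" "A \<in> carrier_mat r c"
  shows "B \<in> carrier_mat r c" "\<And>i j. i < r \<Longrightarrow> j < c \<Longrightarrow> m dvd A $$ (i, j) - B $$ (i, j)"
  using assms by (auto simp: mat_cong_def)

lemma mat_cong_refl [simp]: "mat_cong m A A"
  by (simp add: mat_cong_def)

lemma mat_cong_sym: "mat_cong m A B \<Longrightarrow> mat_cong m B A"
  unfolding mat_cong_def by (metis dvd_minus_iff minus_diff_eq)

lemma mat_cong_trans [trans]:
  assumes "mat_cong m A B" "mat_cong m B C"
  shows "mat_cong m A C"
proof -
  have "m dvd A $$ ij - C $$ ij" if "m dvd A $$ ij - B $$ ij" "m dvd B $$ ij - C $$ ij" for ij
    using dvd_add[OF that] by simp
  then show ?thesis using assms unfolding mat_cong_def by simp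
qed

lemma mat_cong_eq_trans [trans]:
  "A = B \<Longrightarrow> mat_cong m B C \<Longrightarrow> mat_cong m A C"
  "mat_cong m A B \<Longrightarrow> B = C \<Longrightarrow> mat_cong m A C"
  by auto

lemma dvd_mult_diff:
  fixes m :: "'a::comm_ring_1"
  assumes "m dvd a - b" "m dvd c - d"
  shows "m dvd a * c - b * d"
proof -
  have "a * c - b * d = a * (c - d) + (a - b) * d" by (simp add: algebra_simps)
  then show ?thesis using assms by (metis dvd_add dvd_mult dvd_mult2)
qed

lemma dvd_sum_diff:
  fixes m :: "'a::comm_ring_1"
  assumes "\<And>i. i \<in> I \<Longrightarrow> m dvd f i - g i"
  shows "m dvd sum f I - sum g I"
  unfolding sum_subtractf[symmetric] by (rule dvd_sum) (rule assms)

lemma dvd_prod_diff: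
  fixes m :: "'a::comm_ring_1"
  assumes "\<And>i. i \<in> I \<Longrightarrow> m dvd f i - g i"
  shows "m dvd prod f I - prod g I"
  using assms by (induction I rule: infinite_finite_induct) (auto intro: dvd_mult_diff)

lemma mat_cong_mult:
  assumes A: "mat_cong m A A'" and B: "mat_cong m B B'" and dim: "dim_col A = dim_row B"
  shows "mat_cong m (A * B) (A' * B')"
  unfolding mat_cong_def
proof (intro conjI allI impI)
  fix i j assume ij: "i < dim_row (A * B)" "j < dim_col (A * B)"
  have "m dvd (\<Sum>k = 0..<dim_row B. A $$ (i, k) * B $$ (k, j)) - (\<Sum>k = 0..<dim_row B. A' $$ (i, k) * B' $$ (k, j))"
    by (intro dvd_sum_diff dvd_mult_diff) (use A B ij dim in \<open>auto simp: mat_cong_def\<close>)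
  then show "m dvd (A * B) $$ (i, j) - (A' * B') $$ (i, j)"
    using A B ij dim by (auto simp: mat_cong_def scalar_prod_def)
qed (use A B in \<open>auto simp: mat_cong_def\<close>)

lemma mat_cong_mult_carrier:
  assumes "mat_cong m A A'" "mat_cong m B B'" "A \<in> carrier_mat r k" "B \<in> carrier_mat k c"
  shows "mat_cong m (A * B) (A' * B')"
  using assms by (intro mat_cong_mult) auto

lemma mat_cong_det:
  assumes AB: "mat_cong m A B" and A: "A \<in> carrier_mat n n"
  shows "m dvd Determinant.det A - Determinant.det B"
proof -
  note B = mat_congD(1)[OF AB A]
  show ?thesis unfolding det_def'[OF A] det_def'[OF B]
  proof (intro dvd_sum_diff dvd_mult_diff dvd_prod_diff)
    fix p i assume "p \<in> {p. p permutes {0..<n}}" "i \<in> {0..<n}"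
    then have "i < n" "p i < n" using permutes_in_image[of p "{0..<n}" i] by auto
    then show "m dvd A $$ (i, p i) - B $$ (i, p i)" using mat_congD(2)[OF AB A] by blast
  qed simp
qed

section \<open>The group SL(n, p) on reduced integer matrices\<close>

definition redm :: "int \<Rightarrow> int mat \<Rightarrow> int mat" where
  "redm p A = map_mat (\<lambda>a. a mod p) A"

lemma redm_carrier [simp]: "redm p A \<in> carrier_mat r c \<longleftrightarrow> A \<in> carrier_mat r c"
  by (simp add: redm_def)

lemma redm_cong: "mat_cong p (redm p A) A"
  by (auto simp: mat_cong_def redm_def mod_eq_dvd_iff[symmetric])

lemma redm_eq_iff: "redm p A = redm p B \<longleftrightarrow> mat_cong p A B"
  by (auto simp: mat_cong_def redm_def mat_eq_iff mod_eq_dvd_iff[symmetric])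

lemma redm_redm [simp]: "redm p (redm p A) = redm p A"
  unfolding redm_eq_iff by (rule redm_cong)

lemma redm_mult:
  assumes "dim_col A = dim_row B"
  shows "redm p (redm p A * B) = redm p (A * B)" "redm p (A * redm p B) = redm p (A * B)"
  unfolding redm_eq_iff
  by (rule mat_cong_mult; use assms in \<open>auto simp: redm_cong[unfolded redm_def] redm_def\<close>)+

text \<open>Elements are canonical integer representatives, so the groups for all primes share the
  type \<open>int mat\<close>, as \<open>product_group\<close> over a varying prime
  requires.\<close>

definition SLp :: "nat \<Rightarrow> int \<Rightarrow> int mat monoid" where
  "SLp n p = \<lparr>carrier = {A \<in> carrier_mat n n. redm p A = A \<and> p dvd Determinant.det A - 1},
     monoid.mult = (\<lambda>A B. redm p (A * B)), one = redm p (1\<^sub>m n)\<rparr>"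

lemma SLp_carrier: "A \<in> carrier (SLp n p) \<longleftrightarrow> A \<in> carrier_mat n n \<and> redm p A = A \<and> p dvd Determinant.det A - 1"
  by (simp add: SLp_def)

lemma SLp_mult [simp]: "A \<otimes>\<^bsub>SLp n p\<^esub> B = redm p (A * B)"
  by (simp add: SLp_def)

lemma SLp_one [simp]: "\<one>\<^bsub>SLp n p\<^esub> = redm p (1\<^sub>m n)"
  by (simp add: SLp_def)

lemma dvd_det_mult_1:
  fixes p :: int
  assumes "A \<in> carrier_mat n n" "B \<in> carrier_mat n n"
    "p dvd Determinant.det A - 1" "p dvd Determinant.det B - 1"
  shows "p dvd Determinant.det (A * B) - 1"
  using dvd_mult_diff[OF assms(3,4)] det_mult[OF assms(1,2)] by simp

lemma redm_SLp:
  assumes "A \<in> carrier_mat n n" "p dvd Determinant.det A - 1"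
  shows "redm p A \<in> carrier (SLp n p)"
proof -
  have "p dvd Determinant.det (redm p A) - Determinant.det A"
    by (rule mat_cong_det[OF redm_cong, of _ _ n]) (simp add: assms)
  then have "p dvd Determinant.det (redm p A) - 1" using dvd_add[OF _ assms(2)] by fastforce
  then show ?thesis using assms by (simp add: SLp_carrier)
qed

text \<open>The adjugate is to be the inverse modulo p. Its determinant e satisfies e det A = (det
  A)^n, where det A is 1 modulo p.\<close>

lemma dvd_det_adj_mat:
  fixes p :: int
  assumes A: "A \<in> carrier_mat n n" and d: "p dvd Determinant.det A - 1"
  shows "p dvd Determinant.det (adj_mat A) - 1"
proof -
  let ?d = "Determinant.det A" and ?e = "Determinant.det (adj_mat A)"
  note adj = adj_mat[OF A]
  have "?e * ?d = ?d ^ n"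
    using det_mult[OF adj(1) A] unfolding adj(3) by simp
  moreover have "p dvd ?d ^ n - 1"
    using dvd_prod_diff[of "{..<n}" p "\<lambda>_. ?d" "\<lambda>_. 1"] d by simp
  ultimately have "p dvd ?e * ?d - 1" by simp
  moreover have "p dvd ?e * (?d - 1)" using d by simp
  ultimately have "p dvd (?e * ?d - 1) - ?e * (?d - 1)" by (rule dvd_diff)
  then show ?thesis by (simp add: algebra_simps)
qed

lemma group_SLp: "group (SLp n p)"
proof (rule groupI)
  fix A B assume AB: "A \<in> carrier (SLp n p)" "B \<in> carrier (SLp n p)"
  then show "A \<otimes>\<^bsub>SLp n p\<^esub> B \<in> carrier (SLp n p)"
    unfolding SLp_mult by (intro redm_SLp dvd_det_mult_1[of _ n]) (auto simp: SLp_carrier)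
next
  show "\<one>\<^bsub>SLp n p\<^esub> \<in> carrier (SLp n p)" by (auto intro!: redm_SLp)
next
  fix A B C assume "A \<in> carrier (SLp n p)" "B \<in> carrier (SLp n p)" "C \<in> carrier (SLp n p)"
  then have "A \<in> carrier_mat n n" "B \<in> carrier_mat n n" "C \<in> carrier_mat n n"
    by (auto simp: SLp_carrier)
  then show "A \<otimes>\<^bsub>SLp n p\<^esub> B \<otimes>\<^bsub>SLp n p\<^esub> C = A \<otimes>\<^bsub>SLp n p\<^esub> (B \<otimes>\<^bsub>SLp n p\<^esub> C)"
    by (simp add: redm_mult assoc_mult_mat[of A n n B n C n])
next
  fix A assume "A \<in> carrier (SLp n p)"
  then show "\<one>\<^bsub>SLp n p\<^esub> \<otimes>\<^bsub>SLp n p\<^esub> A = A" by (auto simp: SLp_carrier redm_mult)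
next
  fix A assume A: "A \<in> carrier (SLp n p)"
  then have A': "A \<in> carrier_mat n n" "p dvd Determinant.det A - 1" by (auto simp: SLp_carrier)
  note adj = adj_mat[OF A'(1)]
  have "mat_cong p (adj_mat A * A) (1\<^sub>m n)"
    unfolding adj(3) using A'(2) by (auto simp: mat_cong_def)
  then have "redm p (redm p (adj_mat A) * A) = redm p (1\<^sub>m n)"
    using adj(1) A' by (simp add: redm_mult redm_eq_iff)
  moreover have "redm p (adj_mat A) \<in> carrier (SLp n p)"
    using adj(1) dvd_det_adj_mat[OF A'] by (rule redm_SLp)
  ultimately show "\<exists>B\<in>carrier (SLp n p). B \<otimes>\<^bsub>SLp n p\<^esub> A = \<one>\<^bsub>SLp n p\<^esub>" by auto
qed

definition reduced_mats :: "nat \<Rightarrow> int \<Rightarrow> int mat set" where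
  "reduced_mats n p = {A \<in> carrier_mat n n. redm p A = A}"

lemma reduced_mats_bound:
  assumes p: "p > 0"
  shows "finite (reduced_mats n p)" "card (reduced_mats n p) \<le> nat p ^ (n * n)"
proof -
  let ?I = "{0..<n} \<times> {0..<n}"
  let ?F = "?I \<rightarrow>\<^sub>E {0..<p}"
  have sub: "reduced_mats n p \<subseteq> (\<lambda>f. Matrix.mat n n f) ` ?F"
  proof
    fix A assume A: "A \<in> reduced_mats n p"
    then have c: "A \<in> carrier_mat n n" "redm p A = A" by (auto simp: reduced_mats_def)
    have "A $$ (i, j) \<in> {0..<p}" if "i < n" "j < n" for i j
    proof -
      have "A $$ (i, j) = A $$ (i, j) mod p"
        by (subst (1) c(2)[symmetric]) (use c(1) that in \<open>simp add: redm_def\<close>)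
      then show ?thesis using p by (metis atLeastLessThan_iff pos_mod_bound pos_mod_sign)
    qed
    then have "restrict (\<lambda>ij. A $$ ij) ?I \<in> ?F" by auto
    moreover have "A = Matrix.mat n n (restrict (\<lambda>ij. A $$ ij) ?I)"
      by (rule eq_matI) (use c(1) in auto)
    ultimately show "A \<in> (\<lambda>f. Matrix.mat n n f) ` ?F" by blast
  qed
  have fin: "finite ?F" by (intro finite_PiE) auto
  then show "finite (reduced_mats n p)" using sub by (meson finite_imageI finite_subset)
  have "card (reduced_mats n p) \<le> card ?F"
    using sub fin by (meson card_image_le card_mono finite_imageI le_trans)
  also have "\<dots> = nat p ^ (n * n)" by (simp add: card_PiE)
  finally show "card (reduced_mats n p) \<le> nat p ^ (n * n)" .
qed

lemma SLp_subset_reduced: "carrier (SLp n p) \<subseteq> reduced_mats n p"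
  by (auto simp: SLp_carrier reduced_mats_def)

section \<open>Elimination modulo p\<close>

text \<open>Residue classes of products of exactly N elementary matrices. The coefficient b may be
  0, so products of fewer factors are covered as well.\<close>

primrec elem_gen :: "nat \<Rightarrow> int \<Rightarrow> nat \<Rightarrow> int mat set" where
  "elem_gen n p 0 = {A \<in> carrier_mat n n. mat_cong p A (1\<^sub>m n)}"
| "elem_gen n p (Suc N) = {A \<in> carrier_mat n n. \<exists>i j b B. i < n \<and> j < n \<and> i \<noteq> j \<and>
     B \<in> elem_gen n p N \<and> mat_cong p A (addrow_mat n b i j * B)}"

lemma elem_gen_carrier: "A \<in> elem_gen n p N \<Longrightarrow> A \<in> carrier_mat n n"
  by (cases N) auto

text \<open>A row operation is undone by the opposite one, so every step of elimination contributes
  one elementary factor.\<close>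

lemma elem_gen_addrow:
  assumes A: "A \<in> carrier_mat n n" and ij: "i < n" "j < n" "i \<noteq> j"
    and B: "addrow b i j A \<in> elem_gen n p N"
  shows "A \<in> elem_gen n p (Suc N)"
proof -
  have "A = addrow (- b) i j (addrow b i j A)"
    by (rule eq_matI) (use A ij in auto)
  also have "\<dots> = addrow_mat n (- b) i j * addrow b i j A"
    by (rule addrow_mat) (use A ij in auto)
  finally have "mat_cong p A (addrow_mat n (- b) i j * addrow b i j A)"
    by (metis mat_cong_refl)
  then show ?thesis using assms by auto
qed

lemma elem_gen_Suc: "n \<ge> 2 \<Longrightarrow> A \<in> elem_gen n p N \<Longrightarrow> A \<in> elem_gen n p (Suc N)"
proof (rule elem_gen_addrow[of A n 0 1 0])
  assume "n \<ge> 2" "A \<in> elem_gen n p N"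
  then have "A \<in> carrier_mat n n" by (simp add: elem_gen_carrier)
  then have "addrow 0 0 1 A = A" by (intro eq_matI) auto
  with \<open>A \<in> elem_gen n p N\<close> show "addrow 0 0 1 A \<in> elem_gen n p N" by simp
qed (auto simp: elem_gen_carrier)

lemma elem_gen_mono: "n \<ge> 2 \<Longrightarrow> A \<in> elem_gen n p N \<Longrightarrow> N \<le> N' \<Longrightarrow> A \<in> elem_gen n p N'"
proof -
  assume n: "n \<ge> 2" and A: "A \<in> elem_gen n p N" and "N \<le> N'"
  then obtain d where "N' = N + d" using le_Suc_ex by blast
  moreover have "A \<in> elem_gen n p (N + d)"
    by (induction d) (use n A elem_gen_Suc in \<open>auto simp del: elem_gen.simps\<close>)
  ultimately show ?thesis by simp
qed

definition cols_cleared :: "nat \<Rightarrow> int \<Rightarrow> nat \<Rightarrow> int mat \<Rightarrow> bool" where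
  "cols_cleared n p k A \<longleftrightarrow> A \<in> carrier_mat n n \<and> p dvd Determinant.det A - 1 \<and>
     (\<forall>c<k. \<forall>i<n. p dvd A $$ (i, c) - of_bool (i = c))"

text \<open>The added row j has index at least k, so modulo p it vanishes in all cleared
  columns.\<close>

lemma cols_cleared_addrow:
  assumes A: "cols_cleared n p k A" and k: "k \<le> n" and ij: "i < n" "j < n" "i \<noteq> j" "k \<le> j"
  shows "cols_cleared n p k (addrow b i j A)"
proof -
  have c: "A \<in> carrier_mat n n" using A by (simp add: cols_cleared_def)
  have "p dvd addrow b i j A $$ (r, c) - of_bool (r = c)" if "c < k" "r < n" for r c
  proof (cases "r = i")
    case True
    have col: "p dvd A $$ (r, c) - of_bool (r = c)" if "r < n" for r
      using A that \<open>c < k\<close> by (simp add: cols_cleared_def)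
    have "j \<noteq> c" using that ij by simp
    then have "p dvd A $$ (i, c) - of_bool (i = c)" "p dvd A $$ (j, c)"
      using col[OF ij(1)] col[OF ij(2)] by simp_all
    then have "p dvd b * A $$ (j, c) + (A $$ (i, c) - of_bool (i = c))" by (intro dvd_add dvd_mult)
    then show ?thesis using True ij k that \<open>A \<in> carrier_mat n n\<close> by (simp add: algebra_simps)
  next
    case False
    then show ?thesis using A k that \<open>A \<in> carrier_mat n n\<close> by (auto simp: cols_cleared_def)
  qed
  moreover have "Determinant.det (addrow b i j A) = Determinant.det A"
    by (rule det_addrow) (use c ij in auto)
  ultimately show ?thesis using A by (auto simp: cols_cleared_def)
qed

text \<open>Elimination with a continuation: \<open>next_col\<close> says that what remains after
  this column costs M. The induction is on the number l of top rows whose entry in column k may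
  still be nonzero.\<close>

lemma clear_column:
  assumes n: "n \<ge> 2" and k: "k < n"
    and next_col: "\<And>A. cols_cleared n p (Suc k) A \<Longrightarrow> A \<in> elem_gen n p M"
    and "l \<le> n" "cols_cleared n p k A" "p dvd A $$ (k, k) - 1"
    and "\<And>i. i < n \<Longrightarrow> l \<le> i \<Longrightarrow> i \<noteq> k \<Longrightarrow> p dvd A $$ (i, k)"
  shows "A \<in> elem_gen n p (M + l)"
  using assms(4-)
proof (induction l arbitrary: A)
  case 0
  have "p dvd A $$ (i, c) - of_bool (i = c)" if "c < Suc k" "i < n" for i c
  proof (cases "c = k")
    case True
    then show ?thesis using 0 that by (cases "i = k") auto
  next
    case False
    then show ?thesis using 0 that by (auto simp: cols_cleared_def)
  qed
  then have "cols_cleared n p (Suc k) A" using 0(2) by (simp add: cols_cleared_def)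
  then show ?case using next_col by simp
next
  case (Suc l)
  note A = Suc.prems(2)
  have c: "A \<in> carrier_mat n n" using A by (simp add: cols_cleared_def)
  show ?case
  proof (cases "l = k")
    case True
    then have "A \<in> elem_gen n p (M + l)" using Suc by (intro Suc.IH) auto
    then show ?thesis using elem_gen_Suc[OF n] by (simp del: elem_gen.simps)
  next
    case False
    let ?B = "addrow (- A $$ (l, k)) l k A"
    have ln: "l < n" using Suc.prems by simp
    have "?B \<in> elem_gen n p (M + l)"
    proof (rule Suc.IH)
      show "l \<le> n" using ln by simp
      show "cols_cleared n p k ?B"
        using cols_cleared_addrow[OF A] k ln False by simp
      show "p dvd ?B $$ (k, k) - 1" using c k ln False Suc.prems(3) by simp
      fix i assume i: "i < n" "l \<le> i" "i \<noteq> k"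
      show "p dvd ?B $$ (i, k)"
      proof (cases "i = l")
        case True
        have "p dvd - A $$ (l, k) * (A $$ (k, k) - 1)" using Suc.prems(3) by (rule dvd_mult)
        then show ?thesis using True c k ln by (simp add: algebra_simps)
      next
        case False
        then show ?thesis using i c k ln Suc.prems(4)[of i] by simp
      qed
    qed
    then show ?thesis
      using elem_gen_addrow[OF c, of l k] ln k False by (simp del: elem_gen.simps)
  qed
qed

text \<open>Row k of the adjugate pairs to 0 with the columns j < k of A. These are unit vectors
  modulo p, so its entries at j < k vanish modulo p. If column k vanished from row k on, the pairing
  with column k, which is det A, would vanish too.\<close>

lemma cols_cleared_pivot:
  assumes p: "prime p" and k: "k < n" and A: "cols_cleared n p k A"
  shows "\<exists>i. k \<le> i \<and> i < n \<and> \<not> p dvd A $$ (i, k)"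
proof (rule ccontr)
  assume "\<not> ?thesis"
  then have col: "p dvd A $$ (i, k)" if "k \<le> i" "i < n" for i using that by auto
  have c: "A \<in> carrier_mat n n" using A by (simp add: cols_cleared_def)
  note adj = adj_mat[OF c]
  define R where "R i = adj_mat A $$ (k, i)" for i
  have RA: "(\<Sum>i = 0..<n. R i * A $$ (i, j)) = of_bool (k = j) * Determinant.det A" if "j < n" for j
  proof -
    have "(adj_mat A * A) $$ (k, j) = (\<Sum>i = 0..<n. R i * A $$ (i, j))"
      using adj(1) c k that by (auto simp: scalar_prod_def R_def)
    then show ?thesis unfolding adj(3) using k that by (cases "k = j") auto
  qed
  have R0: "p dvd R j" if "j < k" for j
  proof -
    have "p dvd (\<Sum>i = 0..<n. R i * A $$ (i, j)) - (\<Sum>i = 0..<n. R i * of_bool (i = j))" (is "p dvd ?x - ?y")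
      by (intro dvd_sum_diff dvd_mult_diff) (use A that in \<open>auto simp: cols_cleared_def\<close>)
    moreover have "?y = (\<Sum>i = 0..<n. if i = j then R i else 0)"
      by (rule sum.cong) auto
    ultimately show ?thesis using RA[of j] that k by simp
  qed
  have "p dvd (\<Sum>i = 0..<n. R i * A $$ (i, k))"
  proof (rule dvd_sum)
    fix i assume "i \<in> {0..<n}"
    then show "p dvd R i * A $$ (i, k)" using R0[of i] col[of i] by (cases "i < k") auto
  qed
  then have "p dvd Determinant.det A" using RA[OF k] by simp
  moreover have "p dvd Determinant.det A - 1" using A by (simp add: cols_cleared_def)
  ultimately have "p dvd Determinant.det A - (Determinant.det A - 1)" by (rule dvd_diff)
  then show False using p by (auto simp: not_prime_unit)
qed

text \<open>With all earlier columns cleared the matrix is upper triangular modulo p with diagonal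
  1, ..., 1, A_kk, so its determinant leaves no choice for the last entry.\<close>

lemma last_pivot:
  assumes n: "n = Suc k" and A: "cols_cleared n p k A"
  shows "p dvd A $$ (k, k) - 1"
proof -
  have c: "A \<in> carrier_mat n n" using A by (simp add: cols_cleared_def)
  define A' where "A' = Matrix.mat n n (\<lambda>(i, j). if j < k then of_bool (i = j) else A $$ (i, j))"
  have c': "A' \<in> carrier_mat n n" by (simp add: A'_def)
  have "mat_cong p A A'"
    by (rule mat_congI[OF c c']) (use A in \<open>auto simp: A'_def cols_cleared_def\<close>)
  then have "p dvd Determinant.det A - Determinant.det A'" by (rule mat_cong_det[OF _ c])
  moreover have "Determinant.det A' = A $$ (k, k)"
  proof -
    have "upper_triangular A'" by (auto simp: A'_def n)
    then have "Determinant.det A' = prod_list (diag_mat A')" by (rule det_upper_triangular[OF _ c'])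
    also have "diag_mat A' = map (\<lambda>i. 1) [0..<k] @ [A $$ (k, k)]"
      by (simp add: diag_mat_def A'_def n)
    also have "prod_list \<dots> = A $$ (k, k)"
    proof -
      have "prod_list (map (\<lambda>i. 1 :: int) xs) = 1" for xs :: "nat list" by (induction xs) auto
      then show ?thesis by simp
    qed
    finally show ?thesis .
  qed
  moreover have "p dvd Determinant.det A - 1" using A by (simp add: cols_cleared_def)
  ultimately have "p dvd (Determinant.det A - 1) - (Determinant.det A - A $$ (k, k))" by (metis dvd_diff)
  then show ?thesis by simp
qed

lemma prime_int_inverse:
  fixes p a :: int
  assumes "prime p" "\<not> p dvd a"
  shows "\<exists>b. p dvd a * b - 1"
proof -
  have "coprime a p" using prime_imp_coprime[OF assms] by (simp add: ac_simps)
  then obtain b where "[a * b = 1] (mod p)" using cong_solve_coprime_int by blast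
  then show ?thesis by (auto simp: cong_iff_dvd_diff)
qed

text \<open>Scaling a row would change the determinant, so the pivot is turned into 1 by adding a
  multiple of a lower row. The cost n + 2 is n for clearing, one for this, and one for creating a
  nonzero entry below the pivot if there is none. In the last column the determinant already fixes
  the pivot.\<close>

lemma eliminate_column:
  assumes n: "n \<ge> 2" and p: "prime p" and k: "k < n"
    and next_col: "\<And>A. cols_cleared n p (Suc k) A \<Longrightarrow> A \<in> elem_gen n p M"
    and A: "cols_cleared n p k A"
  shows "A \<in> elem_gen n p (M + (n + 2))"
proof -
  have clear: "A \<in> elem_gen n p (M + n)" if "cols_cleared n p k A" "p dvd A $$ (k, k) - 1" for A
    using clear_column[OF n k next_col, where l = n] that by auto
  have pivot: "A \<in> elem_gen n p (M + n + 1)"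
    if A: "cols_cleared n p k A" and i: "k < i" "i < n" "\<not> p dvd A $$ (i, k)" for A i
  proof -
    have c: "A \<in> carrier_mat n n" using A by (simp add: cols_cleared_def)
    obtain b where "p dvd A $$ (i, k) * b - 1" using prime_int_inverse[OF p i(3)] by blast
    then have "p dvd (1 - A $$ (k, k)) * (A $$ (i, k) * b - 1)" by (rule dvd_mult)
    then have b: "p dvd (1 - A $$ (k, k)) * b * A $$ (i, k) + A $$ (k, k) - 1" by (simp add: algebra_simps)
    \<comment> \<open>With b inverse to A_ik, this multiple of row i adds 1 - A_kk to the pivot
      modulo p.\<close>
    have "addrow ((1 - A $$ (k, k)) * b) k i A \<in> elem_gen n p (M + n)"
    proof (rule clear)
      show "cols_cleared n p k (addrow ((1 - A $$ (k, k)) * b) k i A)"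
        using cols_cleared_addrow[OF A] i k by simp
      show "p dvd addrow ((1 - A $$ (k, k)) * b) k i A $$ (k, k) - 1" using b c k by simp
    qed
    then show ?thesis using elem_gen_addrow[OF c, of k i] i k by (simp del: elem_gen.simps)
  qed
  have c: "A \<in> carrier_mat n n" using A by (simp add: cols_cleared_def)
  show ?thesis
  proof (cases "n = Suc k")
    case True
    then show ?thesis using elem_gen_mono[OF n clear[OF A last_pivot[OF True A]]] by (simp del: elem_gen.simps)
  next
    case False
    show ?thesis
    proof (cases "\<exists>i. k < i \<and> i < n \<and> \<not> p dvd A $$ (i, k)")
      case True
      then show ?thesis using elem_gen_mono[OF n pivot[OF A]] by (auto simp del: elem_gen.simps)
    next
      case none: False
      then have kk: "\<not> p dvd A $$ (k, k)" using cols_cleared_pivot[OF p k A] by (metis le_neq_implies_less)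
      let ?B = "addrow 1 (Suc k) k A"
      have "\<not> p dvd ?B $$ (Suc k, k)"
      proof -
        have "p dvd A $$ (Suc k, k)" using none False k by auto
        then show ?thesis using kk c k False by (simp add: dvd_add_left_iff)
      qed
      moreover have "cols_cleared n p k ?B" using cols_cleared_addrow[OF A] k False by simp
      ultimately have "?B \<in> elem_gen n p (M + n + 1)" using pivot[of ?B "Suc k"] k False by simp
      then have "A \<in> elem_gen n p (Suc (M + n + 1))"
        by (rule elem_gen_addrow[OF c, rotated 3]) (use k False in auto)
      then show ?thesis by (simp del: elem_gen.simps)
    qed
  qed
qed

theorem elem_gen_det_1:
  assumes n: "n \<ge> 2" and p: "prime p" and A: "A \<in> carrier_mat n n" "p dvd Determinant.det A - 1"
  shows "A \<in> elem_gen n p (n * (n + 2))"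
proof -
  \<comment> \<open>Here d counts the columns still to be cleared.\<close>
  have "A \<in> elem_gen n p (d * (n + 2))" if "d \<le> n" "cols_cleared n p (n - d) A" for d A
    using that
  proof (induction d arbitrary: A)
    case 0
    then show ?case by (auto simp: cols_cleared_def mat_cong_def of_bool_def)
  next
    case (Suc d)
    have "Suc (n - Suc d) = n - d" using Suc.prems by simp
    then have "A \<in> elem_gen n p (d * (n + 2) + (n + 2))"
      using Suc by (intro eliminate_column[OF n p, of "n - Suc d"]) (auto simp del: elem_gen.simps)
    then show ?case by (simp del: elem_gen.simps add: algebra_simps)
  qed
  from this[of n A] A show ?thesis by (simp del: elem_gen.simps add: cols_cleared_def)
qed

section \<open>Short words with prescribed residues\<close>

text \<open>The identity with the 2 by 2 block (a b; c d) placed on rows and columns i, j. Products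
  on a fixed pair of indices thereby become 2 by 2 arithmetic, see \<open>emb_mult\<close>.\<close>

definition emb :: "nat \<Rightarrow> nat \<Rightarrow> nat \<Rightarrow> int \<Rightarrow> int \<Rightarrow> int \<Rightarrow> int \<Rightarrow> int mat" where
  "emb n i j a b c d = Matrix.mat n n (\<lambda>(r, s).
     if r = i \<and> s = i then a else if r = i \<and> s = j then b
     else if r = j \<and> s = i then c else if r = j \<and> s = j then d else of_bool (r = s))"

lemma emb_carrier [simp]: "emb n i j a b c d \<in> carrier_mat n n"
  by (simp add: emb_def)

lemma emb_mult:
  assumes "i < n" "j < n" "i \<noteq> j"
  shows "emb n i j a b c d * emb n i j a' b' c' d'
    = emb n i j (a * a' + b * c') (a * b' + b * d') (c * a' + d * c') (c * b' + d * d')"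
proof (rule eq_matI)
  let ?X = "emb n i j a b c d" and ?Y = "emb n i j a' b' c' d'"
  fix r s assume "r < dim_row (emb n i j (a * a' + b * c') (a * b' + b * d') (c * a' + d * c') (c * b' + d * d'))"
    "s < dim_col (emb n i j (a * a' + b * c') (a * b' + b * d') (c * a' + d * c') (c * b' + d * d'))"
  then have rs: "r < n" "s < n" by (auto simp: emb_def)
  let ?K = "{0..<n} - {i, j}"
  have "(?X * ?Y) $$ (r, s) = (\<Sum>k = 0..<n. ?X $$ (r, k) * ?Y $$ (k, s))"
    using rs by (simp add: scalar_prod_def emb_def)
  also have "{0..<n} = insert i (insert j ?K)" using assms by auto
  also have "(\<Sum>k\<in>\<dots>. ?X $$ (r, k) * ?Y $$ (k, s))
     = ?X $$ (r, i) * ?Y $$ (i, s) + (?X $$ (r, j) * ?Y $$ (j, s) + (\<Sum>k\<in>?K. ?X $$ (r, k) * ?Y $$ (k, s)))"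
    using assms by simp
  also have "(\<Sum>k\<in>?K. ?X $$ (r, k) * ?Y $$ (k, s)) = (\<Sum>k\<in>?K. if k = r then of_bool (r = s) else 0)"
    by (rule sum.cong) (use rs in \<open>auto simp: emb_def\<close>)
  also have "\<dots> = (if r \<in> ?K then of_bool (r = s) else 0)" by simp
  finally show "(?X * ?Y) $$ (r, s)
    = emb n i j (a * a' + b * c') (a * b' + b * d') (c * a' + d * c') (c * b' + d * d') $$ (r, s)"
    using assms rs by (auto simp: emb_def)
qed (auto simp: emb_def)

lemma emb_cong:
  assumes "p dvd a - a'" "p dvd b - b'" "p dvd c - c'" "p dvd d - d'"
  shows "mat_cong p (emb n i j a b c d) (emb n i j a' b' c' d')"
proof (rule mat_congI[OF emb_carrier emb_carrier])
  fix r s assume rs: "r < n" "s < n"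
  show "p dvd emb n i j a b c d $$ (r, s) - emb n i j a' b' c' d' $$ (r, s)"
    unfolding emb_def index_mat(1)[OF rs] prod.case
    using assms by (cases "r = i"; cases "s = i"; cases "r = j"; cases "s = j") simp_all
qed

lemma addrow_mat_emb: "i \<noteq> j \<Longrightarrow> addrow_mat n b i j = emb n i j 1 b 0 1"
  by (rule eq_matI) (auto simp: emb_def)

lemma addrow_mat_emb': "i \<noteq> j \<Longrightarrow> addrow_mat n b j i = emb n i j 1 0 b 1"
  by (rule eq_matI) (auto simp: emb_def)

lemma addrow_mat_0: "i \<noteq> j \<Longrightarrow> addrow_mat n (0::int) i j = 1\<^sub>m n"
  by (rule eq_matI) auto

lemma addrow_mat_add:
  assumes "i < n" "j < n" "i \<noteq> j"
  shows "addrow_mat n a i j * addrow_mat n b i j = addrow_mat n (a + b :: int) i j"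
  using assms by (simp add: addrow_mat_emb emb_mult add.commute)

lemma addrow_mat_cong: "i \<noteq> j \<Longrightarrow> p dvd a - b \<Longrightarrow> mat_cong p (addrow_mat n a i j) (addrow_mat n b i j)"
  by (auto simp: mat_cong_def)

lemma SL_int_inverse_comm:
  assumes A: "A \<in> SL_int n" and B: "B \<in> carrier_mat n n" and AB: "A * B = 1\<^sub>m n"
  shows "B * A = 1\<^sub>m n"
proof -
  have c: "A \<in> carrier_mat n n" and d: "Determinant.det A = 1" using A by (auto simp: SL_int_def)
  note adj = adj_mat[OF c]
  have one: "adj_mat A * A = 1\<^sub>m n" using adj(3) d by auto
  have "adj_mat A = adj_mat A * (A * B)" using adj(1) AB by simp
  also have "\<dots> = (adj_mat A * A) * B" using adj(1) c B by (simp add: assoc_mult_mat)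
  also have "\<dots> = B" using one B by simp
  finally show ?thesis using one by simp
qed

lemma mat_cong_inverse:
  assumes "x \<in> carrier_mat n n" "x' \<in> carrier_mat n n" "x * x' = 1\<^sub>m n" "mat_cong a x (1\<^sub>m n)"
  shows "mat_cong a x' (1\<^sub>m n)"
proof -
  have "mat_cong a (x * x') (1\<^sub>m n * x')"
    using assms by (intro mat_cong_mult_carrier[of _ _ _ _ _ n n n]) auto
  then show ?thesis using assms by (intro mat_cong_sym[of a "1\<^sub>m n"]) simp
qed

section \<open>Words in the generators of SL(n, Z)\<close>

locale SL_generators =
  fixes n :: nat and S :: "int mat set"
  assumes n2: "n \<ge> 2" and S_sub: "S \<subseteq> SL_int n" and S_fin: "finite S"
    and S_sym: "\<forall>A\<in>S. \<exists>B\<in>S. A * B = 1\<^sub>m n" and S_gen: "gen_by n S = SL_int n"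
begin

lemma mprod_snoc [simp]: "mprod n (xs @ [s]) = mprod n xs * s"
  by (simp add: mprod_def)

lemma mprod_Nil [simp]: "mprod n [] = 1\<^sub>m n"
  by (simp add: mprod_def)

lemma S_carrier: "s \<in> S \<Longrightarrow> s \<in> carrier_mat n n"
  using S_sub by (auto simp: SL_int_def)

lemma mprod_SL: "set xs \<subseteq> S \<Longrightarrow> mprod n xs \<in> SL_int n"
proof (induction xs rule: rev_induct)
  case (snoc s xs)
  then have "mprod n xs \<in> SL_int n" "s \<in> SL_int n" using S_sub by auto
  then show ?case by (auto simp: SL_int_def det_mult[of _ n])
qed (simp add: SL_int_def)

lemma mprod_carrier: "set xs \<subseteq> S \<Longrightarrow> mprod n xs \<in> carrier_mat n n"
  using mprod_SL by (auto simp: SL_int_def)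

lemma mprod_append: "set xs \<subseteq> S \<Longrightarrow> set ys \<subseteq> S \<Longrightarrow> mprod n (xs @ ys) = mprod n xs * mprod n ys"
proof (induction ys rule: rev_induct)
  case Nil
  then show ?case using mprod_carrier[of xs] by simp
next
  case (snoc s ys)
  then have "mprod n (xs @ ys @ [s]) = (mprod n xs * mprod n ys) * s"
    unfolding append_assoc[symmetric] mprod_snoc by simp
  also have "\<dots> = mprod n xs * (mprod n ys * s)"
    using snoc.prems by (intro assoc_mult_mat[of _ n n _ n _ n]) (auto simp: mprod_carrier S_carrier)
  finally show ?case by simp
qed

text \<open>Even length matches the diameter hypothesis of \<open>mixing\<close>. It also lets the
  identity be spelled s s^-1, so that words can be padded and \<open>W\<close> increases with
  m.\<close>

definition W :: "nat \<Rightarrow> int mat set" where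
  "W m = mprod n ` words S (2 * m)"

lemma W_SL: "x \<in> W m \<Longrightarrow> x \<in> SL_int n"
  using mprod_SL by (auto simp: W_def words_def)

lemma W_carrier: "x \<in> W m \<Longrightarrow> x \<in> carrier_mat n n"
  using W_SL by (auto simp: SL_int_def)

lemma W_mult: "x \<in> W a \<Longrightarrow> y \<in> W b \<Longrightarrow> x * y \<in> W (a + b)"
proof -
  assume "x \<in> W a" "y \<in> W b"
  then obtain xs ys where "xs \<in> words S (2 * a)" "x = mprod n xs" "ys \<in> words S (2 * b)" "y = mprod n ys"
    unfolding W_def by blast
  then have "xs @ ys \<in> words S (2 * (a + b))" "x * y = mprod n (xs @ ys)"
    using words_append[of xs S "2 * a" ys "2 * b"] mprod_append[of xs ys]
    by (auto simp: words_def)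
  then show ?thesis unfolding W_def by blast
qed

lemma gen_words: "g \<in> gen_by n S \<Longrightarrow> \<exists>m. g \<in> mprod n ` words S m"
proof (induction rule: gen_by.induct)
  case one
  have "1\<^sub>m n \<in> mprod n ` words S 0" by simp
  then show ?case by blast
next
  case (mult A s)
  then obtain m xs where "xs \<in> words S m" "A = mprod n xs" by blast
  then have "xs @ [s] \<in> words S (Suc m)" "A * s = mprod n (xs @ [s])" using mult by (auto simp: words_def)
  then show ?case by blast
next
  case (mult_inv A s B)
  obtain t where t: "t \<in> S" "s * t = 1\<^sub>m n" using S_sym mult_inv by blast
  have ts: "t * s = 1\<^sub>m n" using SL_int_inverse_comm[of s n t] t mult_inv S_sub S_carrier by blast
  have "B = (t * s) * B" using ts mult_inv by simp
  also have "\<dots> = t * (s * B)"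
    using t mult_inv S_carrier by (intro assoc_mult_mat[of _ n n _ n _ n]) auto
  also have "\<dots> = t" using mult_inv S_carrier[OF t(1)] by simp
  finally have "B = t" .
  obtain m xs where "xs \<in> words S m" "A = mprod n xs" using mult_inv by blast
  then have "xs @ [t] \<in> words S (Suc m)" "A * B = mprod n (xs @ [t])"
    using t \<open>B = t\<close> by (auto simp: words_def)
  then show ?case by blast
qed

lemma addrow_mat_SL: "i < n \<Longrightarrow> j < n \<Longrightarrow> i \<noteq> j \<Longrightarrow> addrow_mat n b i j \<in> SL_int n"
  by (simp add: SL_int_def det_addrow_mat)

lemma S_ne: "S \<noteq> {}"
proof
  assume "S = {}"
  have "addrow_mat n 1 0 1 \<in> gen_by n S" using addrow_mat_SL[of 0 1 1] S_gen n2 by simp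
  then obtain m where "addrow_mat n 1 0 1 \<in> mprod n ` words S m" using gen_words by blast
  then have "addrow_mat n (1::int) 0 1 = 1\<^sub>m n" using \<open>S = {}\<close> by (auto simp: words_def)
  then have "addrow_mat n (1::int) 0 1 $$ (0, 1) = 1\<^sub>m n $$ (0, 1)" by simp
  then show False using n2 by simp
qed

lemma one_W1: "1\<^sub>m n \<in> W 1"
proof -
  obtain s where s: "s \<in> S" using S_ne by blast
  then obtain t where t: "t \<in> S" "s * t = 1\<^sub>m n" using S_sym by blast
  have "mprod n ([] @ [s] @ [t]) = 1\<^sub>m n"
    unfolding append_assoc[symmetric] mprod_snoc using t S_carrier[OF s] S_carrier[OF t(1)] by simp
  moreover have "[] @ [s] @ [t] \<in> words S (2 * 1)" using s t by (simp add: words_def)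
  ultimately show ?thesis unfolding W_def by (metis image_eqI)
qed

lemma W_mono: "x \<in> W a \<Longrightarrow> a \<le> b \<Longrightarrow> x \<in> W b"
proof -
  assume x: "x \<in> W a" and "a \<le> b"
  then obtain d where "b = a + d" using le_Suc_ex by blast
  moreover have "x \<in> W (a + d)"
  proof (induction d)
    case (Suc d)
    then have "x * 1\<^sub>m n \<in> W (a + d + 1)" using W_mult one_W1 by blast
    then show ?case using W_carrier[OF x] by simp
  qed (simp add: x)
  ultimately show ?thesis by simp
qed

lemma mprod_inverse:
  "xs \<in> words S m \<Longrightarrow> \<exists>ys\<in>words S m. mprod n xs * mprod n ys = 1\<^sub>m n"
proof (induction m arbitrary: xs)
  case (Suc m)
  then obtain zs s where zs: "xs = zs @ [s]" "zs \<in> words S m" "s \<in> S"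
    by (cases xs rule: rev_cases) (auto simp: words_def)
  obtain ys where ys: "ys \<in> words S m" "mprod n zs * mprod n ys = 1\<^sub>m n" using Suc.IH zs by blast
  obtain t where t: "t \<in> S" "s * t = 1\<^sub>m n" using S_sym zs by blast
  have sub: "set zs \<subseteq> S" "set ys \<subseteq> S" using zs ys by (auto simp: words_def)
  note car = mprod_carrier[OF sub(1)] mprod_carrier[OF sub(2)] S_carrier[OF t(1)] S_carrier[OF zs(3)]
  have "mprod n ([t] @ ys) = t * mprod n ys"
    using mprod_append[of "[t]" ys] t sub car by (simp add: mprod_def)
  then have "mprod n xs * mprod n ([t] @ ys) = (mprod n zs * s) * (t * mprod n ys)" using zs by simp
  also have "\<dots> = mprod n zs * ((s * t) * mprod n ys)"
    using car by (simp add: assoc_mult_mat[of _ n n _ n _ n])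
  also have "\<dots> = 1\<^sub>m n" using t ys car by simp
  finally have "mprod n xs * mprod n ([t] @ ys) = 1\<^sub>m n" .
  moreover have "[t] @ ys \<in> words S (Suc m)" using t ys by (auto simp: words_def)
  ultimately show ?case by blast
qed simp

lemma W_inverse:
  assumes "x \<in> W m"
  shows "\<exists>x'\<in>W m. x * x' = 1\<^sub>m n \<and> x' * x = 1\<^sub>m n"
proof -
  obtain x' where "x' \<in> W m" "x * x' = 1\<^sub>m n" using assms mprod_inverse unfolding W_def by blast
  then show ?thesis using SL_int_inverse_comm[of x n x'] W_SL[OF assms] W_carrier by blast
qed

text \<open>A word for the elementary matrix with entry 1 may have odd length; repeating it twice
  gives even length and entry 2. This is the origin of the 2 in all later statements.\<close>

lemma elementary_square_words: "\<exists>C>0. \<forall>i<n. \<forall>j<n. i \<noteq> j \<longrightarrow> addrow_mat n 2 i j \<in> W C"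
proof -
  have "\<exists>m. addrow_mat n 2 i j \<in> W m" if ij: "i < n" "j < n" "i \<noteq> j" for i j
  proof -
    obtain m where "addrow_mat n 1 i j \<in> mprod n ` words S m"
      using gen_words addrow_mat_SL[OF ij] S_gen by blast
    then obtain xs where xs: "xs \<in> words S m" "addrow_mat n 1 i j = mprod n xs" by blast
    then have "mprod n (xs @ xs) = addrow_mat n 2 i j"
      using mprod_append[of xs xs] addrow_mat_add[OF ij, of 1 1] by (auto simp: words_def)
    moreover have "xs @ xs \<in> words S (2 * m)" using words_append[OF xs(1) xs(1)] by (simp add: mult_2)
    ultimately show ?thesis unfolding W_def by (metis image_eqI)
  qed
  then obtain f where f: "\<And>i j. i < n \<Longrightarrow> j < n \<Longrightarrow> i \<noteq> j \<Longrightarrow> addrow_mat n 2 i j \<in> W (f i j)" by metis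
  have "f i j \<le> Suc (\<Sum>i<n. \<Sum>j<n. f i j)" if "i < n" "j < n" for i j
  proof -
    have "f i j \<le> (\<Sum>j<n. f i j)" using that by (intro member_le_sum) auto
    also have "\<dots> \<le> (\<Sum>i<n. \<Sum>j<n. f i j)" using that by (intro member_le_sum[where f = "\<lambda>i. \<Sum>j<n. f i j"]) auto
    finally show ?thesis by simp
  qed
  then have "\<forall>i<n. \<forall>j<n. i \<noteq> j \<longrightarrow> addrow_mat n 2 i j \<in> W (Suc (\<Sum>i<n. \<Sum>j<n. f i j))"
    using f W_mono by blast
  then show ?thesis by blast
qed

section \<open>Words trivial modulo a set of primes\<close>

definition reach :: "int \<Rightarrow> int set \<Rightarrow> nat \<Rightarrow> bool" where
  "reach p A L \<longleftrightarrow> (\<forall>i<n. \<forall>j<n. i \<noteq> j \<longrightarrow> (\<forall>b. \<exists>w\<in>W L.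
     mat_cong p w (addrow_mat n b i j) \<and> (\<forall>a\<in>A. mat_cong a w (1\<^sub>m n))))"

lemma reachD:
  assumes "reach p A L" "i < n" "j < n" "i \<noteq> j"
  obtains w where "w \<in> W L" "mat_cong p w (addrow_mat n b i j)" "\<And>a. a \<in> A \<Longrightarrow> mat_cong a w (1\<^sub>m n)"
  using assms(1)[unfolded reach_def, rule_format, OF assms(2-4), of b] by blast

lemma reach_mono: "reach p A L \<Longrightarrow> A' \<subseteq> A \<Longrightarrow> L \<le> L' \<Longrightarrow> reach p A' L'"
proof -
  assume r: "reach p A L" and sub: "A' \<subseteq> A" "L \<le> L'"
  show ?thesis unfolding reach_def
  proof (intro allI impI)
    fix i j b assume "i < n" "j < n" "i \<noteq> j"
    then obtain w where "w \<in> W L" "mat_cong p w (addrow_mat n b i j)" "\<And>a. a \<in> A \<Longrightarrow> mat_cong a w (1\<^sub>m n)"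
      using reachD[OF r, of i j b] by blast
    then show "\<exists>w\<in>W L'. mat_cong p w (addrow_mat n b i j) \<and> (\<forall>a\<in>A'. mat_cong a w (1\<^sub>m n))"
      using sub W_mono by blast
  qed
qed

text \<open>The entry 2 a c is divisible by a, and some c in [0, p) makes it b modulo p because 2 a
  is invertible there. The word is the one for entry 2 repeated a c times; a length polynomial in
  the primes is good enough.\<close>

lemma reach_single:
  assumes C: "\<forall>i<n. \<forall>j<n. i \<noteq> j \<longrightarrow> addrow_mat n 2 i j \<in> W C"
    and p: "prime p" "p > 2" and a: "a > 0" "\<not> p dvd a"
  shows "reach p {a} (C * nat (a * p))"
  unfolding reach_def
proof (intro allI impI)
  fix i j b assume ij: "i < n" "j < n" "i \<noteq> j"
  have pow: "addrow_mat n (2 * int k) i j \<in> W (C * k)" for k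
  proof (induction k)
    case 0
    have "1\<^sub>m n \<in> W 0" by (simp add: W_def)
    then show ?case using ij addrow_mat_0 by simp
  next
    case (Suc k)
    then have "addrow_mat n (2 * int k) i j * addrow_mat n 2 i j \<in> W (C * k + C)"
      using C ij W_mult by blast
    then show ?case using ij by (simp add: addrow_mat_add algebra_simps)
  qed
  have "\<not> p dvd 2" using p by (auto dest: zdvd_imp_le)
  then have "\<not> p dvd 2 * a" using a p by (simp add: prime_dvd_mult_iff)
  then obtain c0 where c0: "p dvd (2 * a) * c0 - 1" using prime_int_inverse[OF p(1)] by blast
  define c where "c = (c0 * b) mod p"
  have c: "0 \<le> c" "c < p" using p by (auto simp: c_def)
  have "p dvd c - c0 * b" by (simp add: c_def mod_eq_dvd_iff[symmetric])
  then have "p dvd 2 * a * (c - c0 * b) + b * ((2 * a) * c0 - 1)" using c0 by (intro dvd_add dvd_mult)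
  then have cb: "p dvd 2 * (a * c) - b" by (simp add: algebra_simps)
  have ac: "0 \<le> a * c" "a * c \<le> a * p" using a c by auto
  define w where "w = addrow_mat n (2 * (a * c)) i j"
  have "w \<in> W (C * nat (a * c))" using pow[of "nat (a * c)"] ac by (simp add: w_def)
  then have "w \<in> W (C * nat (a * p))" by (rule W_mono) (use ac in \<open>auto intro: nat_mono\<close>)
  moreover have "mat_cong p w (addrow_mat n b i j)"
    unfolding w_def using ij cb by (intro addrow_mat_cong)
  moreover have "mat_cong a w (1\<^sub>m n)"
    unfolding w_def addrow_mat_0[OF ij(3), symmetric] using ij by (intro addrow_mat_cong) auto
  ultimately show "\<exists>w\<in>W (C * nat (a * p)). mat_cong p w (addrow_mat n b i j) \<and> (\<forall>a\<in>{a}. mat_cong a w (1\<^sub>m n))"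
    by blast
qed

text \<open>The torus element diag(2,1/2) is a product of five elementary matrices; its commutator with
  an elementary matrix is again elementary, and a commutator of words is trivial modulo every
  prime modulo which one of the two words is.\<close>

lemma reach_commutator:
  assumes p: "prime p" "p > 3" and A: "reach p A L" and B: "reach p B L"
  shows "reach p (A \<union> B) (12 * L)"
  unfolding reach_def
proof (intro allI impI)
  fix i j b assume ij: "i < n" "j < n" "i \<noteq> j"
  let ?E = "emb n i j"
  have "\<not> p dvd 2" "\<not> p dvd 3" using p by (auto dest: zdvd_imp_le)
  then obtain v t where v: "p dvd 2 * v - 1" and t: "p dvd 3 * t - 1"
    using prime_int_inverse[OF p(1)] by blast
  \<comment> \<open>The commutator of diag(2, 1/2) with the elementary matrix of entry \<beta> has
    entry 4 \<beta> - \<beta>, so \<beta> is b / 3. Here v and t are 1/2 and 1/3 modulo p, whence p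
    > 3.\<close>
  define \<beta> where "\<beta> = t * b"
  have \<beta>: "p dvd 3 * \<beta> - b"
    using dvd_mult2[OF t, of b] by (simp add: \<beta>_def algebra_simps)
  obtain x1 where x1: "x1 \<in> W L" "mat_cong p x1 (addrow_mat n 2 i j)" "\<And>a. a \<in> A \<Longrightarrow> mat_cong a x1 (1\<^sub>m n)"
    using reachD[OF A ij, of 2] by blast
  obtain x2 where x2: "x2 \<in> W L" "mat_cong p x2 (addrow_mat n (- v) j i)" "\<And>a. a \<in> A \<Longrightarrow> mat_cong a x2 (1\<^sub>m n)"
    using reachD[OF A ij(2,1) ij(3)[symmetric], of "- v"] by blast
  obtain x3 where x3: "x3 \<in> W L" "mat_cong p x3 (addrow_mat n 1 i j)" "\<And>a. a \<in> A \<Longrightarrow> mat_cong a x3 (1\<^sub>m n)"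
    using reachD[OF A ij, of 1] by blast
  obtain x4 where x4: "x4 \<in> W L" "mat_cong p x4 (addrow_mat n 1 j i)" "\<And>a. a \<in> A \<Longrightarrow> mat_cong a x4 (1\<^sub>m n)"
    using reachD[OF A ij(2,1) ij(3)[symmetric], of 1] by blast
  obtain x5 where x5: "x5 \<in> W L" "mat_cong p x5 (addrow_mat n (- 1) i j)" "\<And>a. a \<in> A \<Longrightarrow> mat_cong a x5 (1\<^sub>m n)"
    using reachD[OF A ij, of "- 1"] by blast
  obtain y where y: "y \<in> W L" "mat_cong p y (addrow_mat n \<beta> i j)" "\<And>a. a \<in> B \<Longrightarrow> mat_cong a y (1\<^sub>m n)"
    using reachD[OF B ij, of \<beta>] by blast
  have mult5: "mat_cong m (z1 * z2 * z3 * z4 * z5) (z1' * z2' * z3' * z4' * z5')"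
    if "mat_cong m z1 z1'" "mat_cong m z2 z2'" "mat_cong m z3 z3'" "mat_cong m z4 z4'" "mat_cong m z5 z5'"
      "z1 \<in> carrier_mat n n" "z2 \<in> carrier_mat n n" "z3 \<in> carrier_mat n n" "z4 \<in> carrier_mat n n" "z5 \<in> carrier_mat n n"
    for z1 z2 z3 z4 z5 z1' z2' z3' z4' z5' :: "int mat" and m :: int
    using that by (intro mat_cong_mult_carrier[of _ _ _ _ _ n n n]) auto
  \<comment> \<open>Modulo p the five factors multiply to diag(2, 1 - v), and 1 - v is congruent to
    v.\<close>
  define x where "x = x1 * x2 * x3 * x4 * x5"
  have "x \<in> W (L + L + L + L + L)" unfolding x_def using x1 x2 x3 x4 x5 by (intro W_mult)
  moreover have "L + L + L + L + L = 5 * L" by simp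
  ultimately have xW: "x \<in> W (5 * L)" by simp
  have xA: "mat_cong a x (1\<^sub>m n)" if "a \<in> A" for a
    using mult5[of a x1 "1\<^sub>m n" x2 "1\<^sub>m n" x3 "1\<^sub>m n" x4 "1\<^sub>m n" x5 "1\<^sub>m n"] x1 x2 x3 x4 x5 that W_carrier
    unfolding x_def by simp
  have "mat_cong p x (?E 1 2 0 1 * ?E 1 0 (- v) 1 * ?E 1 1 0 1 * ?E 1 0 1 1 * ?E 1 (- 1) 0 1)"
    unfolding x_def
    by (rule mult5) (use x1 x2 x3 x4 x5 W_carrier addrow_mat_emb[OF ij(3)] addrow_mat_emb'[OF ij(3)] in auto)
  also have "mat_cong p \<dots> (?E 2 0 0 v)"
  proof -
    have "p dvd (2 * v - 1) * (- 2)" "p dvd (2 * v - 1) * (- 1)" using v by (intro dvd_mult2; simp)+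
    then show ?thesis
      unfolding emb_mult[OF ij] by (intro emb_cong) (use v in \<open>auto simp: algebra_simps dvd_diff_commute\<close>)
  qed
  finally have xp: "mat_cong p x (?E 2 0 0 v)" .
  have yp: "mat_cong p y (?E 1 \<beta> 0 1)" using y addrow_mat_emb[OF ij(3)] by simp
  obtain x' where x': "x' \<in> W (5 * L)" "x * x' = 1\<^sub>m n" using W_inverse[OF xW] by blast
  obtain y' where y': "y' \<in> W L" "y * y' = 1\<^sub>m n" using W_inverse[OF y(1)] by blast
  note car = W_carrier[OF xW] W_carrier[OF x'(1)] W_carrier[OF y(1)] W_carrier[OF y'(1)]
  \<comment> \<open>Two words of length parameter 5 L and two of L make up the factor 12.\<close>
  define w where "w = x * y * x' * y'"
  have "w \<in> W (5 * L + L + 5 * L + L)" unfolding w_def using xW x' y y' by (intro W_mult)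
  moreover have "5 * L + L + 5 * L + L = 12 * L" by simp
  ultimately have "w \<in> W (12 * L)" by simp
  moreover have "mat_cong a w (1\<^sub>m n)" if "a \<in> A" for a
  proof -
    have "mat_cong a x' (1\<^sub>m n)" using mat_cong_inverse[OF car(1,2) x'(2) xA[OF that]] .
    then have "mat_cong a w (1\<^sub>m n * y * 1\<^sub>m n * y')"
      unfolding w_def using car xA[OF that] by (intro mat_cong_mult_carrier[of _ _ _ _ _ n n n]) auto
    also have "1\<^sub>m n * y * 1\<^sub>m n * y' = 1\<^sub>m n" using car y' by simp
    finally show ?thesis .
  qed
  moreover have "mat_cong a w (1\<^sub>m n)" if "a \<in> B" for a
  proof -
    have "mat_cong a y' (1\<^sub>m n)" using mat_cong_inverse[OF car(3,4) y'(2) y(3)[OF that]] .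
    then have "mat_cong a w (x * 1\<^sub>m n * x' * 1\<^sub>m n)"
      unfolding w_def using car y(3)[OF that] by (intro mat_cong_mult_carrier[of _ _ _ _ _ n n n]) auto
    also have "x * 1\<^sub>m n * x' * 1\<^sub>m n = 1\<^sub>m n" using car x' by simp
    finally show ?thesis .
  qed
  moreover have "mat_cong p w (addrow_mat n b i j)"
  proof -
    \<comment> \<open>The commutator relation is checked as x y = E(b) y x modulo p, with E(b) the
      elementary matrix wanted, so the inverses enter only through x x' = 1 and y y' = 1.\<close>
    have "mat_cong p (x * y) (?E 2 0 0 v * ?E 1 \<beta> 0 1)"
      using car xp yp by (intro mat_cong_mult_carrier[of _ _ _ _ _ n n n]) auto
    also have "mat_cong p \<dots> (?E 1 b 0 1 * ?E 1 \<beta> 0 1 * ?E 2 0 0 v)"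
    proof -
      have "p dvd - (2 * \<beta>) * (2 * v - 1) + v * (3 * \<beta> - b)" using v \<beta> by (intro dvd_add dvd_mult)
      then show ?thesis
        unfolding emb_mult[OF ij] by (intro emb_cong) (auto simp: algebra_simps)
    qed
    also have "mat_cong p \<dots> (?E 1 b 0 1 * y * x)"
      by (rule mat_cong_sym)
         (use car xp yp in \<open>intro mat_cong_mult_carrier[of _ _ _ _ _ n n n] mult_carrier_mat[of _ n n _ n], auto\<close>)
    finally have xy: "mat_cong p (x * y) (?E 1 b 0 1 * y * x)" .
    have xy_car: "x * y \<in> carrier_mat n n" "x * y * x' \<in> carrier_mat n n" using car by auto
    have "mat_cong p w (?E 1 b 0 1 * y * x * x' * y')"
      unfolding w_def
      using mat_cong_mult_carrier[OF mat_cong_mult_carrier[OF xy mat_cong_refl xy_car(1) car(2)]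
          mat_cong_refl xy_car(2) car(4)] .
    also have "?E 1 b 0 1 * y * x * x' * y' = ?E 1 b 0 1 * y * (x * x') * y'"
      using car by (subst assoc_mult_mat[of _ n n x n x' n]) (auto intro: mult_carrier_mat[of _ n n _ n])
    also have "\<dots> = ?E 1 b 0 1 * y * y'"
      using car x' by (subst x'(2), subst right_mult_one_mat[of _ n n]) (auto intro: mult_carrier_mat[of _ n n _ n])
    also have "\<dots> = ?E 1 b 0 1 * (y * y')"
      using car by (intro assoc_mult_mat[of _ n n _ n _ n]) auto
    also have "\<dots> = addrow_mat n b i j"
      using y' addrow_mat_emb[OF ij(3)] right_mult_one_mat[OF emb_carrier] by simp
    finally show ?thesis .
  qed
  ultimately show "\<exists>w\<in>W (12 * L). mat_cong p w (addrow_mat n b i j) \<and> (\<forall>a\<in>A \<union> B. mat_cong a w (1\<^sub>m n))"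
    by blast
qed

text \<open>Halving \<open>A\<close> nests the commutators only t deep, so 12^t stays polynomial in
  the number of primes; adjoining one prime at a time would give an exponential length. The factor
  x^2 bounds the product a p of the base case.\<close>

lemma reach_doubling:
  assumes C: "\<forall>i<n. \<forall>j<n. i \<noteq> j \<longrightarrow> addrow_mat n 2 i j \<in> W C"
    and p: "prime p" "p > 3" "p \<le> int x"
  shows "finite A \<Longrightarrow> card A \<le> 2 ^ t \<Longrightarrow> (\<And>a. a \<in> A \<Longrightarrow> prime a \<and> a \<noteq> p \<and> a \<le> int x)
    \<Longrightarrow> reach p A (12 ^ t * (C * x ^ 2))"
proof (induction t arbitrary: A)
  case 0
  have bound: "C * nat (a * p) \<le> C * x ^ 2" if "0 < a" "a \<le> int x" for a
  proof -
    have "a * p \<le> int x * int x" using that p by (intro mult_mono) auto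
    then show ?thesis by (simp add: power2_eq_square nat_le_iff)
  qed
  \<comment> \<open>The set may also be empty here; then a = 1 serves as modulus.\<close>
  have "\<exists>a. A \<subseteq> {a} \<and> 0 < a \<and> a \<le> int x \<and> \<not> p dvd a"
  proof (cases "A = {}")
    case True
    then show ?thesis using p by (intro exI[of _ 1]) (auto dest: zdvd_imp_le)
  next
    case False
    then have "card A = 1" using 0 by (simp add: card_gt_0_iff le_antisym Suc_le_eq)
    then obtain a where a: "A = {a}" using card_1_singletonE by blast
    then have "prime a" "a \<noteq> p" "a \<le> int x" using 0 by auto
    moreover have "\<not> p dvd a" using \<open>prime a\<close> \<open>a \<noteq> p\<close> p(1) primes_dvd_imp_eq by blast
    ultimately show ?thesis using a prime_gt_0_int by blast
  qed
  then obtain a where a: "A \<subseteq> {a}" "0 < a" "a \<le> int x" "\<not> p dvd a" by blast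
  have "reach p {a} (C * nat (a * p))" using reach_single[OF C p(1) _ a(2,4)] p by simp
  then show ?case using reach_mono[OF _ a(1)] bound[OF a(2,3)] by simp
next
  case (Suc t)
  obtain A1 where A1: "A1 \<subseteq> A" "card A1 \<le> 2 ^ t" "card (A - A1) \<le> 2 ^ t"
  proof (cases "card A \<le> 2 ^ t")
    case True
    then show ?thesis using that[of A] by simp
  next
    case False
    then obtain B where "B \<subseteq> A" "card B = 2 ^ t" by (meson obtain_subset_with_card_n nat_le_linear)
    then show ?thesis using that[of B] Suc.prems by (simp add: card_Diff_subset finite_subset)
  qed
  have "reach p (A1 \<union> (A - A1)) (12 * (12 ^ t * (C * x ^ 2)))"
    using A1 Suc.prems by (intro reach_commutator p Suc.IH) (auto intro: finite_subset)
  then show ?case using A1 by (simp add: Un_absorb1 algebra_simps)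
qed

text \<open>Elimination writes g modulo p with n (n + 2) elementary factors. Each is replaced by a
  word trivial modulo \<open>A\<close>, and triviality survives multiplication.\<close>

lemma reach_all:
  assumes p: "prime p" and A: "reach p A L"
    and g: "g \<in> carrier_mat n n" "p dvd Determinant.det g - 1"
  shows "\<exists>w\<in>W (n * (n + 2) * L). mat_cong p w g \<and> (\<forall>a\<in>A. mat_cong a w (1\<^sub>m n))"
proof -
  have "\<exists>w\<in>W (N * L). mat_cong p w g \<and> (\<forall>a\<in>A. mat_cong a w (1\<^sub>m n))" if "g \<in> elem_gen n p N" for N g
    using that
  proof (induction N arbitrary: g)
    case 0
    have "1\<^sub>m n \<in> W (0 * L)" by (simp add: W_def)
    moreover have "mat_cong p (1\<^sub>m n) g" using 0 by (auto intro: mat_cong_sym)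
    ultimately show ?case by (intro bexI[of _ "1\<^sub>m n"]) auto
  next
    case (Suc N)
    then obtain i j b B where B: "i < n" "j < n" "i \<noteq> j" "B \<in> elem_gen n p N"
      "mat_cong p g (addrow_mat n b i j * B)" by auto
    obtain w where w: "w \<in> W (N * L)" "mat_cong p w B" "\<forall>a\<in>A. mat_cong a w (1\<^sub>m n)"
      using Suc.IH B by blast
    obtain e where e: "e \<in> W L" "mat_cong p e (addrow_mat n b i j)" "\<And>a. a \<in> A \<Longrightarrow> mat_cong a e (1\<^sub>m n)"
      using reachD[OF A B(1-3), of b] by blast
    note car = W_carrier[OF w(1)] W_carrier[OF e(1)]
    have "e * w \<in> W (Suc N * L)" using W_mult[OF e(1) w(1)] by simp
    moreover have "mat_cong p (e * w) g"
      using mat_cong_mult_carrier[OF e(2) w(2) car(2,1)] B(5) mat_cong_sym mat_cong_trans by blast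
    moreover have "mat_cong a (e * w) (1\<^sub>m n)" if "a \<in> A" for a
      using mat_cong_mult_carrier[OF e(3)[OF that] bspec[OF w(3) that] car(2,1)] by simp
    ultimately show ?case by blast
  qed
  from this[OF elem_gen_det_1[OF n2 p g]] show ?thesis .
qed

text \<open>Chinese remaindering in words: for each p a word hits \<open>G p\<close> modulo p and is
  trivial modulo the other primes; the product of these words has all the residues.\<close>

theorem simultaneous_words:
  assumes C: "\<forall>i<n. \<forall>j<n. i \<noteq> j \<longrightarrow> addrow_mat n 2 i j \<in> W C"
    and Q: "finite Q" "card Q \<le> 2 ^ t" "\<And>p. p \<in> Q \<Longrightarrow> prime p \<and> 3 < p \<and> p \<le> int x"
    and G: "\<And>p. p \<in> Q \<Longrightarrow> G p \<in> carrier_mat n n \<and> p dvd Determinant.det (G p) - 1"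
  shows "\<exists>w\<in>W (card Q * (n * (n + 2) * (12 ^ t * (C * x ^ 2)))). \<forall>p\<in>Q. mat_cong p w (G p)"
proof -
  define K where "K = n * (n + 2) * (12 ^ t * (C * x ^ 2))"
  \<comment> \<open>Triviality modulo the untreated primes is carried along, so that the factor
    added for the next prime alone decides the residue there.\<close>
  have "\<exists>w\<in>W (card Q' * K). (\<forall>p\<in>Q'. mat_cong p w (G p)) \<and> (\<forall>p\<in>Q - Q'. mat_cong p w (1\<^sub>m n))"
    if "Q' \<subseteq> Q" for Q'
    using finite_subset[OF that Q(1)] that
  proof (induction Q' rule: finite_induct)
    case empty
    have "1\<^sub>m n \<in> W (card {} * K)" by (simp add: W_def)
    then show ?case by (intro bexI[of _ "1\<^sub>m n"]) auto
  next
    case (insert p Q')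
    then obtain w where w: "w \<in> W (card Q' * K)" "\<And>q. q \<in> Q' \<Longrightarrow> mat_cong q w (G q)"
      "\<And>q. q \<in> Q - Q' \<Longrightarrow> mat_cong q w (1\<^sub>m n)" by blast
    have p: "p \<in> Q" using insert by simp
    have "reach p (Q - {p}) (12 ^ t * (C * x ^ 2))"
    proof (rule reach_doubling[OF C])
      show "card (Q - {p}) \<le> 2 ^ t" using Q(2) card_Diff1_le[of Q p] by linarith
    qed (use Q p in auto)
    then obtain v where v: "v \<in> W K" "mat_cong p v (G p)" "\<And>a. a \<in> Q - {p} \<Longrightarrow> mat_cong a v (1\<^sub>m n)"
      unfolding K_def using reach_all[of p "Q - {p}" _ "G p"] Q(3)[OF p] G[OF p] by blast
    note car = W_carrier[OF v(1)] W_carrier[OF w(1)]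
    have "v * w \<in> W (K + card Q' * K)" using W_mult[OF v(1) w(1)] .
    then have "v * w \<in> W (card (insert p Q') * K)" using insert by simp
    moreover have "mat_cong p (v * w) (G p)"
      using mat_cong_mult_carrier[OF v(2) w(3)[of p] car] right_mult_one_mat[of "G p" n n] G[OF p] p insert.hyps(2)
      by simp
    moreover have "mat_cong q (v * w) (G q)" if "q \<in> Q'" for q
    proof -
      have "q \<in> Q - {p}" using that insert by auto
      then show ?thesis
        using mat_cong_mult_carrier[OF v(3)[of q] w(2)[OF that] car] left_mult_one_mat[of "G q" n n] G[of q]
        by simp
    qed
    moreover have "mat_cong q (v * w) (1\<^sub>m n)" if "q \<in> Q - insert p Q'" for q
      using mat_cong_mult_carrier[OF v(3)[of q] w(3)[of q] car] that by simp
    ultimately show ?case by blast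
  qed
  from this[of Q] show ?thesis unfolding K_def by blast
qed

end

section \<open>Matrices with prescribed characteristic polynomial modulo p\<close>

text \<open>In this convention, multiplying a matrix by it on the right shifts the columns one place
  to the left, except for the last column; \<open>companion_step\<close> exploits this.\<close>

definition companion :: "nat \<Rightarrow> int poly \<Rightarrow> int mat" where
  "companion n f = Matrix.mat n n (\<lambda>(i, j). if Suc j = n then - Polynomial.coeff f i else of_bool (i = Suc j))"

lemma companion_carrier [simp]: "companion n f \<in> carrier_mat n n"
  by (simp add: companion_def)

lemma mult_mat_index:
  fixes A B :: "'a::semiring_0 mat"
  assumes "A \<in> carrier_mat r m" "B \<in> carrier_mat m c" "i < r" "j < c"
  shows "(A * B) $$ (i, j) = (\<Sum>k = 0..<m. A $$ (i, k) * B $$ (k, j))"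
  using assms by (auto simp: scalar_prod_def)

lemma char_poly_matrix_index:
  assumes "A \<in> carrier_mat n n" "i < n" "j < n"
  shows "char_poly_matrix A $$ (i, j) = (if i = j then [:0, 1:] else 0) - [:A $$ (i, j):]"
  using assms by (auto simp: char_poly_matrix_def)

text \<open>Adding the multiples by powers of the variable of the lower rows of the characteristic matrix
  to its first row leaves only the polynomial itself in the last entry of that row.\<close>

lemma char_poly_companion:
  assumes n: "n > 0" and f: "monic f" "degree f = n"
  shows "char_poly (companion n f) = f"
proof -
  let ?C = "companion n f"
  define M where "M = char_poly_matrix ?C"
  have M: "M \<in> carrier_mat n n" by (simp add: M_def)
  have Mij: "M $$ (i, j) = (if i = j then [:0, 1:] else 0) - (if Suc j = n then [:- Polynomial.coeff f i:] else of_bool (i = Suc j))"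
    if "i < n" "j < n" for i j
    using that char_poly_matrix_index[OF companion_carrier that, of f]
    by (auto simp: M_def companion_def)
  define U where "U = Matrix.mat n n (\<lambda>(i, j). if i = 0 then Polynomial.monom 1 j else of_bool (i = j) :: int poly)"
  have U: "U \<in> carrier_mat n n" by (simp add: U_def)
  have "Determinant.det U = prod_list (diag_mat U)"
    by (rule det_upper_triangular[OF _ U]) (auto simp: U_def)
  also have "diag_mat U = map (\<lambda>i. 1) [0..<n]" by (auto simp: diag_mat_def U_def)
  also have "prod_list (map (\<lambda>i. 1 :: int poly) xs) = 1" for xs :: "nat list" by (induction xs) auto
  finally have detU: "Determinant.det U = 1" .
  define N where "N = U * M"
  have N: "N \<in> carrier_mat n n" using U M by (simp add: N_def)
  have detN: "Determinant.det N = char_poly ?C"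
    using det_mult[OF U M] detU by (simp add: N_def M_def char_poly_def)
  have N_row: "N $$ (i, j) = M $$ (i, j)" if "0 < i" "i < n" "j < n" for i j
  proof -
    have "N $$ (i, j) = (\<Sum>k = 0..<n. U $$ (i, k) * M $$ (k, j))"
      using U M that by (auto simp: N_def scalar_prod_def)
    also have "\<dots> = (\<Sum>k = 0..<n. if k = i then M $$ (i, j) else 0)"
      by (rule sum.cong) (use that in \<open>auto simp: U_def\<close>)
    finally show ?thesis using that by simp
  qed
  have N_0: "N $$ (0, j) = (\<Sum>k = 0..<n. Polynomial.monom 1 k * M $$ (k, j))" if "j < n" for j
    using U M that n by (auto simp: N_def scalar_prod_def U_def)
  have N_0_zero: "N $$ (0, j) = 0" if "Suc j < n" for j
  proof -
    have "N $$ (0, j) = (\<Sum>k = 0..<n. (if k = j then Polynomial.monom 1 j * [:0, 1:] else 0) - (if k = Suc j then Polynomial.monom 1 (Suc j) else 0))"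
      unfolding N_0[OF Suc_lessD[OF that]] by (rule sum.cong) (use that Mij in auto)
    also have "\<dots> = Polynomial.monom 1 j * [:0, 1:] - Polynomial.monom 1 (Suc j)"
      using that by (simp add: sum_subtractf)
    finally show ?thesis by (simp add: monom_Suc mult.commute)
  qed
  have N_0_f: "N $$ (0, n - 1) = f"
  proof -
    have n1: "n - 1 < n" using n by simp
    have "N $$ (0, n - 1) = (\<Sum>k = 0..<n. (if k = n - 1 then Polynomial.monom 1 (n - 1) * [:0, 1:] else 0) + Polynomial.monom (Polynomial.coeff f k) k)"
      unfolding N_0[OF n1]
    proof (rule sum.cong)
      fix k assume k: "k \<in> {0..<n}"
      have "Polynomial.monom 1 k * [:- Polynomial.coeff f k:] = - Polynomial.monom (Polynomial.coeff f k) k"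
        by (simp add: poly_eq_iff coeff_monom_mult coeff_pCons split: nat.splits)
      then show "Polynomial.monom 1 k * M $$ (k, n - 1) = (if k = n - 1 then Polynomial.monom 1 (n - 1) * [:0, 1:] else 0) + Polynomial.monom (Polynomial.coeff f k) k"
        using Mij[of k "n - 1"] k n by (auto simp: right_diff_distrib)
    qed simp
    also have "\<dots> = Polynomial.monom 1 n + (\<Sum>k = 0..<n. Polynomial.monom (Polynomial.coeff f k) k)"
    proof -
      have "Polynomial.monom 1 (n - 1) * [:0, 1:] = (Polynomial.monom 1 n :: int poly)"
        using n by (cases n) (simp_all add: monom_Suc mult.commute)
      then show ?thesis using n by (simp add: sum.distrib)
    qed
    also have "\<dots> = (\<Sum>k\<le>n. Polynomial.monom (Polynomial.coeff f k) k)"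
      using f by (simp add: lessThan_Suc_atMost[symmetric] lessThan_atLeast0)
    also have "\<dots> = f" using f poly_as_sum_of_monoms by metis
    finally show ?thesis .
  qed
  \<comment> \<open>This minor is upper triangular with -1 on the diagonal; its sign (-1)^(n-1)
    cancels that of the cofactor at (0, n-1).\<close>
  define D where "D = mat_delete N 0 (n - 1)"
  have D: "D \<in> carrier_mat (n - 1) (n - 1)" using N by (simp add: D_def mat_delete_def)
  have Dij: "D $$ (i, j) = M $$ (Suc i, j)" if "i < n - 1" "j < n - 1" for i j
  proof -
    have "D $$ (i, j) = N $$ (Suc i, j)" using N that by (auto simp: D_def mat_delete_def)
    then show ?thesis using N_row that by simp
  qed
  have "Determinant.det D = prod_list (diag_mat D)"
    by (rule det_upper_triangular[OF _ D]) (use Dij Mij D in auto)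
  also have "diag_mat D = map (\<lambda>i. - 1) [0..<n - 1]"
    using D Dij Mij by (auto simp: diag_mat_def)
  also have "prod_list (map (\<lambda>i. - 1 :: int poly) xs) = (- 1) ^ length xs" for xs :: "nat list"
    by (induction xs) auto
  finally have detD: "Determinant.det D = (- 1) ^ (n - 1)" by simp
  have "Determinant.det N = (\<Sum>j<n. N $$ (0, j) * cofactor N 0 j)"
    by (rule laplace_expansion_row[OF N n])
  also have "\<dots> = (\<Sum>j<n. if j = n - 1 then f * cofactor N 0 (n - 1) else 0)"
    by (rule sum.cong) (use N_0_zero N_0_f in auto)
  also have "\<dots> = f * cofactor N 0 (n - 1)" using n by simp
  also have "\<dots> = f"
    using detD by (simp add: cofactor_def D_def power_add[symmetric] mult_2[symmetric] flip: power_mult_distrib)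
  finally show ?thesis using detN by simp
qed

lemma coeff_0_char_poly:
  fixes A :: "int mat"
  assumes A: "A \<in> carrier_mat n n"
  shows "Polynomial.coeff (char_poly A) 0 = (- 1) ^ n * Determinant.det A"
proof -
  have "poly (Determinant.det (char_poly_matrix A)) 0 = Determinant.det ((- 1) \<cdot>\<^sub>m A)"
    by (rule poly_det_cong[of _ n]) (use A char_poly_matrix_index[OF A] carrier_matD[OF A] in auto)
  then show ?thesis using A by (simp add: char_poly_def poly_0_coeff_0)
qed

text \<open>From g B = B C follows (T - g) B = B (T - C) modulo p; in the determinants, det B is a
  constant invertible modulo p and cancels. Similarity in this form needs no inverse of B.\<close>

lemma char_poly_intertwine:
  fixes p :: int
  assumes p: "prime p" and g: "g \<in> carrier_mat n n" and B: "B \<in> carrier_mat n n" and C: "C \<in> carrier_mat n n"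
    and gB: "mat_cong p (g * B) (B * C)" and det: "\<not> p dvd Determinant.det B"
  shows "[:p:] dvd char_poly g - char_poly C"
proof -
  interpret h: comm_ring_hom "\<lambda>a :: int. [:a:]" by unfold_locales auto
  let ?B = "map_mat (\<lambda>a. [:a:]) B"
  have B': "?B \<in> carrier_mat n n" using B by simp
  have left: "(char_poly_matrix g * ?B) $$ (i, j) = [:0, 1:] * [:B $$ (i, j):] - [:(g * B) $$ (i, j):]"
    if ij: "i < n" "j < n" for i j
  proof -
    have "(char_poly_matrix g * ?B) $$ (i, j) = (\<Sum>k = 0..<n. char_poly_matrix g $$ (i, k) * [:B $$ (k, j):])"
      by (subst mult_mat_index[OF char_poly_matrix_closed[OF g] B' ij]) (use B ij in simp)
    also have "\<dots> = (\<Sum>k = 0..<n. (if k = i then [:0, 1:] * [:B $$ (i, j):] else 0) - [:g $$ (i, k) * B $$ (k, j):])"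
      by (rule sum.cong) (use ij char_poly_matrix_index[OF g] in \<open>auto simp: left_diff_distrib\<close>)
    also have "\<dots> = [:0, 1:] * [:B $$ (i, j):] - [:\<Sum>k = 0..<n. g $$ (i, k) * B $$ (k, j):]"
      using ij by (simp add: sum_subtractf h.hom_sum)
    also have "(\<Sum>k = 0..<n. g $$ (i, k) * B $$ (k, j)) = (g * B) $$ (i, j)"
      using g B ij by (auto simp: scalar_prod_def)
    finally show ?thesis .
  qed
  have right: "(?B * char_poly_matrix C) $$ (i, j) = [:0, 1:] * [:B $$ (i, j):] - [:(B * C) $$ (i, j):]"
    if ij: "i < n" "j < n" for i j
  proof -
    have "(?B * char_poly_matrix C) $$ (i, j) = (\<Sum>k = 0..<n. [:B $$ (i, k):] * char_poly_matrix C $$ (k, j))"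
      by (subst mult_mat_index[OF B' char_poly_matrix_closed[OF C] ij]) (use B ij in simp)
    also have "\<dots> = (\<Sum>k = 0..<n. (if k = j then [:0, 1:] * [:B $$ (i, j):] else 0) - [:B $$ (i, k) * C $$ (k, j):])"
      by (rule sum.cong) (use ij char_poly_matrix_index[OF C] in \<open>auto simp: right_diff_distrib\<close>)
    also have "\<dots> = [:0, 1:] * [:B $$ (i, j):] - [:\<Sum>k = 0..<n. B $$ (i, k) * C $$ (k, j):]"
      using ij by (simp add: sum_subtractf h.hom_sum)
    also have "(\<Sum>k = 0..<n. B $$ (i, k) * C $$ (k, j)) = (B * C) $$ (i, j)"
      using C B ij by (auto simp: scalar_prod_def)
    finally show ?thesis .
  qed
  have "mat_cong [:p:] (char_poly_matrix g * ?B) (?B * char_poly_matrix C)"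
  proof (rule mat_congI)
    fix i j assume ij: "i < n" "j < n"
    have "(char_poly_matrix g * ?B) $$ (i, j) - (?B * char_poly_matrix C) $$ (i, j)
        = - [:(g * B) $$ (i, j) - (B * C) $$ (i, j):]"
      unfolding left[OF ij] right[OF ij] by simp
    moreover have "p dvd (g * B) $$ (i, j) - (B * C) $$ (i, j)"
      using mat_congD(2)[OF gB, of n n] g B ij by simp
    ultimately show "[:p:] dvd (char_poly_matrix g * ?B) $$ (i, j) - (?B * char_poly_matrix C) $$ (i, j)"
      by (simp del: minus_pCons)
  qed (rule mult_carrier_mat[OF char_poly_matrix_closed[OF g] B']
        mult_carrier_mat[OF B' char_poly_matrix_closed[OF C]])+
  then have "[:p:] dvd Determinant.det (char_poly_matrix g * ?B) - Determinant.det (?B * char_poly_matrix C)"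
    by (rule mat_cong_det[OF _ mult_carrier_mat[OF char_poly_matrix_closed[OF g] B']])
  also have "\<dots> = char_poly g * [:Determinant.det B:] - [:Determinant.det B:] * char_poly C"
    using det_mult[of "char_poly_matrix g" n ?B] det_mult[of ?B n "char_poly_matrix C"] g C B'
    by (simp add: char_poly_def h.hom_det)
  also have "\<dots> = smult (Determinant.det B) (char_poly g - char_poly C)"
    by (simp add: smult_diff_right)
  finally have "[:p:] dvd smult (Determinant.det B) (char_poly g - char_poly C)" .
  then show ?thesis
    unfolding const_poly_dvd_iff using p det by (auto simp: prime_dvd_mult_iff)
qed

section \<open>Counting matrices by characteristic polynomial\<close>

definition reduced_monic :: "nat \<Rightarrow> int \<Rightarrow> int poly set" where
  "reduced_monic e p = {f. monic f \<and> degree f = e \<and> (\<forall>i<e. Polynomial.coeff f i \<in> {0..<p})}"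

lemma reduced_monic_cong_eq:
  assumes f: "f \<in> reduced_monic n p" "f' \<in> reduced_monic n p" and dv: "[:p:] dvd f - f'"
  shows "f = f'"
proof (rule poly_eqI)
  fix i
  show "Polynomial.coeff f i = Polynomial.coeff f' i"
  proof (cases "i < n")
    case True
    then have "Polynomial.coeff f i mod p = Polynomial.coeff f i" "Polynomial.coeff f' i mod p = Polynomial.coeff f' i"
      using f by (auto simp: reduced_monic_def)
    moreover have "p dvd Polynomial.coeff f i - Polynomial.coeff f' i"
      using dv by (simp add: const_poly_dvd_iff)
    ultimately show ?thesis by (simp add: mod_eq_dvd_iff[symmetric])
  next
    case False
    then show ?thesis using f by (cases "i = n") (auto simp: reduced_monic_def coeff_eq_0)
  qed
qed

text \<open>Invertible matrices modulo p fixing the first unit vector e. If g B = B C with C a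
  companion matrix, the columns of such a B are e, g e, g^2 e, ... modulo p.\<close>

definition based_mats :: "nat \<Rightarrow> int \<Rightarrow> int mat set" where
  "based_mats n p = {B \<in> reduced_mats n p. \<not> p dvd Determinant.det B \<and> (\<forall>i<n. B $$ (i, 0) = of_bool (i = 0))}"

lemma reduced_mats_cong_eq:
  "A \<in> reduced_mats n p \<Longrightarrow> B \<in> reduced_mats n p \<Longrightarrow> mat_cong p A B \<Longrightarrow> A = B"
  by (simp add: reduced_mats_def redm_eq_iff[symmetric])

lemma companion_step:
  assumes B: "B \<in> carrier_mat n n" and ij: "i < n" "Suc j < n"
  shows "(B * companion n f) $$ (i, j) = B $$ (i, Suc j)"
proof -
  have "(B * companion n f) $$ (i, j) = (\<Sum>k = 0..<n. B $$ (i, k) * companion n f $$ (k, j))"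
    by (rule mult_mat_index[OF B companion_carrier]) (use ij in auto)
  also have "\<dots> = (\<Sum>k = 0..<n. if k = Suc j then B $$ (i, Suc j) else 0)"
    by (rule sum.cong) (use ij in \<open>auto simp: companion_def\<close>)
  finally show ?thesis using ij by simp
qed

text \<open>Column j + 1 of B is g applied to column j and the first column is fixed, so g
  determines B modulo p; f is the characteristic polynomial of g modulo p. Reducedness turns both
  congruences into equalities.\<close>

lemma intertwine_unique:
  fixes p :: int
  assumes p: "prime p" and g: "g \<in> carrier_mat n n" and n: "n > 0"
    and B: "B \<in> based_mats n p" "B' \<in> based_mats n p"
    and f: "f \<in> reduced_monic n p" "f' \<in> reduced_monic n p"
    and gB: "mat_cong p (g * B) (B * companion n f)" "mat_cong p (g * B') (B' * companion n f')"
  shows "B = B' \<and> f = f'"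
proof -
  have Bc: "B \<in> carrier_mat n n" "B' \<in> carrier_mat n n"
    using B by (auto simp: based_mats_def reduced_mats_def)
  have step: "p dvd B $$ (i, Suc j) - (\<Sum>k = 0..<n. g $$ (i, k) * B $$ (k, j))"
    if "B \<in> carrier_mat n n" "mat_cong p (g * B) (B * companion n f)" "i < n" "Suc j < n" for B f i j
  proof -
    have "p dvd (g * B) $$ (i, j) - (B * companion n f) $$ (i, j)"
      using mat_congD(2)[OF that(2), of n n i j] g that by simp
    moreover have "(g * B) $$ (i, j) = (\<Sum>k = 0..<n. g $$ (i, k) * B $$ (k, j))"
      using g that by (auto simp: scalar_prod_def)
    ultimately show ?thesis using companion_step[OF that(1,3,4), of f] by (simp add: dvd_diff_commute)
  qed
  have "\<forall>i<n. p dvd B $$ (i, j) - B' $$ (i, j)" if "j < n" for j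
    using that
  proof (induction j)
    case 0
    then show ?case using B by (auto simp: based_mats_def)
  next
    case (Suc j)
    show ?case
    proof (intro allI impI)
      fix i assume i: "i < n"
      define X X' where "X = (\<Sum>k = 0..<n. g $$ (i, k) * B $$ (k, j))"
        and "X' = (\<Sum>k = 0..<n. g $$ (i, k) * B' $$ (k, j))"
      have "p dvd X - X'"
        unfolding X_def X'_def by (intro dvd_sum_diff dvd_mult_diff) (use Suc in auto)
      note XX = this
      have "p dvd B $$ (i, Suc j) - X" "p dvd B' $$ (i, Suc j) - X'"
        unfolding X_def X'_def using step[OF Bc(1) gB(1) i Suc.prems] step[OF Bc(2) gB(2) i Suc.prems] by auto
      then have "p dvd (B $$ (i, Suc j) - X) + (X - X') - (B' $$ (i, Suc j) - X')"
        by (rule dvd_diff[OF dvd_add[OF _ XX]])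
      then show "p dvd B $$ (i, Suc j) - B' $$ (i, Suc j)" by (simp add: algebra_simps)
    qed
  qed
  then have "mat_cong p B B'" using Bc by (intro mat_congI[of _ n n]) auto
  then have "B = B'" using reduced_mats_cong_eq B by (auto simp: based_mats_def)
  have mon: "monic f" "degree f = n" "monic f'" "degree f' = n" using f by (auto simp: reduced_monic_def)
  have ff: "[:p:] dvd char_poly g - f" "[:p:] dvd char_poly g - f'"
    using char_poly_intertwine[OF p g Bc(1) companion_carrier gB(1)]
      char_poly_intertwine[OF p g Bc(2) companion_carrier gB(2)] B mon char_poly_companion[OF n]
    by (auto simp: based_mats_def)
  have "[:p:] dvd (char_poly g - f') - (char_poly g - f)" by (rule dvd_diff[OF ff(2,1)])
  then have "f = f'" by (intro reduced_monic_cong_eq[OF f]) simp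
  with \<open>B = B'\<close> show ?thesis by simp
qed

text \<open>Take g = B C B^-1, where B^-1 is the adjugate scaled by an inverse of det B modulo p.
  The condition on f(0) says that det C is 1 modulo p.\<close>

lemma intertwine_exists:
  fixes p :: int
  assumes p: "prime p" and n: "n > 0" and B: "B \<in> based_mats n p"
    and f: "f \<in> reduced_monic n p" "p dvd Polynomial.coeff f 0 - (- 1) ^ n"
  shows "\<exists>g\<in>carrier (SLp n p). mat_cong p (g * B) (B * companion n f)"
proof -
  let ?C = "companion n f"
  have Bc: "B \<in> carrier_mat n n" and det: "\<not> p dvd Determinant.det B"
    using B by (auto simp: based_mats_def reduced_mats_def)
  note adj = adj_mat[OF Bc]
  obtain s where s: "p dvd Determinant.det B * s - 1" using prime_int_inverse[OF p det] by blast
  define Bi where "Bi = s \<cdot>\<^sub>m adj_mat B"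
  have Bi: "Bi \<in> carrier_mat n n" using adj by (simp add: Bi_def)
  have inv: "mat_cong p (Bi * B) (1\<^sub>m n)"
  proof -
    have "Bi * B = s \<cdot>\<^sub>m (Determinant.det B \<cdot>\<^sub>m 1\<^sub>m n)"
      unfolding Bi_def using adj Bc by (simp add: mult_smult_assoc_mat[of _ n n _ n])
    then show ?thesis using s by (auto simp: mat_cong_def mult.commute)
  qed
  define g0 where "g0 = B * ?C * Bi"
  have BC: "B * ?C \<in> carrier_mat n n" by (rule mult_carrier_mat[OF Bc companion_carrier])
  have g0: "g0 \<in> carrier_mat n n" unfolding g0_def by (rule mult_carrier_mat[OF BC Bi])
  have "g0 * B = B * ?C * (Bi * B)"
    unfolding g0_def using BC Bi Bc by (intro assoc_mult_mat[of _ n n _ n _ n])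
  also have "mat_cong p \<dots> (B * ?C * 1\<^sub>m n)"
    using inv BC Bi Bc by (intro mat_cong_mult_carrier[of _ _ _ _ _ n n n]) auto
  also have "B * ?C * 1\<^sub>m n = B * ?C" by (rule right_mult_one_mat[OF BC])
  finally have g0B: "mat_cong p (g0 * B) (B * ?C)" .
  have detC: "p dvd Determinant.det ?C - 1"
  proof -
    have mon: "monic f" "degree f = n" using f by (auto simp: reduced_monic_def)
    have "Polynomial.coeff f 0 = (- 1) ^ n * Determinant.det ?C"
      using coeff_0_char_poly[OF companion_carrier[of n f]] unfolding char_poly_companion[OF n mon] .
    then have "(- 1) ^ n * (Polynomial.coeff f 0 - (- 1) ^ n) = Determinant.det ?C - 1"
      by (simp add: right_diff_distrib mult.assoc[symmetric] power_add[symmetric] flip: power_mult_distrib)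
    then show ?thesis using f(2) by (metis dvd_mult)
  qed
  have "p dvd Determinant.det (g0 * B) - Determinant.det (B * ?C)"
    by (rule mat_cong_det[OF g0B, of n]) (use g0 Bc in simp)
  then have "p dvd Determinant.det B * (Determinant.det g0 - Determinant.det ?C)"
    using det_mult[OF g0 Bc] det_mult[OF Bc companion_carrier, of f] by (simp add: algebra_simps)
  then have "p dvd Determinant.det g0 - Determinant.det ?C" using p det by (simp add: prime_dvd_mult_iff)
  then have "p dvd (Determinant.det g0 - Determinant.det ?C) + (Determinant.det ?C - 1)"
    using detC by (intro dvd_add)
  then have "redm p g0 \<in> carrier (SLp n p)" using redm_SLp[OF g0] by simp
  moreover have "mat_cong p (redm p g0 * B) (B * ?C)"
  proof -
    have "redm p g0 \<in> carrier_mat n n" using g0 by simp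
    from mat_cong_mult_carrier[OF redm_cong mat_cong_refl this Bc] g0B show ?thesis by (rule mat_cong_trans)
  qed
  ultimately show ?thesis by blast
qed

text \<open>Orbit counting for GL(n, p), of order p - 1 times that of SL(n, p), acting on first
  columns: there are at most p^n columns, and each fibre is a translate of the stabilizer of the
  first unit vector. Only a lower bound for \<open>based_mats\<close> is wanted, so an injection is
  enough.\<close>

lemma card_SLp_le:
  fixes p :: int
  assumes p: "prime p" and n: "n \<ge> 2"
  shows "card (carrier (SLp n p)) * nat (p - 1) \<le> nat p ^ n * card (based_mats n p)"
proof -
  interpret group "SLp n p" by (rule group_SLp)
  let ?G = "carrier (SLp n p)"
  have p1: "p > 1" using p prime_gt_1_int by blast
  define fc where "fc A = (\<lambda>i\<in>{0..<n}. A $$ (i, 0))" for A :: "int mat"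
  \<comment> \<open>A fixed element of SL(n, p) for each first column that occurs;
    \<open>T A\<close> below divides it out of A, which moves A into the stabilizer.\<close>
  define R where "R v = (SOME A. A \<in> ?G \<and> fc A = v)" for v
  \<comment> \<open>Scaling the last column by u supplies all nonzero determinants; by n >= 2 the
    first column stays untouched.\<close>
  define D where "D u = multrow_mat n (n - 1) (u :: int)" for u
  have D: "D u \<in> carrier_mat n n" for u by (simp add: D_def)
  have detD: "Determinant.det (D u) = u" for u using n by (simp add: D_def det_multrow_mat)
  have mult_D: "(A * D u) $$ (i, j) = (if j = n - 1 then u else 1) * A $$ (i, j)"
    if "A \<in> carrier_mat n n" "i < n" "j < n" for A u i j
  proof -
    have "(A * D u) $$ (i, j) = (\<Sum>k = 0..<n. A $$ (i, k) * D u $$ (k, j))"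
      using D[of u] that by (auto simp: scalar_prod_def)
    also have "\<dots> = (\<Sum>k = 0..<n. if k = j then (if j = n - 1 then u else 1) * A $$ (i, j) else 0)"
      by (rule sum.cong) (use that in \<open>auto simp: D_def\<close>)
    finally show ?thesis using that by simp
  qed
  have R: "R (fc A) \<in> ?G" "fc (R (fc A)) = fc A" if "A \<in> ?G" for A
    using someI[of "\<lambda>B. B \<in> ?G \<and> fc B = fc A" A] that by (auto simp: R_def)
  define T where "T A = inv\<^bsub>SLp n p\<^esub> (R (fc A)) \<otimes>\<^bsub>SLp n p\<^esub> A" for A
  have T: "T A \<in> ?G" if "A \<in> ?G" for A using R[OF that] that unfolding T_def by (intro m_closed inv_closed)
  have T_col: "p dvd T A $$ (i, 0) - of_bool (i = 0)" if A: "A \<in> ?G" and i: "i < n" for A i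
  proof -
    let ?I = "inv\<^bsub>SLp n p\<^esub> (R (fc A))"
    have I: "?I \<in> ?G" using R[OF A] by simp
    have c: "?I \<in> carrier_mat n n" "A \<in> carrier_mat n n" "R (fc A) \<in> carrier_mat n n"
      using I A R[OF A] by (simp_all add: SLp_carrier)
    have same: "A $$ (k, 0) = R (fc A) $$ (k, 0)" if "k < n" for k
      using fun_cong[OF R(2)[OF A], of k] that by (simp add: fc_def)
    have "T A $$ (i, 0) = (\<Sum>k = 0..<n. ?I $$ (i, k) * A $$ (k, 0)) mod p"
      unfolding T_def using c i n by (auto simp: redm_def scalar_prod_def)
    also have "(\<Sum>k = 0..<n. ?I $$ (i, k) * A $$ (k, 0)) = (\<Sum>k = 0..<n. ?I $$ (i, k) * R (fc A) $$ (k, 0))"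
      by (rule sum.cong) (use same in auto)
    also have "\<dots> mod p = (?I \<otimes>\<^bsub>SLp n p\<^esub> R (fc A)) $$ (i, 0)"
      using c i n by (auto simp: redm_def scalar_prod_def)
    also have "?I \<otimes>\<^bsub>SLp n p\<^esub> R (fc A) = redm p (1\<^sub>m n)" using l_inv[OF R(1)[OF A]] by simp
    also have "redm p (1\<^sub>m n) $$ (i, 0) = of_bool (i = 0) mod p" using i n by (auto simp: redm_def)
    finally show ?thesis by (simp add: mod_eq_dvd_iff[symmetric])
  qed
  define \<Phi> where "\<Phi> = (\<lambda>(A, u). (fc A, redm p (T A * D u)))"
  have entry: "0 \<le> A $$ (i, j) \<and> A $$ (i, j) < p" if "A \<in> ?G" "i < n" "j < n" for A i j
  proof -
    have c: "A \<in> carrier_mat n n" "redm p A = A" using that by (auto simp: SLp_carrier)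
    have "A $$ (i, j) = A $$ (i, j) mod p"
      by (subst (1) c(2)[symmetric]) (use c(1) that in \<open>simp add: redm_def\<close>)
    then show ?thesis using p1 pos_mod_bound[of p "A $$ (i, j)"] pos_mod_sign[of p "A $$ (i, j)"] by linarith
  qed
  have "\<Phi> ` (?G \<times> {1..p - 1}) \<subseteq> ({0..<n} \<rightarrow>\<^sub>E {0..<p}) \<times> based_mats n p"
  proof
    fix y assume "y \<in> \<Phi> ` (?G \<times> {1..p - 1})"
    then obtain A u where Au: "A \<in> ?G" "1 \<le> u" "u \<le> p - 1" "y = \<Phi> (A, u)" by auto
    let ?B = "redm p (T A * D u)"
    have Tc: "T A \<in> carrier_mat n n" "p dvd Determinant.det (T A) - 1" using T[OF Au(1)] by (auto simp: SLp_carrier)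
    have TD: "T A * D u \<in> carrier_mat n n" using Tc D[of u] by simp
    have "p dvd Determinant.det ?B - Determinant.det (T A * D u)"
      by (rule mat_cong_det[OF redm_cong, of _ _ n]) (use TD in simp)
    then have "p dvd (Determinant.det ?B - Determinant.det (T A) * u) + u * (Determinant.det (T A) - 1)"
      using det_mult[OF Tc(1) D, of u] detD Tc(2) by (intro dvd_add dvd_mult) simp_all
    then have "p dvd Determinant.det ?B - u" by (simp add: algebra_simps)
    moreover have "\<not> p dvd u" using Au by (auto dest: zdvd_imp_le)
    ultimately have nd: "\<not> p dvd Determinant.det ?B" using dvd_diff[of p "Determinant.det ?B" "Determinant.det ?B - u"] by auto
    have col: "?B $$ (i, 0) = of_bool (i = 0)" if i: "i < n" for i
    proof -
      have "?B $$ (i, 0) = T A $$ (i, 0) mod p"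
        using mult_D[OF Tc(1) i, of 0 u] carrier_matD[OF Tc(1)] carrier_matD[OF D, of u] i n by (auto simp: redm_def)
      also have "\<dots> = of_bool (i = 0) mod p" using T_col[OF Au(1) i] by (simp add: mod_eq_dvd_iff)
      also have "\<dots> = of_bool (i = 0)" using p1 by simp
      finally show ?thesis .
    qed
    have "?B \<in> based_mats n p" using nd col TD by (simp add: based_mats_def reduced_mats_def)
    moreover have "fc A \<in> {0..<n} \<rightarrow>\<^sub>E {0..<p}" unfolding fc_def using entry[OF Au(1)] n by auto
    ultimately show "y \<in> ({0..<n} \<rightarrow>\<^sub>E {0..<p}) \<times> based_mats n p" using Au by (simp add: \<Phi>_def)
  qed
  moreover have "inj_on \<Phi> (?G \<times> {1..p - 1})"
  proof (rule inj_onI)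
    fix x y assume xy: "x \<in> ?G \<times> {1..p - 1}" "y \<in> ?G \<times> {1..p - 1}" "\<Phi> x = \<Phi> y"
    obtain A u A' u' where x: "x = (A, u)" and y: "y = (A', u')" by (cases x, cases y) auto
    have G: "A \<in> ?G" "A' \<in> ?G" and u: "1 \<le> u" "u < p" "1 \<le> u'" "u' < p" using xy x y by auto
    have eq: "fc A = fc A'" "mat_cong p (T A * D u) (T A' * D u')"
      using xy(3) by (auto simp: x y \<Phi>_def redm_eq_iff)
    have Tc: "T A \<in> carrier_mat n n" "p dvd Determinant.det (T A) - 1"
        "T A' \<in> carrier_mat n n" "p dvd Determinant.det (T A') - 1"
      using T[OF G(1)] T[OF G(2)] by (auto simp: SLp_carrier)
    have "p dvd Determinant.det (T A * D u) - Determinant.det (T A' * D u')"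
      by (rule mat_cong_det[OF eq(2), of n]) (use Tc(1) D[of u] in simp)
    then have "p dvd Determinant.det (T A) * u - Determinant.det (T A') * u'"
      unfolding det_mult[OF Tc(1) D] det_mult[OF Tc(3) D] detD .
    then have "p dvd (Determinant.det (T A) * u - Determinant.det (T A') * u')
        - u * (Determinant.det (T A) - 1) + u' * (Determinant.det (T A') - 1)"
      by (rule dvd_add[OF dvd_diff[OF _ dvd_mult[OF Tc(2)]] dvd_mult[OF Tc(4)]])
    then have "p dvd u - u'" by (simp add: algebra_simps)
    then have "u mod p = u' mod p" by (simp add: mod_eq_dvd_iff)
    then have "u = u'" using u by simp
    have "p dvd T A $$ (i, j) - T A' $$ (i, j)" if ij: "i < n" "j < n" for i j
    proof -
      have "p dvd (T A * D u) $$ (i, j) - (T A' * D u') $$ (i, j)"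
        using mat_congD(2)[OF eq(2), of n n i j] Tc D[of u] ij by simp
      then have "p dvd (if j = n - 1 then u else 1) * (T A $$ (i, j) - T A' $$ (i, j))"
        unfolding mult_D[OF Tc(1) ij] mult_D[OF Tc(3) ij] \<open>u = u'\<close> by (simp add: right_diff_distrib)
      moreover have "\<not> p dvd u" using u by (auto dest: zdvd_imp_le)
      ultimately show ?thesis using p by (auto simp: prime_dvd_mult_iff split: if_splits)
    qed
    then have "mat_cong p (T A) (T A')" using Tc by (intro mat_congI[of _ n n]) auto
    then have "T A = T A'"
      using reduced_mats_cong_eq T G SLp_subset_reduced by (meson subsetD)
    then have "A = A'" using G R(1)[OF G(1)] eq(1) unfolding T_def by (simp del: SLp_mult)
    with \<open>u = u'\<close> show "x = y" by (simp add: x y)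
  qed
  moreover have "finite (({0..<n} \<rightarrow>\<^sub>E {0..<p}) \<times> based_mats n p)"
  proof -
    have "based_mats n p \<subseteq> reduced_mats n p" by (auto simp: based_mats_def)
    then have "finite (based_mats n p)" using reduced_mats_bound(1)[of p n] p1 finite_subset by auto
    then show ?thesis by (intro finite_cartesian_product finite_PiE) auto
  qed
  ultimately have "card (?G \<times> {1..p - 1}) \<le> card (({0..<n} \<rightarrow>\<^sub>E {0..<p}) \<times> based_mats n p)"
    by (meson card_inj_on_le)
  then show ?thesis by (simp add: card_cartesian_product card_PiE)
qed

text \<open>A factorization over the field of p elements, with both factors lifted to monic integer
  polynomials of the same degrees.\<close>

definition has_factor :: "int \<Rightarrow> nat \<Rightarrow> nat \<Rightarrow> int poly \<Rightarrow> bool" where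
  "has_factor p d e f \<longleftrightarrow> (\<exists>g h. monic g \<and> degree g = d \<and> monic h \<and> degree h = e \<and> [:p:] dvd f - g * h)"

lemma has_factor_cong:
  assumes "[:p:] dvd f - f'" "has_factor p d e f'"
  shows "has_factor p d e f"
proof -
  obtain g h where gh: "monic g" "degree g = d" "monic h" "degree h = e" "[:p:] dvd f' - g * h"
    using assms(2) by (auto simp: has_factor_def)
  have "[:p:] dvd (f - f') + (f' - g * h)" by (rule dvd_add[OF assms(1) gh(5)])
  then show ?thesis using gh by (auto simp: has_factor_def)
qed

text \<open>A pair (B, f) is sent to some g with g B = B C, where C is the companion matrix of f.
  Injectivity is \<open>intertwine_unique\<close>, and g inherits the lack of a factor because its
  characteristic polynomial is f modulo p.\<close>

lemma card_no_factor_matrices: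
  fixes p :: int
  assumes p: "prime p" and n: "n \<ge> 2"
    and F: "\<And>f. f \<in> F \<Longrightarrow> f \<in> reduced_monic n p \<and> p dvd Polynomial.coeff f 0 - (- 1) ^ n \<and> \<not> has_factor p d e f"
  shows "card (based_mats n p) * card F \<le> card {g \<in> carrier (SLp n p). \<not> has_factor p d e (char_poly g)}"
proof -
  have p1: "p > 1" using p prime_gt_1_int by blast
  define \<Psi> where "\<Psi> = (\<lambda>(B, f). SOME g. g \<in> carrier (SLp n p) \<and> mat_cong p (g * B) (B * companion n f))"
  have \<Psi>: "\<Psi> (B, f) \<in> carrier (SLp n p)" "mat_cong p (\<Psi> (B, f) * B) (B * companion n f)"
    if "B \<in> based_mats n p" "f \<in> F" for B f
    using someI_ex[OF intertwine_exists[OF p _ that(1), of f, unfolded Bex_def]] F[OF that(2)] n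
    by (auto simp: \<Psi>_def)
  have "inj_on \<Psi> (based_mats n p \<times> F)"
  proof (rule inj_onI, clarify)
    fix B f B' f' assume a: "B \<in> based_mats n p" "f \<in> F" "B' \<in> based_mats n p" "f' \<in> F" "\<Psi> (B, f) = \<Psi> (B', f')"
    show "B = B' \<and> f = f'"
    proof (rule intertwine_unique[OF p])
      show "\<Psi> (B, f) \<in> carrier_mat n n" using \<Psi>(1)[OF a(1,2)] by (simp add: SLp_carrier)
      show "mat_cong p (\<Psi> (B, f) * B') (B' * companion n f')" unfolding a(5) by (rule \<Psi>(2)[OF a(3,4)])
      show "mat_cong p (\<Psi> (B, f) * B) (B * companion n f)" by (rule \<Psi>(2)[OF a(1,2)])
    qed (use a F n in auto)
  qed
  moreover have "\<Psi> ` (based_mats n p \<times> F) \<subseteq> {g \<in> carrier (SLp n p). \<not> has_factor p d e (char_poly g)}"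
  proof clarify
    fix B f assume a: "B \<in> based_mats n p" "f \<in> F"
    have "[:p:] dvd char_poly (\<Psi> (B, f)) - char_poly (companion n f)"
      by (rule char_poly_intertwine[OF p _ _ companion_carrier \<Psi>(2)[OF a]])
         (use \<Psi>(1)[OF a] a in \<open>auto simp: SLp_carrier based_mats_def reduced_mats_def\<close>)
    moreover have "char_poly (companion n f) = f"
      using F[OF a(2)] n by (intro char_poly_companion) (auto simp: reduced_monic_def)
    ultimately have "[:p:] dvd f - char_poly (\<Psi> (B, f))" 
      using dvd_minus_iff[of "[:p:]" "char_poly (\<Psi> (B, f)) - f"] by simp
    then have "\<not> has_factor p d e (char_poly (\<Psi> (B, f)))"
      using has_factor_cong F[OF a(2)] by blast
    then show "\<Psi> (B, f) \<in> carrier (SLp n p) \<and> \<not> has_factor p d e (char_poly (\<Psi> (B, f)))"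
      using \<Psi>(1)[OF a] by blast
  qed
  moreover have "finite {g \<in> carrier (SLp n p). \<not> has_factor p d e (char_poly g)}"
    using finite_subset[OF SLp_subset_reduced reduced_mats_bound(1)] p1 by auto
  ultimately have "card (based_mats n p \<times> F) \<le> card {g \<in> carrier (SLp n p). \<not> has_factor p d e (char_poly g)}"
    by (rule card_inj_on_le)
  then show ?thesis by (simp add: card_cartesian_product)
qed

section \<open>Polynomials modulo p without factors of given degree\<close>

lemma dvd_diff_swap:
  fixes m :: "'a::comm_ring_1"
  shows "m dvd a - b \<Longrightarrow> m dvd b - a"
  using dvd_minus_iff[of m "a - b"] by simp

definition redpoly :: "int \<Rightarrow> int poly \<Rightarrow> int poly" where
  "redpoly p f = map_poly (\<lambda>a. a mod p) f"

lemma redpoly_cong: "[:p:] dvd redpoly p f - f"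
  by (simp add: const_poly_dvd_iff redpoly_def coeff_map_poly mod_eq_dvd_iff[symmetric])

lemma redpoly_reduced_monic:
  assumes "monic f" "degree f = n" "p > 1"
  shows "redpoly p f \<in> reduced_monic n p"
proof -
  have c: "Polynomial.coeff (redpoly p f) i = Polynomial.coeff f i mod p" for i
    by (simp add: redpoly_def coeff_map_poly)
  have 1: "Polynomial.coeff (redpoly p f) n = 1" using assms by (simp add: c)
  have "degree (redpoly p f) = n"
  proof (rule antisym)
    show "degree (redpoly p f) \<le> n"
      by (rule degree_le) (use assms in \<open>auto simp: c coeff_eq_0\<close>)
    show "n \<le> degree (redpoly p f)" by (rule le_degree) (simp add: 1)
  qed
  then show ?thesis using 1 c assms by (simp add: reduced_monic_def)
qed

lemma reduced_monic_0: "reduced_monic 0 p = {1}"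
  by (auto simp: reduced_monic_def elim!: degree_eq_zeroE)

lemma reduced_monic_Suc:
  "reduced_monic (Suc e) p = (\<lambda>(a, f). pCons a f) ` ({0..<p} \<times> reduced_monic e p)"
proof
  show "reduced_monic (Suc e) p \<subseteq> (\<lambda>(a, f). pCons a f) ` ({0..<p} \<times> reduced_monic e p)"
  proof
    fix f assume f: "f \<in> reduced_monic (Suc e) p"
    obtain a g where fg: "f = pCons a g" by (cases f)
    have "g \<noteq> 0" using f fg by (auto simp: reduced_monic_def)
    then have deg: "degree g = e" using f fg by (auto simp: reduced_monic_def)
    have c: "Polynomial.coeff f i \<in> {0..<p}" if "i < Suc e" for i using f that by (simp add: reduced_monic_def)
    have "a \<in> {0..<p}" using c[of 0] by (simp add: fg)
    moreover have "Polynomial.coeff g i \<in> {0..<p}" if "i < e" for i using c[of "Suc i"] that by (simp add: fg)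
    moreover have "monic g" using f fg deg \<open>g \<noteq> 0\<close> by (auto simp: reduced_monic_def)
    ultimately have "(a, g) \<in> {0..<p} \<times> reduced_monic e p" using deg by (simp add: reduced_monic_def)
    then show "f \<in> (\<lambda>(a, f). pCons a f) ` ({0..<p} \<times> reduced_monic e p)" using fg by force
  qed
  show "(\<lambda>(a, f). pCons a f) ` ({0..<p} \<times> reduced_monic e p) \<subseteq> reduced_monic (Suc e) p"
  proof clarify
    fix a f assume a: "a \<in> {0..<p}" and f: "f \<in> reduced_monic e p"
    then have "f \<noteq> 0" by (auto simp: reduced_monic_def)
    then show "pCons a f \<in> reduced_monic (Suc e) p"
      using a f by (auto simp: reduced_monic_def coeff_pCons split: nat.splits)
  qed
qed

lemma card_reduced_monic:
  "finite (reduced_monic e p)" "card (reduced_monic e p) = nat p ^ e"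
proof -
  have "finite (reduced_monic e p) \<and> card (reduced_monic e p) = nat p ^ e"
  proof (induction e)
    case (Suc e)
    have "inj_on (\<lambda>(a, f). pCons a f) ({0..<p} \<times> reduced_monic e p)"
      by (auto simp: inj_on_def)
    then show ?case using Suc by (simp add: reduced_monic_Suc card_image card_cartesian_product)
  qed (simp add: reduced_monic_0)
  then show "finite (reduced_monic e p)" "card (reduced_monic e p) = nat p ^ e" by auto
qed

text \<open>Discarding one preimage of each element of \<open>C\<close> does not shrink the image,
  since a second preimage remains.\<close>

lemma card_image_plus_collisions:
  assumes P: "finite P" and C: "\<And>y. y \<in> C \<Longrightarrow> \<exists>x\<in>P. \<exists>x'\<in>P. x \<noteq> x' \<and> \<Phi> x = y \<and> \<Phi> x' = y"
  shows "card (\<Phi> ` P) + card C \<le> card P"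
proof -
  obtain s where s: "\<And>y. y \<in> C \<Longrightarrow> s y \<in> P \<and> \<Phi> (s y) = y \<and> (\<exists>x'\<in>P. x' \<noteq> s y \<and> \<Phi> x' = y)"
    using C by metis
  have inj: "inj_on s C" by (rule inj_onI) (metis s)
  have sub: "s ` C \<subseteq> P" using s by blast
  have "\<Phi> ` P \<subseteq> \<Phi> ` (P - s ` C)"
  proof
    fix y assume "y \<in> \<Phi> ` P"
    then obtain x where x: "x \<in> P" "y = \<Phi> x" by blast
    show "y \<in> \<Phi> ` (P - s ` C)"
    proof (cases "x \<in> s ` C")
      case True
      then obtain z where z: "z \<in> C" "x = s z" by blast
      then obtain x' where x': "x' \<in> P" "x' \<noteq> s z" "\<Phi> x' = z" using s by blast
      have "x' \<notin> s ` C"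
      proof
        assume "x' \<in> s ` C"
        then obtain w where w: "w \<in> C" "x' = s w" by blast
        then have "w = z" using s[OF w(1)] x'(3) by simp
        then show False using w x' by simp
      qed
      moreover have "y = \<Phi> x'" using x z s[OF z(1)] x'(3) by simp
      ultimately show ?thesis using x' by blast
    qed (use x in blast)
  qed
  then have "card (\<Phi> ` P) \<le> card (\<Phi> ` (P - s ` C))" using P by (intro card_mono) auto
  also have "\<dots> \<le> card (P - s ` C)" using P by (intro card_image_le) auto
  also have "\<dots> = card P - card C"
    using sub P card_image[OF inj] by (simp add: card_Diff_subset finite_subset)
  finally have "card (\<Phi> ` P) \<le> card P - card C" .
  moreover have "card C \<le> card P" using card_mono[OF P sub] card_image[OF inj] by simp
  ultimately show ?thesis by linarith
qed

definition factor_pairs :: "int \<Rightarrow> nat \<Rightarrow> nat \<Rightarrow> int \<Rightarrow> (int poly \<times> int poly) set" where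
  "factor_pairs p d e c = (SIGMA g : reduced_monic d p.
     {h \<in> reduced_monic e p. p dvd Polynomial.coeff g 0 * Polynomial.coeff h 0 - c})"

lemma finite_factor_pairs: "finite (factor_pairs p d e c)"
  unfolding factor_pairs_def by (intro finite_SigmaI) (auto simp: card_reduced_monic)

text \<open>As c is nonzero modulo p, g(0) must be invertible and then determines h(0), so one of
  the d + e free coefficients is lost.\<close>

lemma card_factor_pairs:
  assumes p: "prime p" and c: "\<not> p dvd c" and e: "e > 0"
  shows "card (factor_pairs p d e c) \<le> nat p ^ (d + e - 1)"
proof -
  obtain e' where e': "e = Suc e'" using e by (cases e) auto
  have p1: "p > 1" using p prime_gt_1_int by blast
  have "card {h \<in> reduced_monic e p. p dvd Polynomial.coeff g 0 * Polynomial.coeff h 0 - c} \<le> nat p ^ e'" for g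
  proof (cases "p dvd Polynomial.coeff g 0")
    case True
    have "{h \<in> reduced_monic e p. p dvd Polynomial.coeff g 0 * Polynomial.coeff h 0 - c} = {}"
    proof -
      have "p dvd c" if "p dvd Polynomial.coeff g 0 * b - c" for b
        using dvd_diff[OF dvd_mult2[OF True, of b] that] by simp
      then show ?thesis using c by auto
    qed
    then show ?thesis by (metis card.empty zero_le)
  next
    case False
    then obtain i where i: "p dvd Polynomial.coeff g 0 * i - 1" using prime_int_inverse[OF p] by blast
    have "{h \<in> reduced_monic e p. p dvd Polynomial.coeff g 0 * Polynomial.coeff h 0 - c}
        \<subseteq> pCons ((i * c) mod p) ` reduced_monic e' p"
    proof clarify
      fix h assume h: "h \<in> reduced_monic e p" and dv: "p dvd Polynomial.coeff g 0 * Polynomial.coeff h 0 - c"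
      obtain b h' where bh: "h = pCons b h'" "b \<in> {0..<p}" "h' \<in> reduced_monic e' p"
        using h unfolding e' reduced_monic_Suc by auto
      have "p dvd i * (Polynomial.coeff g 0 * b - c) - b * (Polynomial.coeff g 0 * i - 1)"
        by (rule dvd_diff[OF dvd_mult dvd_mult]) (use dv bh(1) i in auto)
      then have "p dvd b - i * c" by (simp add: algebra_simps)
      then have "b mod p = (i * c) mod p" by (simp add: mod_eq_dvd_iff)
      then have "b = (i * c) mod p" using bh(2) by simp
      then show "h \<in> pCons ((i * c) mod p) ` reduced_monic e' p" using bh by blast
    qed
    then have "card {h \<in> reduced_monic e p. p dvd Polynomial.coeff g 0 * Polynomial.coeff h 0 - c}
        \<le> card (pCons ((i * c) mod p) ` reduced_monic e' p)"
      by (intro card_mono) (auto simp: card_reduced_monic)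
    also have "\<dots> \<le> card (reduced_monic e' p)" by (intro card_image_le card_reduced_monic)
    finally show ?thesis by (simp add: card_reduced_monic)
  qed
  then have "(\<Sum>g\<in>reduced_monic d p. card {h \<in> reduced_monic e p. p dvd Polynomial.coeff g 0 * Polynomial.coeff h 0 - c})
      \<le> (\<Sum>g\<in>reduced_monic d p. nat p ^ e')" by (intro sum_mono) auto
  then show ?thesis
    unfolding factor_pairs_def by (subst card_SigmaI) (auto simp: card_reduced_monic e' power_add)
qed

section \<open>Products of linear factors and exchange of roots\<close>

definition linprod :: "'b set \<Rightarrow> ('b \<Rightarrow> int) \<Rightarrow> int poly" where
  "linprod I a = (\<Prod>i\<in>I. [:- a i, 1:])"

lemma degree_linprod [simp]: "degree (linprod I a) = card I"
  unfolding linprod_def by (simp add: degree_prod_eq_sum_degree)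

lemma monic_linprod: "monic (linprod I a)"
  unfolding linprod_def by (subst lead_coeff_prod) simp

lemma coeff_linprod [simp]: "Polynomial.coeff (linprod I a) (card I) = 1"
  using monic_linprod[of I a] by simp

lemma monic_mult_int:
  fixes f g :: "int poly"
  assumes "monic f" "monic g"
  shows "monic (f * g)" "degree (f * g) = degree f + degree g"
proof -
  have "f \<noteq> 0" "g \<noteq> 0" using assms by auto
  then show "degree (f * g) = degree f + degree g" by (simp add: degree_mult_eq)
  show "monic (f * g)" using assms by (simp add: lead_coeff_mult)
qed

text \<open>The pairs (g, h) of monic polynomials with prescribed constant term of the product are at most as
  many as the possible products, so there are at least as many non-products as there are polynomials
  with two distinct factorizations. Exchanging a root of g with a root of h gives such polynomials.\<close>

lemma many_without_factor:
  assumes p: "prime p" "p > 3" and d: "0 < d" "d < n"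
  obtains F where "\<And>f. f \<in> F \<Longrightarrow> f \<in> reduced_monic n p \<and> p dvd Polynomial.coeff f 0 - (- 1) ^ n
      \<and> \<not> has_factor p d (n - d) f"
    and "nat (p - 1) ^ (n - 2) * nat (p - 3) \<le> card F * n ^ (n - 1)"
proof -
  have p1: "p > 1" using p by simp
  have n: "n \<ge> 2" using d by linarith
  let ?c = "(- 1) ^ n :: int" and ?e = "n - d"
  have c: "\<not> p dvd ?c" using p1 by (cases "even n") auto
  define F0 where "F0 = {f \<in> reduced_monic n p. p dvd Polynomial.coeff f 0 - ?c}"
  define P where "P = factor_pairs p d ?e ?c"
  define \<Phi> where "\<Phi> = (\<lambda>(g, h). redpoly p (g * h))"
  define F where "F = F0 - \<Phi> ` P"
  have P_fin: "finite P" unfolding P_def by (rule finite_factor_pairs)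
  have F_no: "f \<in> reduced_monic n p \<and> p dvd Polynomial.coeff f 0 - ?c \<and> \<not> has_factor p d ?e f" if "f \<in> F" for f
  proof -
    have f: "f \<in> reduced_monic n p" "p dvd Polynomial.coeff f 0 - ?c" "f \<notin> \<Phi> ` P"
      using that by (auto simp: F_def F0_def)
    have "\<not> has_factor p d ?e f"
    proof
      assume "has_factor p d ?e f"
      then obtain g h where gh: "monic g" "degree g = d" "monic h" "degree h = ?e" "[:p:] dvd f - g * h"
        by (auto simp: has_factor_def)
      define g' h' where "g' = redpoly p g" and "h' = redpoly p h"
      have g': "g' \<in> reduced_monic d p" "h' \<in> reduced_monic ?e p"
        unfolding g'_def h'_def using gh p1 by (auto intro: redpoly_reduced_monic)
      have "[:p:] dvd g * h - g' * h'"
        unfolding g'_def h'_def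
        by (intro dvd_mult_diff dvd_diff_swap[OF redpoly_cong])
      from dvd_add[OF gh(5) this] have fg: "[:p:] dvd f - g' * h'" by simp
      then have "p dvd Polynomial.coeff (f - g' * h') 0" by (simp only: const_poly_dvd_iff)
      then have "p dvd Polynomial.coeff f 0 - Polynomial.coeff g' 0 * Polynomial.coeff h' 0" by (simp add: coeff_mult_0)
      from dvd_diff[OF f(2) this] have "(g', h') \<in> P" using g' by (simp add: P_def factor_pairs_def)
      moreover have "\<Phi> (g', h') = f"
      proof (rule reduced_monic_cong_eq)
        have m: "monic g'" "monic h'" "degree g' = d" "degree h' = ?e" using g' by (auto simp: reduced_monic_def)
        show "\<Phi> (g', h') \<in> reduced_monic n p"
          unfolding \<Phi>_def prod.case
          by (rule redpoly_reduced_monic) (use monic_mult_int[OF m(1,2)] m d p1 in simp_all)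
        show "[:p:] dvd \<Phi> (g', h') - f"
          using dvd_diff[OF redpoly_cong[of p "g' * h'"] fg] by (simp add: \<Phi>_def)
      qed (rule f(1))
      ultimately show False using f(3) by force
    qed
    then show ?thesis using f by blast
  qed
  have F0_card: "nat p ^ (n - 1) \<le> card F0"
  proof -
    have "pCons (?c mod p) ` reduced_monic (n - 1) p \<subseteq> F0"
    proof clarify
      fix f assume "f \<in> reduced_monic (n - 1) p"
      then have "pCons (?c mod p) f \<in> reduced_monic (Suc (n - 1)) p"
        unfolding reduced_monic_Suc using p1 by force
      moreover have "p dvd ?c mod p - ?c" by (simp add: mod_eq_dvd_iff[symmetric])
      ultimately show "pCons (?c mod p) f \<in> F0" using n by (simp add: F0_def)
    qed
    moreover have "finite F0" unfolding F0_def by (rule finite_subset[OF _ card_reduced_monic(1)]) auto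
    ultimately have "card (pCons (?c mod p) ` reduced_monic (n - 1) p) \<le> card F0" by (rule card_mono[rotated])
    then show ?thesis by (simp add: card_image card_reduced_monic inj_on_def)
  qed
  \<comment> \<open>There are n - 2 free roots a_i, a root c, and a last root forced by the constant
    term: n roots in all.\<close>
  define I where "I = {1..<n - 1}"
  define R where "R = {1..p - 1}"
  have IR_fin: "finite I" "finite R" by (simp_all add: I_def R_def)
  \<comment> \<open>The last root is inverse to c times the product of the a_i; the condition says
    that it is not c, so that exchanging the two changes something.\<close>
  define Par where "Par = (SIGMA a : (I \<rightarrow>\<^sub>E R). {c \<in> R. \<not> p dvd c ^ 2 * (\<Prod>i\<in>I. a i) - 1})"
  have R: "\<not> p dvd r" if "r \<in> R" for r using that by (auto simp: R_def dest: zdvd_imp_le)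
  have R_eq: "r = r'" if "r \<in> R" "r' \<in> R" "p dvd r - r'" for r r'
  proof -
    have "r mod p = r' mod p" using that(3) by (simp add: mod_eq_dvd_iff)
    then show ?thesis using that(1,2) by (simp add: R_def)
  qed
  have R_ex: "\<exists>r\<in>R. p dvd r - x" if "\<not> p dvd x" for x
  proof -
    have "x mod p \<noteq> 0" using that by (simp add: dvd_eq_mod_eq_0)
    moreover have "0 \<le> x mod p" "x mod p < p" using p1 by simp_all
    ultimately have "x mod p \<in> R" by (simp add: R_def)
    moreover have "p dvd x mod p - x" by (simp add: mod_eq_dvd_iff[symmetric])
    ultimately show ?thesis by blast
  qed
  have PI: "\<not> p dvd (\<Prod>i\<in>I. a i)" if "a \<in> I \<rightarrow>\<^sub>E R" for a
  proof
    assume "p dvd (\<Prod>i\<in>I. a i)"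
    then obtain i where "i \<in> I" "p dvd a i" using p(1) by (auto simp: prime_dvd_prod_iff I_def)
    then show False using R that by (auto simp: PiE_iff)
  qed
  have last: "\<exists>b\<in>R. p dvd c * (\<Prod>i\<in>I. a i) * b - 1" if "a \<in> I \<rightarrow>\<^sub>E R" "c \<in> R" for a c
  proof -
    have "\<not> p dvd c * (\<Prod>i\<in>I. a i)" using PI[OF that(1)] R[OF that(2)] p(1) by (simp add: prime_dvd_mult_iff)
    then obtain x where x: "p dvd c * (\<Prod>i\<in>I. a i) * x - 1" using prime_int_inverse[OF p(1)] by blast
    have "\<not> p dvd x"
    proof
      assume "p dvd x"
      from dvd_diff[OF dvd_mult[OF this, of "c * (\<Prod>i\<in>I. a i)"] x] have "p dvd 1" by simp
      then show False using p1 by simp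
    qed
    then obtain b where b: "b \<in> R" "p dvd b - x" using R_ex by blast
    have "p dvd c * (\<Prod>i\<in>I. a i) * (b - x) + (c * (\<Prod>i\<in>I. a i) * x - 1)"
      by (rule dvd_add[OF dvd_mult[OF b(2)] x])
    then show ?thesis using b(1) by (auto simp: algebra_simps)
  qed
  define lst where "lst = (\<lambda>(a, c). SOME b. b \<in> R \<and> p dvd c * (\<Prod>i\<in>I. a i) * b - 1)"
  have lst: "lst (a, c) \<in> R \<and> p dvd c * (\<Prod>i\<in>I. a i) * lst (a, c) - 1" if "a \<in> I \<rightarrow>\<^sub>E R" "c \<in> R" for a c
    using someI_ex[of "\<lambda>b. b \<in> R \<and> p dvd c * (\<Prod>i\<in>I. a i) * b - 1"] last[OF that] unfolding lst_def by auto
  define pol where "pol = (\<lambda>(a, c). [:- c, 1:] * [:- lst (a, c), 1:] * linprod I a)"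
  have poly_pol: "poly (pol (a, c)) r = (r - c) * (r - lst (a, c)) * (\<Prod>i\<in>I. r - a i)" for a c r
    unfolding pol_def prod.case linprod_def poly_mult poly_prod by simp
  define C where "C = (\<lambda>x. redpoly p (pol x)) ` Par"
  have Par_fin: "finite Par"
    unfolding Par_def using IR_fin by (intro finite_SigmaI finite_PiE) auto
  have two: "\<exists>x\<in>P. \<exists>x'\<in>P. x \<noteq> x' \<and> \<Phi> x = y \<and> \<Phi> x' = y" if "y \<in> C" for y
  proof -
    obtain a c where ac: "a \<in> I \<rightarrow>\<^sub>E R" "c \<in> R" "\<not> p dvd c ^ 2 * (\<Prod>i\<in>I. a i) - 1"
      and y: "y = redpoly p (pol (a, c))" using \<open>y \<in> C\<close> by (auto simp: C_def Par_def)
    define b where "b = lst (a, c)"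
    have b: "b \<in> R" "p dvd c * (\<Prod>i\<in>I. a i) * b - 1" using lst[OF ac(1,2)] by (auto simp: b_def)
    have bc: "\<not> p dvd b - c"
    proof
      assume "p dvd b - c"
      from dvd_diff[OF b(2) dvd_mult[OF this, of "c * (\<Prod>i\<in>I. a i)"]]
      have "p dvd c ^ 2 * (\<Prod>i\<in>I. a i) - 1" by (simp add: algebra_simps power2_eq_square)
      then show False using ac(3) by simp
    qed
    \<comment> \<open>The free roots are divided into d - 1 for g and n - 1 - d for h; b and c
      supply the missing root of each, in either order.\<close>
    define A1 A2 where "A1 = {1..<d}" and "A2 = {d..<n - 1}"
    have A: "I = A1 \<union> A2" "A1 \<inter> A2 = {}" "finite A1" "finite A2" "card A1 = d - 1" "card A2 = n - 1 - d"
      using d by (auto simp: A1_def A2_def I_def)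
    have split: "linprod I a = linprod A1 a * linprod A2 a"
      unfolding linprod_def A(1) by (rule prod.union_disjoint) (use A in auto)
    have pair: "(redpoly p ([:- u, 1:] * linprod A1 a), redpoly p ([:- v, 1:] * linprod A2 a)) \<in> P
        \<and> \<Phi> (redpoly p ([:- u, 1:] * linprod A1 a), redpoly p ([:- v, 1:] * linprod A2 a)) = y"
      if uv: "u = c \<and> v = b \<or> u = b \<and> v = c" for u v
    proof -
      define g h where "g = [:- u, 1:] * linprod A1 a" and "h = [:- v, 1:] * linprod A2 a"
      have g: "monic g" "degree g = d" "monic h" "degree h = ?e"
      proof -
        have lin: "monic [:- u, 1:]" "degree [:- u, 1:] = 1" for u :: int by simp_all
        show "monic g" "monic h" unfolding g_def h_def by (intro monic_mult_int(1) lin monic_linprod)+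
        show "degree g = d" "degree h = ?e"
          unfolding g_def h_def monic_mult_int(2)[OF lin(1) monic_linprod] lin(2) degree_linprod
          using A d by auto
      qed
      have gh: "g * h = pol (a, c)"
        unfolding g_def h_def pol_def prod.case b_def[symmetric] split using uv by (auto simp: algebra_simps)
      define g' h' where "g' = redpoly p g" and "h' = redpoly p h"
      have g': "g' \<in> reduced_monic d p" "h' \<in> reduced_monic ?e p"
        unfolding g'_def h'_def using g p1 by (auto intro: redpoly_reduced_monic)
      have cong: "[:p:] dvd g' * h' - g * h"
        unfolding g'_def h'_def by (intro dvd_mult_diff redpoly_cong)
      have "card I + 2 = n" using n by (simp add: I_def)
      have "poly (pol (a, c)) 0 = (- c) * (- b) * (\<Prod>i\<in>I. - a i)"
        by (simp add: pol_def b_def linprod_def poly_prod)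
      also have "\<dots> = (- 1) ^ (card I + 2) * (c * (\<Prod>i\<in>I. a i) * b)"
        by (simp add: prod_uminus algebra_simps)
      finally have "poly (pol (a, c)) 0 = ?c * (c * (\<Prod>i\<in>I. a i) * b)"
        unfolding \<open>card I + 2 = n\<close> .
      then have const: "Polynomial.coeff (g * h) 0 = ?c * (c * (\<Prod>i\<in>I. a i) * b)"
        unfolding gh poly_0_coeff_0 .
      have "p dvd Polynomial.coeff (g' * h' - g * h) 0" using cong by (simp only: const_poly_dvd_iff)
      then have "p dvd (Polynomial.coeff g' 0 * Polynomial.coeff h' 0 - Polynomial.coeff (g * h) 0)
          + ?c * (c * (\<Prod>i\<in>I. a i) * b - 1)"
        using b(2) by (intro dvd_add dvd_mult) (simp_all add: coeff_mult_0)
      then have "(g', h') \<in> P"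
        using g' const by (simp add: P_def factor_pairs_def right_diff_distrib)
      moreover have "\<Phi> (g', h') = y"
      proof (rule reduced_monic_cong_eq)
        have m: "monic g'" "monic h'" "degree g' = d" "degree h' = ?e" using g' by (auto simp: reduced_monic_def)
        show "\<Phi> (g', h') \<in> reduced_monic n p"
          unfolding \<Phi>_def prod.case
          by (rule redpoly_reduced_monic) (use monic_mult_int[OF m(1,2)] m d p1 in simp_all)
        show "y \<in> reduced_monic n p"
          unfolding y gh[symmetric]
          by (rule redpoly_reduced_monic) (use monic_mult_int[OF g(1,3)] g d p1 in simp_all)
        have "[:p:] dvd (\<Phi> (g', h') - g' * h') + (g' * h' - g * h) - (y - g * h)"
          unfolding y gh[symmetric] \<Phi>_def prod.case
          by (rule dvd_diff[OF dvd_add[OF redpoly_cong cong] redpoly_cong])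
        then show "[:p:] dvd \<Phi> (g', h') - y" by simp
      qed
      ultimately show ?thesis by (simp add: g'_def h'_def g_def h_def)
    qed
    \<comment> \<open>The two choices of g differ by (b - c) times a monic polynomial, which is
      nonzero modulo p.\<close>
    have "redpoly p ([:- c, 1:] * linprod A1 a) \<noteq> redpoly p ([:- b, 1:] * linprod A1 a)"
    proof
      assume eq: "redpoly p ([:- c, 1:] * linprod A1 a) = redpoly p ([:- b, 1:] * linprod A1 a)"
      have cancel: "(x - y) - (x - z) = z - y" for x y z :: "int poly" by simp
      have "[:p:] dvd (redpoly p ([:- b, 1:] * linprod A1 a) - [:- b, 1:] * linprod A1 a)
          - (redpoly p ([:- c, 1:] * linprod A1 a) - [:- c, 1:] * linprod A1 a)"
        by (intro dvd_diff redpoly_cong)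
      then have "[:p:] dvd [:- c, 1:] * linprod A1 a - [:- b, 1:] * linprod A1 a"
        unfolding eq cancel .
      also have "[:- c, 1:] * linprod A1 a - [:- b, 1:] * linprod A1 a = Polynomial.smult (b - c) (linprod A1 a)"
        by (simp add: smult_diff_left)
      finally have "p dvd Polynomial.coeff (Polynomial.smult (b - c) (linprod A1 a)) (card A1)"
        by (simp only: const_poly_dvd_iff)
      then show False using bc coeff_linprod[of A1 a] by simp
    qed
    then show ?thesis using pair[of c b] pair[of b c] by blast
  qed
  \<comment> \<open>The roots of y modulo p form a set of at most n residues, and the n - 1 entries
    of a parameter (a, c) mapping to y must be drawn from it.\<close>
  have fibre: "card {x \<in> Par. redpoly p (pol x) = y} \<le> n ^ (n - 1)" if "y \<in> C" for y
  proof -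
    obtain a c where ac: "a \<in> I \<rightarrow>\<^sub>E R" "c \<in> R" and y: "y = redpoly p (pol (a, c))"
      using \<open>y \<in> C\<close> by (auto simp: C_def Par_def)
    define b where "b = lst (a, c)"
    have b: "b \<in> R" using lst[OF ac] by (simp add: b_def)
    define Z where "Z = insert c (insert b (a ` I))"
    have Z_fin: "finite Z" by (simp add: Z_def I_def)
    have "finite (a ` I)" using IR_fin by simp
    then have "card Z \<le> Suc (Suc (card (a ` I)))"
      unfolding Z_def by (simp add: card_insert_if)
    also have "card (a ` I) \<le> n - 2" using card_image_le[of I a] IR_fin by (simp add: I_def)
    finally have Z_card: "card Z \<le> n" using n by simp
    have root: "r \<in> Z" if "r \<in> R" "a' \<in> I \<rightarrow>\<^sub>E R" "c' \<in> R" "redpoly p (pol (a', c')) = y"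
      "r = c' \<or> r \<in> a' ` I" for r a' c'
    proof -
      have z: "poly (pol (a', c')) r = 0"
        using that(5) IR_fin by (auto simp: poly_pol)
      have "[:p:] dvd (redpoly p (pol (a', c')) - pol (a', c')) - (redpoly p (pol (a, c)) - pol (a, c))"
        by (intro dvd_diff redpoly_cong)
      then have "[:p:] dvd pol (a, c) - pol (a', c')" using that(4) y by simp
      then obtain k where "pol (a, c) - pol (a', c') = [:p:] * k" by (elim dvdE)
      then have "poly (pol (a, c) - pol (a', c')) r = p * poly k r" by simp
      then have "poly (pol (a, c)) r = p * poly k r" using z by simp
      moreover have "poly (pol (a, c)) r = (r - c) * (r - b) * (\<Prod>i\<in>I. r - a i)"
        by (simp add: poly_pol b_def)
      ultimately have "p dvd (r - c) * (r - b) * (\<Prod>i\<in>I. r - a i)" by simp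
      then consider "p dvd r - c" | "p dvd r - b" | i where "i \<in> I" "p dvd r - a i"
        using p(1) by (auto simp: prime_dvd_mult_iff prime_dvd_prod_iff I_def)
      then show ?thesis
      proof cases
        case 3
        then have "a i \<in> R" using ac(1) by (auto simp: PiE_iff)
        then show ?thesis using R_eq[OF that(1)] 3 by (auto simp: Z_def)
      qed (use R_eq that(1) ac b in \<open>auto simp: Z_def\<close>)
    qed
    have "{x \<in> Par. redpoly p (pol x) = y} \<subseteq> (I \<rightarrow>\<^sub>E Z) \<times> Z"
    proof
      fix z assume "z \<in> {x \<in> Par. redpoly p (pol x) = y}"
      then obtain a' c' where z: "z = (a', c')" and x: "(a', c') \<in> Par"
        and eq: "redpoly p (pol (a', c')) = y" by (cases z) auto
      then have x': "a' \<in> I \<rightarrow>\<^sub>E R" "c' \<in> R" by (auto simp: Par_def)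
      have "a' i \<in> Z" if "i \<in> I" for i
        using root[OF _ x' eq, of "a' i"] x'(1) that by (auto simp: PiE_iff)
      then have "a' \<in> I \<rightarrow>\<^sub>E Z" using x'(1) by (auto simp: PiE_iff)
      moreover have "c' \<in> Z" using root[OF x'(2) x' eq] by simp
      ultimately show "z \<in> (I \<rightarrow>\<^sub>E Z) \<times> Z" unfolding z by blast
    qed
    then have "card {x \<in> Par. redpoly p (pol x) = y} \<le> card ((I \<rightarrow>\<^sub>E Z) \<times> Z)"
      using Z_fin by (intro card_mono finite_cartesian_product finite_PiE) (auto simp: I_def)
    also have "\<dots> = card Z ^ card I * card Z" by (simp add: card_cartesian_product card_PiE I_def)
    also have "\<dots> \<le> n ^ card I * n" using Z_card by (intro mult_mono power_mono) auto
    also have "\<dots> = n ^ Suc (card I)" by simp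
    also have "Suc (card I) = n - 1" using n by (simp add: I_def)
    finally show ?thesis .
  qed
  have "card Par = card (\<Union>y\<in>C. {x \<in> Par. redpoly p (pol x) = y})"
    by (rule arg_cong[of _ _ card]) (auto simp: C_def)
  also have "\<dots> \<le> (\<Sum>y\<in>C. card {x \<in> Par. redpoly p (pol x) = y})"
    by (rule card_UN_le) (simp add: C_def Par_fin)
  also have "\<dots> \<le> (\<Sum>y\<in>C. n ^ (n - 1))" by (intro sum_mono fibre)
  finally have Par_C: "card Par \<le> card C * n ^ (n - 1)" by simp
  \<comment> \<open>For fixed a the excluded values of c solve a quadratic congruence, with at most
    two solutions of opposite sign, so at least p - 3 of the p - 1 residues remain.\<close>
  have Par_card: "nat (p - 1) ^ (n - 2) * nat (p - 3) \<le> card Par"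
  proof -
    have "nat (p - 3) \<le> card {c \<in> R. \<not> p dvd c ^ 2 * (\<Prod>i\<in>I. a i) - 1}" if a: "a \<in> I \<rightarrow>\<^sub>E R" for a
    proof -
      let ?B = "{c \<in> R. p dvd c ^ 2 * (\<Prod>i\<in>I. a i) - 1}"
      have fin: "finite ?B" "finite R" using IR_fin(2) by simp_all
      have "card ?B \<le> 2"
      proof (cases "?B = {}")
        case False
        then obtain c where c: "c \<in> ?B" by blast
        have "?B \<subseteq> {c, p - c}"
        proof
          fix c' assume c': "c' \<in> ?B"
          have "p dvd (c ^ 2 * (\<Prod>i\<in>I. a i) - 1) - (c' ^ 2 * (\<Prod>i\<in>I. a i) - 1)"
            by (rule dvd_diff) (use c c' in auto)
          then have "p dvd (c - c') * (c + c') * (\<Prod>i\<in>I. a i)" by (simp add: algebra_simps power2_eq_square)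
          then have "p dvd c - c' \<or> p dvd c + c'" using p(1) PI[OF a] by (auto simp: prime_dvd_mult_iff)
          then show "c' \<in> {c, p - c}"
          proof
            assume "p dvd c - c'"
            then show ?thesis using R_eq[of c c'] c c' by auto
          next
            assume "p dvd c + c'"
            then have "p dvd c + c' - p" by simp
            then have "p dvd c' - (p - c)" by (simp add: algebra_simps)
            moreover have "p - c \<in> R" using c by (auto simp: R_def)
            ultimately show ?thesis using R_eq[of c' "p - c"] c' by auto
          qed
        qed
        then have "card ?B \<le> card {c, p - c}" by (intro card_mono) auto
        also have "\<dots> \<le> 2" by (simp add: card_insert_if)
        finally show ?thesis .
      next
        case True
        then show ?thesis by (simp only: card.empty le0)
      qed
      moreover have "card {c \<in> R. \<not> p dvd c ^ 2 * (\<Prod>i\<in>I. a i) - 1} = card R - card ?B"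
      proof -
        have "{c \<in> R. \<not> p dvd c ^ 2 * (\<Prod>i\<in>I. a i) - 1} = R - ?B" by auto
        then show ?thesis using card_Diff_subset[of ?B R] fin by auto
      qed
      moreover have "card R = nat (p - 1)" by (simp add: R_def)
      ultimately show ?thesis using p by linarith
    qed
    then have "(\<Sum>a\<in>I \<rightarrow>\<^sub>E R. nat (p - 3)) \<le> (\<Sum>a\<in>I \<rightarrow>\<^sub>E R. card {c \<in> R. \<not> p dvd c ^ 2 * (\<Prod>i\<in>I. a i) - 1})"
      by (rule sum_mono)
    moreover have "card (I \<rightarrow>\<^sub>E R) = nat (p - 1) ^ (n - 2)" by (simp add: card_PiE I_def R_def numeral_2_eq_2)
    moreover have "card Par = (\<Sum>a\<in>I \<rightarrow>\<^sub>E R. card {c \<in> R. \<not> p dvd c ^ 2 * (\<Prod>i\<in>I. a i) - 1})"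
      unfolding Par_def using IR_fin by (intro card_SigmaI) (auto intro: finite_PiE)
    ultimately show ?thesis by simp
  qed
  \<comment> \<open>Since |P| <= p^(n-1) <= |F0|, every collision accounts for one candidate outside
    the image.\<close>
  have "card (\<Phi> ` P) + card C \<le> card P"
    by (rule card_image_plus_collisions[OF P_fin two])
  moreover have "card P \<le> nat p ^ (n - 1)"
    using card_factor_pairs[OF p(1) c, of ?e d] d by (simp add: P_def)
  moreover have "card F0 - card (\<Phi> ` P) \<le> card F"
    unfolding F_def using P_fin by (intro diff_card_le_card_Diff) auto
  ultimately have "card C \<le> card F" using F0_card by linarith
  then have "card C * n ^ (n - 1) \<le> card F * n ^ (n - 1)" by simp
  then have "nat (p - 1) ^ (n - 2) * nat (p - 3) \<le> card F * n ^ (n - 1)"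
    using Par_C Par_card by linarith
  then show ?thesis using that[of F] F_no by blast
qed

text \<open>By p > 6 both p - 1 and p - 3 are at least p / 2, which gives at least (p / (2 n))^(n-1)
  polynomials; \<open>card_SLp_le\<close> gives at least |SL(n, p)| / (2 p^(n-1)) matrices B. The
  powers of p cancel in the product, so the density does not depend on p.\<close>

theorem no_factor_density:
  fixes p :: int
  assumes p: "prime p" "p > 6" and d: "0 < d" "d < n"
  shows "card (carrier (SLp n p)) / (2 * (2 * real n) ^ (n - 1))
    \<le> card {g \<in> carrier (SLp n p). \<not> has_factor p d (n - d) (char_poly g)}"
proof -
  obtain F where F: "\<And>f. f \<in> F \<Longrightarrow> f \<in> reduced_monic n p \<and> p dvd Polynomial.coeff f 0 - (- 1) ^ n
      \<and> \<not> has_factor p d (n - d) f" "nat (p - 1) ^ (n - 2) * nat (p - 3) \<le> card F * n ^ (n - 1)"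
    using many_without_factor[OF p(1) _ d] p(2) by force
  have n: "n \<ge> 2" using d by linarith
  let ?N = "card {g \<in> carrier (SLp n p). \<not> has_factor p d (n - d) (char_poly g)}"
  define G b f P where "G = real (card (carrier (SLp n p)))" and "b = real (card (based_mats n p))"
    and "f = real (card F)" and "P = real_of_int p"
  have P: "P > 6" using p by (simp add: P_def)
  have 1: "b * f \<le> ?N"
    using card_no_factor_matrices[OF p(1) n F(1)] by (simp add: b_def f_def flip: of_nat_mult)
  have "real (card (carrier (SLp n p)) * nat (p - 1)) \<le> real (nat p ^ n * card (based_mats n p))"
    using card_SLp_le[OF p(1) n] by (simp only: of_nat_le_iff)
  then have 2: "G * (P - 1) \<le> P ^ n * b" using p by (simp add: G_def P_def b_def)
  have "real (nat (p - 1) ^ (n - 2) * nat (p - 3)) \<le> real (card F * n ^ (n - 1))"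
    using F(2) by (simp only: of_nat_le_iff)
  then have 3: "(P - 1) ^ (n - 2) * (P - 3) \<le> f * real n ^ (n - 1)" using p by (simp add: P_def f_def)
  have "(P / 2) ^ (n - 1) = (P / 2) ^ (n - 2) * (P / 2)"
  proof -
    have "n - 1 = Suc (n - 2)" using n by simp
    then show ?thesis by simp
  qed
  also have "\<dots> \<le> (P - 1) ^ (n - 2) * (P - 3)" using P by (intro mult_mono power_mono) auto
  finally have 4: "(P / 2) ^ (n - 1) \<le> f * real n ^ (n - 1)" using 3 by simp
  have Pn: "P ^ n = P * P ^ (n - 1)" using n by (cases n) auto
  have nn: "real n ^ (n - 1) > 0" using n by simp
  have "G * (P / 2) \<le> G * (P - 1)" using P by (intro mult_left_mono) (auto simp: G_def)
  also have "\<dots> \<le> P * (P ^ (n - 1) * b)" using 2 Pn by simp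
  finally have "P * (G / 2) \<le> P * (P ^ (n - 1) * b)" by (simp add: mult.commute)
  then have 5: "G / 2 \<le> P ^ (n - 1) * b" using P by (simp add: mult_le_cancel_left)
  have "P ^ (n - 1) / (2 * real n) ^ (n - 1) \<le> f"
    using 4 nn by (simp add: power_divide power_mult_distrib field_simps)
  then have "P ^ (n - 1) / (2 * real n) ^ (n - 1) * b \<le> f * b"
    by (rule mult_right_mono) (simp add: b_def)
  moreover have "(G / 2) / (2 * real n) ^ (n - 1) \<le> (P ^ (n - 1) * b) / (2 * real n) ^ (n - 1)"
    using 5 by (rule divide_right_mono) simp
  ultimately have "G / (2 * (2 * real n) ^ (n - 1)) \<le> f * b" by simp
  then show ?thesis using 1 by (simp add: G_def mult.commute)
qed

section \<open>Chebyshev's lower bound for primes\<close>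

text \<open>Passing from N to N + 1 raises N div q^i exactly for the i with q^i dividing N + 1, and
  their number is the multiplicity of q. A free cutoff K lets the factorials of m and 2 m share one
  range of summation.\<close>

lemma legendre_formula:
  fixes q :: nat
  assumes q: "prime q"
  shows "N \<le> K \<Longrightarrow> multiplicity q (fact N :: nat) = (\<Sum>i=1..K. N div q ^ i)"
proof (induction N)
  case (Suc N)
  have q2: "q \<ge> 2" using q by (rule prime_ge_2_nat)
  have mult_le: "multiplicity q (Suc N) \<le> K"
  proof -
    have "multiplicity q (Suc N) < 2 ^ multiplicity q (Suc N)" by (rule less_exp)
    also have "\<dots> \<le> q ^ multiplicity q (Suc N)" using q2 by (rule power_mono) simp
    also have "\<dots> \<le> Suc N" by (rule dvd_imp_le[OF multiplicity_dvd]) simp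
    finally show ?thesis using Suc.prems by linarith
  qed
  have "multiplicity q (fact (Suc N) :: nat) = multiplicity q (Suc N) + multiplicity q (fact N :: nat)"
    using q by (simp add: prime_elem_multiplicity_mult_distrib del: mult_Suc of_nat_Suc)
  also have "\<dots> = multiplicity q (Suc N) + (\<Sum>i=1..K. N div q ^ i)" using Suc by simp
  also have "multiplicity q (Suc N) = card {i \<in> {1..K}. q ^ i dvd Suc N}"
  proof -
    have "{i \<in> {1..K}. q ^ i dvd Suc N} = {1..multiplicity q (Suc N)}"
      using mult_le q2 by (auto simp: power_dvd_iff_le_multiplicity)
    then show ?thesis by simp
  qed
  also have "\<dots> = (\<Sum>i=1..K. of_bool (q ^ i dvd Suc N))"
    by (simp add: of_bool_def sum.If_cases Int_def)
  also have "\<dots> + (\<Sum>i=1..K. N div q ^ i) = (\<Sum>i=1..K. Suc N div q ^ i)"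
    unfolding sum.distrib[symmetric]
    by (rule sum.cong) (auto simp: div_Suc dvd_eq_mod_eq_0)
  finally show ?case .
qed simp

text \<open>The exponent is the sum of floor(2m / q^i) - 2 floor(m / q^i), where each term is 0 or
  1, and 0 once q^i > 2m. The number of i with q^i <= 2m is at most the largest of them.\<close>

lemma prime_power_central_binomial:
  fixes q :: nat
  assumes q: "prime q" and m: "m > 0"
  shows "q ^ multiplicity q ((2 * m) choose m) \<le> 2 * m"
proof -
  have q2: "q \<ge> 2" using q by (rule prime_ge_2_nat)
  let ?K = "2 * m"
  define T where "T = {i \<in> {1..?K}. q ^ i \<le> 2 * m}"
  have T_fin: "finite T" by (simp add: T_def)
  have "fact m * fact m * ((2 * m) choose m) = (fact (2 * m) :: nat)"
    using binomial_fact_lemma[of m "2 * m"] by (simp add: mult_2)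
  moreover have "((2 * m) choose m) > 0" by simp
  ultimately have "multiplicity q (fact (2 * m) :: nat)
      = 2 * multiplicity q (fact m :: nat) + multiplicity q ((2 * m) choose m)"
    using q by (metis prime_imp_prime_elem prime_elem_multiplicity_mult_distrib fact_nonzero mult_2 mult_eq_0_iff less_not_refl)
  then have "multiplicity q ((2 * m) choose m) + (\<Sum>i=1..?K. 2 * (m div q ^ i)) = (\<Sum>i=1..?K. 2 * m div q ^ i)"
    using legendre_formula[OF q, of "2 * m" ?K] legendre_formula[OF q, of m ?K]
    by (simp add: sum_distrib_left)
  also have "\<dots> \<le> (\<Sum>i=1..?K. of_bool (i \<in> T) + 2 * (m div q ^ i))"
  proof (rule sum_mono)
    fix i assume i: "i \<in> {1..?K}"
    have pos: "q ^ i > 0" using q2 by simp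
    show "2 * m div q ^ i \<le> of_bool (i \<in> T) + 2 * (m div q ^ i)"
    proof (cases "i \<in> T")
      case True
      have "m < (m div q ^ i + 1) * q ^ i" using pos by (metis Suc_eq_plus1 dividend_less_div_times mult.commute mult_Suc)
      then have "2 * m < (2 * (m div q ^ i) + 2) * q ^ i" by (simp add: algebra_simps)
      then have "2 * m div q ^ i < 2 * (m div q ^ i) + 2" by (simp add: less_mult_imp_div_less)
      then show ?thesis using True by simp
    next
      case False
      then have "2 * m < q ^ i" using i by (simp add: T_def)
      then show ?thesis by simp
    qed
  qed
  also have "\<dots> = card T + (\<Sum>i=1..?K. 2 * (m div q ^ i))"
  proof -
    have "{1..?K} \<inter> T = T" by (auto simp: T_def)
    then have "(\<Sum>i=1..?K. of_bool (i \<in> T)) = card T" by (simp add: of_bool_def sum.If_cases)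
    then show ?thesis by (simp only: sum.distrib)
  qed
  finally have le: "multiplicity q ((2 * m) choose m) \<le> card T" by simp
  show ?thesis
  proof (cases "T = {}")
    case True
    then show ?thesis using le m by simp
  next
    case False
    have "T \<subseteq> {1..Max T}" using T_fin by (auto simp: T_def)
    then have "card T \<le> Max T" using card_mono[of "{1..Max T}" T] by simp
    then have "q ^ multiplicity q ((2 * m) choose m) \<le> q ^ Max T"
      using le q2 by (intro power_increasing) auto
    also have "\<dots> \<le> 2 * m" using Max_in[OF T_fin False] by (simp add: T_def)
    finally show ?thesis .
  qed
qed

lemma central_binomial_le_primes:
  assumes m: "m > 0"
  shows "(2 * m) choose m \<le> (2 * m) ^ card {q. prime q \<and> q \<le> 2 * m}"
proof -
  let ?B = "(2 * m) choose m" and ?Q = "{q :: nat. prime q \<and> q \<le> 2 * m}"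
  have B: "?B > 0" by simp
  have sub: "prime_factors ?B \<subseteq> ?Q"
  proof
    fix q assume q: "q \<in> prime_factors ?B"
    then have pr: "prime q" and dv: "q dvd ?B" by (auto simp: prime_factors_dvd)
    have "multiplicity q ?B > 0" using pr dv B by (simp add: prime_multiplicity_gt_zero_iff)
    then have "q ^ 1 \<le> q ^ multiplicity q ?B" using prime_ge_2_nat[OF pr] by (intro power_increasing) auto
    then show "q \<in> ?Q" using prime_power_central_binomial[OF pr m] pr by simp
  qed
  have "?B = (\<Prod>q\<in>prime_factors ?B. q ^ multiplicity q ?B)" by (rule prime_factorization_nat[OF B])
  also have "\<dots> \<le> (\<Prod>q\<in>prime_factors ?B. 2 * m)"
    by (rule prod_mono) (auto intro: prime_power_central_binomial m)
  also have "\<dots> = (2 * m) ^ card (prime_factors ?B)" by simp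
  also have "\<dots> \<le> (2 * m) ^ card ?Q"
    using m by (intro power_increasing card_mono sub) auto
  finally show ?thesis .
qed

text \<open>The central binomial coefficient is at least 4^m / (2m); after taking logarithms, the
  denominator is the + 1 next to the prime count.\<close>

lemma prime_count_lower:
  assumes m: "m > 0"
  shows "real m * ln 4 \<le> (card {q :: nat. prime q \<and> q \<le> 2 * m} + 1) * ln (2 * real m)"
proof -
  let ?k = "card {q :: nat. prime q \<and> q \<le> 2 * m}"
  have "4 ^ m / (2 * real m) \<le> real ((2 * m) choose m)" using m by (rule central_binomial_lower_bound)
  also have "\<dots> \<le> real ((2 * m) ^ ?k)" using central_binomial_le_primes[OF m] by (simp only: of_nat_le_iff)
  finally have "4 ^ m \<le> (2 * real m) ^ (?k + 1)" using m by (simp add: field_simps)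
  then have "ln (4 ^ m) \<le> ln ((2 * real m) ^ (?k + 1))" using m by (subst ln_le_cancel_iff) auto
  moreover have "ln ((4 :: real) ^ m) = real m * ln 4" by (rule ln_realpow)
  moreover have "ln ((2 * real m) ^ (?k + 1)) = real (?k + 1) * ln (2 * real m)"
    by (rule ln_realpow)
  ultimately show ?thesis by simp
qed

text \<open>The primes up to r^2 number at least a constant times r^2 / ln r, which eventually
  exceeds r with room to spare.\<close>

lemma many_primes:
  "\<forall>\<^sub>F r in sequentially. \<exists>Q. finite Q \<and> card Q = r \<and> (\<forall>q\<in>Q. prime (q :: nat) \<and> 6 < q \<and> q \<le> r ^ 2)"
proof -
  \<comment> \<open>The 8 covers the seven naturals up to 6, which are removed, and the + 1 of
    \<open>prime_count_lower\<close>.\<close>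
  have ev: "\<forall>\<^sub>F r :: nat in sequentially. (real r + 8) * ln ((real r)\<^sup>2) < ((real r)\<^sup>2 / 2 - 1) * ln 4"
    by real_asymp
  show ?thesis
    using ev eventually_ge_at_top[of 4]
  proof eventually_elim
    case (elim r)
    define m where "m = r\<^sup>2 div 2"
    have r0: "r > 0" using elim(2) by simp
    have r2: "r\<^sup>2 \<ge> 16" using elim(2) power_mono[of 4 r 2] by simp
    then have m: "m > 0" "2 * m \<le> r\<^sup>2" "r\<^sup>2 \<le> 2 * m + 1" by (auto simp: m_def)
    have "real (r\<^sup>2) \<le> real (2 * m + 1)" using m(3) by (simp only: of_nat_le_iff)
    then have mr: "(real r)\<^sup>2 / 2 - 1 \<le> real m" by simp
    let ?A = "{q :: nat. prime q \<and> q \<le> 2 * m}"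
    have fin: "finite ?A" by (rule finite_subset[of _ "{..2 * m}"]) auto
    have "real (2 * m) \<le> real (r\<^sup>2)" using m(2) by (simp only: of_nat_le_iff)
    then have lnm: "ln (2 * real m) \<le> ln ((real r)\<^sup>2)" using m(1) r0 by (subst ln_le_cancel_iff) auto
    have "real 16 \<le> real (r\<^sup>2)" using r2 by (simp only: of_nat_le_iff)
    then have "(real r)\<^sup>2 > 1" by simp
    then have lnr: "ln ((real r)\<^sup>2) > 0" by (rule ln_gt_zero)
    have "(real r + 8) * ln ((real r)\<^sup>2) < ((real r)\<^sup>2 / 2 - 1) * ln 4" by (rule elim(1))
    also have "\<dots> \<le> real m * ln 4" using mr by (intro mult_right_mono) auto
    also have "\<dots> \<le> (card ?A + 1) * ln (2 * real m)" by (rule prime_count_lower[OF m(1)])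
    also have "\<dots> \<le> (card ?A + 1) * ln ((real r)\<^sup>2)" using lnm by (intro mult_left_mono) auto
    finally have "real r + 8 < real (card ?A) + 1" using lnr by (simp add: mult_less_cancel_right)
    then have "r + 7 \<le> card ?A" by linarith
    moreover have "card ?A - card {..6 :: nat} \<le> card (?A - {..6})"
      by (rule diff_card_le_card_Diff) simp
    ultimately have "r \<le> card (?A - {..6})" by simp
    then obtain Q where Q: "Q \<subseteq> ?A - {..6}" "card Q = r"
      using obtain_subset_with_card_n[of r "?A - {..6}"] by blast
    then have "finite Q" using fin finite_subset[OF Q(1)] by simp
    moreover have "\<forall>q\<in>Q. prime q \<and> 6 < q \<and> q \<le> r\<^sup>2" using Q(1) m(2) by auto
    ultimately show ?case using Q(2) by blast
  qed
qed

section \<open>The sieve\<close>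

lemma charpoly_T_eq:
  assumes A: "A \<in> carrier_mat n n"
  shows "charpoly_T A = (- 1) ^ n * char_poly A"
proof -
  have "map_mat (\<lambda>a. [:a:]) A - [:0, 1:] \<cdot>\<^sub>m 1\<^sub>m (dim_row A) = (- 1) \<cdot>\<^sub>m char_poly_matrix A"
    by (rule eq_matI) (use A in \<open>auto simp: char_poly_matrix_def\<close>)
  then show ?thesis
    using carrier_matD[OF char_poly_matrix_closed[OF A]] by (simp add: charpoly_T_def char_poly_def)
qed

text \<open>The leading coefficients of the two factors multiply to 1, so both are 1 or both are -1.
  Hence a non-unit factor has positive degree, and multiplying each factor by its leading
  coefficient makes both monic.\<close>

lemma monic_not_irreducible:
  fixes f :: "int poly"
  assumes f: "monic f" "degree f > 0" "\<not> irreducible f"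
  obtains g h where "monic g" "monic h" "f = g * h" "0 < degree g" "degree g < degree f"
    "degree h = degree f - degree g"
proof -
  have "f \<noteq> 0" using f by auto
  have nu: "\<not> is_unit f"
  proof
    assume "is_unit f"
    then obtain c where "f = [:c:]" by (auto simp: is_unit_poly_iff)
    then show False using f(2) by simp
  qed
  obtain a b where ab: "f = a * b" "\<not> is_unit a" "\<not> is_unit b"
    using f(3) \<open>f \<noteq> 0\<close> nu by (auto simp: irreducible_def)
  have ab0: "a \<noteq> 0" "b \<noteq> 0" using ab(1) \<open>f \<noteq> 0\<close> by auto
  have lead: "lead_coeff a * lead_coeff b = 1" using f(1) ab(1) by (simp add: lead_coeff_mult)
  have la: "lead_coeff a * lead_coeff a = 1" "lead_coeff b * lead_coeff b = 1"
    using lead by (auto simp: zmult_eq_1_iff)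
  have pos: "degree x > 0" if "\<not> is_unit x" "lead_coeff x * lead_coeff x = 1" for x :: "int poly"
  proof (rule ccontr)
    assume "\<not> degree x > 0"
    then obtain c where c: "x = [:c:]" using degree_eq_zeroE by blast
    then have "c * c = 1" using that(2) by simp
    then have "is_unit c" by (metis dvd_triv_left)
    then show False using that(1) c by simp
  qed
  have deg: "degree f = degree a + degree b" unfolding ab(1) using ab0 by (simp add: degree_mult_eq)
  define g h where "g = Polynomial.smult (lead_coeff a) a" and "h = Polynomial.smult (lead_coeff b) b"
  have nz: "lead_coeff a \<noteq> 0" "lead_coeff b \<noteq> 0" using ab0 by auto
  have dg: "degree g = degree a" "degree h = degree b" using nz by (simp_all add: g_def h_def)
  show thesis
  proof (rule that[of g h])
    show "monic g" "monic h" unfolding dg unfolding g_def h_def using la by simp_all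
    have "g * h = Polynomial.smult (lead_coeff a * lead_coeff b) (a * b)" by (simp add: g_def h_def mult.commute)
    then show "f = g * h" using lead ab(1) by simp
    show "0 < degree g" "degree g < degree f" "degree h = degree f - degree g"
      using dg deg pos[OF ab(2) la(1)] pos[OF ab(3) la(2)] by auto
  qed
qed

definition splits_in :: "nat \<Rightarrow> nat \<Rightarrow> int mat set" where
  "splits_in n d = {A. \<exists>g h. monic g \<and> degree g = d \<and> monic h \<and> degree h = n - d \<and> char_poly A = g * h}"

lemma reducible_splits_in:
  assumes A: "A \<in> carrier_mat n n" and n: "n > 0" and red: "\<not> irreducible (charpoly_T A)"
  shows "\<exists>d. 0 < d \<and> d < n \<and> A \<in> splits_in n d"
proof -
  have f: "degree (char_poly A) = n" "monic (char_poly A)" using degree_monic_char_poly[OF A] by auto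
  have unit: "is_unit ((- 1) ^ n :: int poly)" by (simp add: is_unit_power_iff)
  have nirr: "\<not> irreducible (char_poly A)"
    using red unfolding charpoly_T_eq[OF A] irreducible_mult_unit_left[OF unit] .
  have "degree (char_poly A) > 0" using f(1) n by simp
  from monic_not_irreducible[OF f(2) this nirr]
  obtain g h where "monic g" "monic h" "char_poly A = g * h" "0 < degree g" "degree g < degree (char_poly A)"
    "degree h = degree (char_poly A) - degree g" by blast
  note this[unfolded f(1)]
  then show ?thesis unfolding splits_in_def by blast
qed

text \<open>The case of the identity as intertwiner in \<open>char_poly_intertwine\<close>.\<close>

lemma char_poly_mat_cong:
  fixes p :: int
  assumes p: "prime p" and A: "A \<in> carrier_mat n n" and AB: "mat_cong p A B"
  shows "[:p:] dvd char_poly A - char_poly B"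
proof -
  have B: "B \<in> carrier_mat n n" using mat_congD(1)[OF AB A] .
  have np: "\<not> p dvd Determinant.det (1\<^sub>m n :: int mat)" using p not_prime_unit by auto
  have "mat_cong p (A * 1\<^sub>m n) (1\<^sub>m n * B)"
    unfolding right_mult_one_mat[OF A] left_mult_one_mat[OF B] by (rule AB)
  from char_poly_intertwine[OF p A one_carrier_mat B this np] show ?thesis .
qed

lemma exists_power_2_between: "r \<ge> 1 \<Longrightarrow> \<exists>t. r \<le> 2 ^ t \<and> 2 ^ t \<le> 2 * (r :: nat)"
proof (induction r rule: nat_induct_at_least)
  case base
  show ?case by (rule exI[of _ 0]) simp
next
  case (Suc r)
  then obtain t where t: "r \<le> 2 ^ t" "2 ^ t \<le> 2 * r" by blast
  show ?case
  proof (cases "r = 2 ^ t")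
    case True
    then show ?thesis using Suc.hyps by (intro exI[of _ "Suc t"]) auto
  next
    case False
    then show ?thesis using t by (intro exI[of _ t]) auto
  qed
qed

context SL_generators
begin

text \<open>Reduction modulo all primes of \<open>Q\<close> makes the walk a
  \<open>finite_sym_walk\<close> on the product group, with diameter m from
  \<open>simultaneous_words\<close>. A matrix split in degree d lands in the box of local bad sets,
  and \<open>no_factor_density\<close> bounds each side of the box.\<close>

lemma sieve_bound:
  assumes C: "C > 0" "\<forall>i<n. \<forall>j<n. i \<noteq> j \<longrightarrow> addrow_mat n 2 i j \<in> W C"
    and d: "0 < d" "d < n"
    and Q: "finite Q" "card Q = r" "\<And>q. q \<in> Q \<Longrightarrow> prime q \<and> 6 < q \<and> q \<le> r ^ 2"
    and t: "r \<le> 2 ^ t" and r: "r \<ge> 1"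
  defines "m \<equiv> r * (n * (n + 2) * (12 ^ t * (C * (r ^ 2) ^ 2)))"
  shows "card {xs \<in> words S k. mprod n xs \<in> splits_in n d} / card S ^ k
    \<le> (1 - 1 / (2 * (2 * real n) ^ (n - 1))) ^ r
      + sqrt (real (r ^ 2) ^ (n * n * r) * (1 - 1 / (m * card S)\<^sup>2) ^ k)"
proof -
  let ?\<delta> = "1 / (2 * (2 * real n) ^ (n - 1))"
  define Q' where "Q' = int ` Q"
  have Q': "finite Q'" "card Q' = r" "\<And>p. p \<in> Q' \<Longrightarrow> prime p \<and> 6 < p \<and> p \<le> int (r ^ 2)"
    using Q unfolding Q'_def by (auto simp: card_image inj_on_def)
  define G where "G = product_group Q' (SLp n)"
  define \<sigma> where "\<sigma> s = (\<lambda>p\<in>Q'. redm p s)" for s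
  have car: "carrier G = (\<Pi>\<^sub>E p\<in>Q'. carrier (SLp n p))" by (simp add: G_def)
  have SLp_fin: "finite (carrier (SLp n p))" "card (carrier (SLp n p)) \<le> (r ^ 2) ^ (n * n)" if "p \<in> Q'" for p
  proof -
    have p: "0 < p" "p \<le> int (r ^ 2)" using Q'(3)[OF that] by auto
    show "finite (carrier (SLp n p))"
      by (rule finite_subset[OF SLp_subset_reduced reduced_mats_bound(1)[OF p(1)]])
    have "card (carrier (SLp n p)) \<le> card (reduced_mats n p)"
      by (rule card_mono[OF reduced_mats_bound(1)[OF p(1)] SLp_subset_reduced])
    also have "\<dots> \<le> nat p ^ (n * n)" by (rule reduced_mats_bound(2)[OF p(1)])
    also have "\<dots> \<le> (r ^ 2) ^ (n * n)" using p by (intro power_mono) (simp_all add: nat_le_iff)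
    finally show "card (carrier (SLp n p)) \<le> (r ^ 2) ^ (n * n)" .
  qed
  have \<sigma>_SL: "\<sigma> A \<in> carrier G" if "A \<in> SL_int n" for A
    using that unfolding car \<sigma>_def by (auto simp: SL_int_def intro!: redm_SLp)
  have \<sigma>_mult: "\<sigma> A \<otimes>\<^bsub>G\<^esub> \<sigma> B = \<sigma> (A * B)" if "A \<in> SL_int n" "B \<in> SL_int n" for A B
    using that by (auto simp: G_def \<sigma>_def SL_int_def redm_mult intro!: restrict_ext)
  have grp: "group G" unfolding G_def by (rule product_group) (rule group_SLp)
  interpret finite_sym_walk G S \<sigma>
  proof (intro finite_sym_walk.intro finite_sym_walk_axioms.intro grp S_fin S_ne)
    show "finite (carrier G)" unfolding car using Q'(1) SLp_fin(1) by (rule finite_PiE)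
    fix s assume s: "s \<in> S"
    then have sSL: "s \<in> SL_int n" using S_sub by blast
    then show "\<sigma> s \<in> carrier G" by (rule \<sigma>_SL)
    obtain s' where s': "s' \<in> S" "s * s' = 1\<^sub>m n" using S_sym s by blast
    have s'SL: "s' \<in> SL_int n" using S_sub s' by blast
    have "s' * s = 1\<^sub>m n" using SL_int_inverse_comm[OF sSL S_carrier[OF s'(1)] s'(2)] .
    then have "\<sigma> s' \<otimes>\<^bsub>G\<^esub> \<sigma> s = \<one>\<^bsub>G\<^esub>"
      unfolding \<sigma>_mult[OF s'SL sSL] by (simp add: \<sigma>_def G_def)
    then have "inv\<^bsub>G\<^esub> (\<sigma> s) = \<sigma> s'"
      using group.inv_equality[OF grp _ \<sigma>_SL[OF sSL] \<sigma>_SL[OF s'SL]] by blast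
    then show "\<exists>s'\<in>S. \<sigma> s' = inv\<^bsub>G\<^esub> (\<sigma> s)" using s'(1) by auto
  qed
  have wprod_eq: "wprod xs = \<sigma> (mprod n xs)" if "set xs \<subseteq> S" for xs
    using that
  proof (induction xs rule: rev_induct)
    case Nil
    show ?case unfolding wprod_def by (simp add: \<sigma>_def G_def)
  next
    case (snoc s xs)
    then have "mprod n xs \<in> SL_int n" "s \<in> SL_int n" using mprod_SL S_sub by auto
    then show ?case using snoc \<sigma>_mult by (simp add: wprod_snoc)
  qed
  have m: "m > 0" using r n2 C by (simp add: m_def)
  have diam: "\<exists>xs\<in>words S (2 * m). wprod xs = g" if g: "g \<in> carrier G" for g
  proof -
    have gp: "g p \<in> carrier (SLp n p)" if "p \<in> Q'" for p using g that unfolding car by (auto simp: PiE_iff)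
    have "\<exists>w\<in>W (card Q' * (n * (n + 2) * (12 ^ t * (C * (r ^ 2) ^ 2)))). \<forall>p\<in>Q'. mat_cong p w (g p)"
    proof (rule simultaneous_words[OF C(2) Q'(1)])
      show "card Q' \<le> 2 ^ t" using t Q'(2) by simp
      show "prime p \<and> 3 < p \<and> p \<le> int (r ^ 2)" if "p \<in> Q'" for p using Q'(3)[OF that] by auto
      show "g p \<in> carrier_mat n n \<and> p dvd Determinant.det (g p) - 1" if "p \<in> Q'" for p
        using gp[OF that] by (simp add: SLp_carrier)
    qed
    then obtain w where w: "w \<in> W m" "\<And>p. p \<in> Q' \<Longrightarrow> mat_cong p w (g p)"
      unfolding Q'(2) m_def by blast
    then obtain xs where xs: "xs \<in> words S (2 * m)" "w = mprod n xs" unfolding W_def by blast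
    have "\<sigma> w = g"
    proof
      fix p
      show "\<sigma> w p = g p"
      proof (cases "p \<in> Q'")
        case True
        have "redm p w = redm p (g p)" using w(2)[OF True] by (simp add: redm_eq_iff)
        then show ?thesis using True gp[OF True] by (simp add: \<sigma>_def SLp_carrier)
      next
        case False
        then show ?thesis using g unfolding car by (auto simp: \<sigma>_def PiE_iff extensional_def)
      qed
    qed
    moreover have "set xs \<subseteq> S" using xs(1) by (simp add: words_def)
    ultimately show ?thesis using xs wprod_eq by blast
  qed
  define bad where "bad p = {g \<in> carrier (SLp n p). has_factor p d (n - d) (char_poly g)}" for p
  define B where "B = (\<Pi>\<^sub>E p\<in>Q'. bad p)"
  have B_sub: "B \<subseteq> carrier G" unfolding B_def car by (rule PiE_mono) (auto simp: bad_def)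
  have in_B: "wprod xs \<in> B" if xs: "xs \<in> words S k" "mprod n xs \<in> splits_in n d" for xs
  proof -
    have sub: "set xs \<subseteq> S" using xs(1) by (simp add: words_def)
    let ?A = "mprod n xs"
    have A: "?A \<in> SL_int n" "?A \<in> carrier_mat n n" using mprod_SL[OF sub] mprod_carrier[OF sub] by auto
    obtain g h where gh: "monic g" "degree g = d" "monic h" "degree h = n - d" "char_poly ?A = g * h"
      using xs(2) by (auto simp: splits_in_def)
    have "redm p ?A \<in> bad p" if p: "p \<in> Q'" for p
    proof -
      have "[:p:] dvd char_poly (redm p ?A) - g * h"
        using char_poly_mat_cong[of p "redm p ?A" n ?A] Q'(3)[OF p] A redm_cong gh(5) by auto
      then have "has_factor p d (n - d) (char_poly (redm p ?A))" using gh unfolding has_factor_def by blast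
      moreover have "redm p ?A \<in> carrier (SLp n p)" using A by (intro redm_SLp) (auto simp: SL_int_def)
      ultimately show ?thesis by (simp add: bad_def)
    qed
    then show ?thesis unfolding wprod_eq[OF sub] by (auto simp: \<sigma>_def B_def)
  qed
  have "real (card {xs \<in> words S k. mprod n xs \<in> splits_in n d}) \<le> real (card {xs \<in> words S k. wprod xs \<in> B})"
    unfolding of_nat_le_iff by (rule card_mono) (use S_fin in_B in auto)
  then have "card {xs \<in> words S k. mprod n xs \<in> splits_in n d} / card S ^ k
      \<le> card {xs \<in> words S k. wprod xs \<in> B} / card S ^ k"
    by (rule divide_right_mono) simp
  also have "\<dots> \<le> card B / card (carrier G) + sqrt (card (carrier G) * (1 - 1 / (m * card S)\<^sup>2) ^ k)"
    by (rule mixing[OF m diam B_sub])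
  also have "card B / card (carrier G) \<le> (1 - ?\<delta>) ^ r"
  proof -
    have local_bound: "real (card (bad p)) / real (card (carrier (SLp n p))) \<le> 1 - ?\<delta>" if p: "p \<in> Q'" for p
    proof -
      let ?H = "carrier (SLp n p)"
      let ?N = "{g \<in> ?H. \<not> has_factor p d (n - d) (char_poly g)}"
      have "card ?H / (2 * (2 * real n) ^ (n - 1)) \<le> card ?N"
        using no_factor_density[OF _ _ d, of p] Q'(3)[OF p] by blast
      moreover have "card ?H = card (bad p) + card ?N"
      proof -
        have "?H = bad p \<union> ?N" "bad p \<inter> ?N = {}" by (auto simp: bad_def)
        moreover have "finite (bad p)" "finite ?N"
          using SLp_fin(1)[OF p] by (auto simp: bad_def)
        ultimately show ?thesis using card_Un_disjoint by metis
      qed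
      ultimately have "real (card (bad p)) \<le> (1 - ?\<delta>) * card ?H" by (simp add: left_diff_distrib)
      moreover have "card ?H > 0"
      proof -
        have "?H \<noteq> {}" using monoid.one_closed[OF group.is_monoid[OF group_SLp], of n p] by blast
        then show ?thesis using SLp_fin(1)[OF p] by (simp add: card_gt_0_iff)
      qed
      ultimately show ?thesis by (simp add: divide_le_eq)
    qed
    have "card B / card (carrier G) = (\<Prod>p\<in>Q'. real (card (bad p)) / real (card (carrier (SLp n p))))"
      unfolding B_def car using Q'(1) by (simp add: card_PiE prod_dividef)
    also have "\<dots> \<le> (\<Prod>p\<in>Q'. 1 - ?\<delta>)" by (rule prod_mono) (use local_bound in auto)
    also have "\<dots> = (1 - ?\<delta>) ^ r" using Q'(2) by simp
    finally show ?thesis .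
  qed
  also have "sqrt (card (carrier G) * (1 - 1 / (m * card S)\<^sup>2) ^ k)
      \<le> sqrt (real (r ^ 2) ^ (n * n * r) * (1 - 1 / (m * card S)\<^sup>2) ^ k)"
  proof (intro real_sqrt_le_mono mult_right_mono)
    have "card (carrier G) = (\<Prod>p\<in>Q'. card (carrier (SLp n p)))" unfolding car by (rule card_PiE[OF Q'(1)])
    also have "\<dots> \<le> (\<Prod>p\<in>Q'. (r ^ 2) ^ (n * n))" by (rule prod_mono) (use SLp_fin(2) in auto)
    also have "\<dots> = (r ^ 2) ^ (n * n * r)" using Q'(2) by (simp add: power_mult)
    finally have "real (card (carrier G)) \<le> real ((r ^ 2) ^ (n * n * r))" by (simp only: of_nat_le_iff)
    then show "real (card (carrier G)) \<le> real (r ^ 2) ^ (n * n * r)" by simp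
    have "m * card S \<ge> 1" using m S_fin S_ne by (simp add: Suc_le_eq card_gt_0_iff)
    then have "(m * card S)\<^sup>2 \<ge> 1" by simp
    then have "real ((m * card S)\<^sup>2) \<ge> 1" by linarith
    then show "0 \<le> (1 - 1 / real ((m * card S)\<^sup>2)) ^ k"
      using m S_fin S_ne by (intro zero_le_power) (simp add: divide_le_eq_1 card_gt_0_iff)
  qed
  finally show ?thesis by simp
qed

end

text \<open>Here a ln k + 1 bounds the number r of primes. The first exponent is n^2 r ln r, from
  the square root of the group order; the second is k times half the spectral gap, whose power 18 is
  the square of the r^9 in the bound for m |S|.\<close>

lemma decay_asymptotics:
  fixes a b c :: real
  assumes "a > 0" "b > 0" "c > 0"
  shows "\<forall>\<^sub>F k :: nat in sequentially.
    exp (b * (a * ln k + 1) * ln (a * ln k + 1) - k / (c * (a * ln k + 1) ^ 18)) \<le> 1 / (real k)\<^sup>2"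
  using assms by real_asymp

context SL_generators
begin

text \<open>Each of the two terms of \<open>sieve_bound\<close> is brought below 1 / k^2: r is just
  large enough for the sieve term, and small enough for the product group to be well mixed by time
  k.\<close>

lemma splits_in_summable_bound:
  assumes d: "0 < d" "d < n"
  shows "\<forall>\<^sub>F k in sequentially.
    card {xs \<in> words S k. mprod n xs \<in> splits_in n d} / card S ^ k \<le> 2 / (real k)\<^sup>2"
proof -
  define \<delta> where "\<delta> = 1 / (2 * (2 * real n) ^ (n - 1))"
  have \<delta>: "0 < \<delta>" "\<delta> \<le> 1"
  proof -
    have "1 \<le> (2 * real n) ^ (n - 1)" using n2 by (intro one_le_power) simp
    then show "0 < \<delta>" "\<delta> \<le> 1" by (auto simp: \<delta>_def divide_le_eq_1)
  qed
  obtain C where C: "C > 0" "\<forall>i<n. \<forall>j<n. i \<noteq> j \<longrightarrow> addrow_mat n 2 i j \<in> W C"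
    using elementary_square_words by blast
  \<comment> \<open>Collects the constants of m |S|; the 16 comes from 12^t <= (2^t)^4 <= 16
    r^4.\<close>
  define K where "K = 16 * (n * (n + 2)) * C * card S"
  have K: "K > 0" using n2 C S_fin S_ne by (simp add: K_def card_gt_0_iff)
  \<comment> \<open>For r >= a ln k this makes (1 - \<delta>)^r <= exp (- \<delta> r) <=
    k^(-2).\<close>
  define a where "a = 2 / \<delta>"
  have a: "a > 0" using \<delta> by (simp add: a_def)
  define R where "R k = nat \<lceil>a * ln (real k)\<rceil>" for k
  have R_lim: "filterlim R at_top sequentially"
    unfolding R_def using a by real_asymp
  have primes: "\<forall>\<^sub>F k in sequentially. \<exists>Q. finite Q \<and> card Q = R k \<and> (\<forall>q\<in>Q. prime q \<and> 6 < q \<and> q \<le> (R k)\<^sup>2)"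
    using eventually_compose_filterlim[OF many_primes R_lim] .
  have R1: "\<forall>\<^sub>F k in sequentially. R k \<ge> 1"
    using R_lim by (simp add: filterlim_at_top)
  have b: "real (n * n) > 0" using n2 by simp
  have c: "2 * (real K)\<^sup>2 > 0" using K by simp
  from primes R1 eventually_ge_at_top[of 1] decay_asymptotics[OF a b c]
  show ?thesis
  proof eventually_elim
    case (elim k)
    define r where "r = R k"
    define \<rho> where "\<rho> = a * ln (real k) + 1"
    obtain Q where Q: "finite Q" "card Q = r" "\<And>q. q \<in> Q \<Longrightarrow> prime q \<and> 6 < q \<and> q \<le> r\<^sup>2"
      using elim(1) unfolding r_def by blast
    have r1: "r \<ge> 1" using elim(2) by (simp add: r_def)
    have lnk: "ln (real k) \<ge> 0" using elim(3) by simp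
    have r_lower: "a * ln (real k) \<le> real r" unfolding r_def R_def by linarith
    have r_upper: "real r \<le> \<rho>" unfolding r_def R_def \<rho>_def using a lnk mult_nonneg_nonneg[of a "ln (real k)"] by linarith
    obtain t where t: "r \<le> 2 ^ t" "2 ^ t \<le> 2 * r" using exists_power_2_between[OF r1] by blast
    define m where "m = r * (n * (n + 2) * (12 ^ t * (C * (r ^ 2) ^ 2)))"
    define q where "q = 1 - 1 / (real (m * card S))\<^sup>2"
    have m_bound: "m * card S \<le> K * r ^ 9"
    proof -
      have "(12::nat) ^ t \<le> 16 ^ t" by (rule power_mono) auto
      also have "(16::nat) ^ t = (2 ^ t) ^ 4" by (simp add: power_mult[symmetric] mult.commute[of t] power_mult)
      also have "\<dots> \<le> (2 * r) ^ 4" using t(2) by (rule power_mono) simp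
      finally have "12 ^ t \<le> 16 * r ^ 4" by (simp add: power_mult_distrib)
      \<comment> \<open>The power r^9 is r from the number of primes, r^4 from 12^t, and r^4 from
        the square of the bound r^2 on the primes.\<close>
      then have "m * card S \<le> r * (n * (n + 2) * ((16 * r ^ 4) * (C * (r ^ 2) ^ 2))) * card S"
        unfolding m_def by (intro mult_le_mono le_refl)
      also have "\<dots> = K * r ^ 9" by (simp add: K_def algebra_simps eval_nat_numeral)
      finally show ?thesis .
    qed
    have ms: "m * card S > 0" using r1 n2 C S_fin S_ne by (simp add: m_def card_gt_0_iff)
    have q0: "0 \<le> q"
    proof -
      have "1 \<le> real (m * card S)" using ms by linarith
      then have "1 \<le> (real (m * card S))\<^sup>2" by (rule one_le_power)
      then show ?thesis using ms by (simp add: q_def divide_le_eq_1 del: of_nat_mult)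
    qed
    have q_le: "q \<le> exp (- (1 / ((real K)\<^sup>2 * \<rho> ^ 18)))"
    proof -
      have "real (m * card S) \<le> real (K * r ^ 9)" using m_bound by (simp only: of_nat_le_iff)
      also have "\<dots> = real K * real r ^ 9" by simp
      also have "\<dots> \<le> real K * \<rho> ^ 9" using r_upper by (intro mult_left_mono power_mono) auto
      finally have "(real (m * card S))\<^sup>2 \<le> (real K * \<rho> ^ 9)\<^sup>2" by (rule power_mono) simp
      also have "\<dots> = (real K)\<^sup>2 * \<rho> ^ 18" by (simp add: power_mult_distrib power_mult[symmetric])
      finally have "1 / ((real K)\<^sup>2 * \<rho> ^ 18) \<le> 1 / (real (m * card S))\<^sup>2"
        by (intro frac_le) (use ms in auto)
      then have "q \<le> 1 + - (1 / ((real K)\<^sup>2 * \<rho> ^ 18))" by (simp add: q_def del: of_nat_mult)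
      also have "\<dots> \<le> exp (- (1 / ((real K)\<^sup>2 * \<rho> ^ 18)))" by (rule exp_ge_add_one_self)
      finally show ?thesis .
    qed
    have "card {xs \<in> words S k. mprod n xs \<in> splits_in n d} / card S ^ k
        \<le> (1 - \<delta>) ^ r + sqrt (real (r ^ 2) ^ (n * n * r) * q ^ k)"
      using sieve_bound[OF C d Q t(1) r1, of k] unfolding m_def[symmetric] \<delta>_def[symmetric] q_def by simp
    also have "(1 - \<delta>) ^ r \<le> 1 / (real k)\<^sup>2"
    proof -
      have "(1 - \<delta>) ^ r \<le> exp (- \<delta>) ^ r"
        using \<delta> exp_ge_add_one_self[of "- \<delta>"] by (intro power_mono) auto
      also have "\<dots> = exp (- \<delta> * r)" by (simp add: exp_of_nat_mult[symmetric] mult.commute)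
      also have "\<dots> \<le> exp (- 2 * ln (real k))"
      proof -
        have "\<delta> * (a * ln (real k)) \<le> \<delta> * r" using r_lower \<delta> by (intro mult_left_mono) auto
        then show ?thesis using \<delta> by (simp add: a_def)
      qed
      also have "\<dots> = 1 / (real k)\<^sup>2"
      proof -
        have "exp (- 2 * ln (real k)) = inverse (exp (2 * ln (real k)))" by (simp add: exp_minus)
        also have "exp (2 * ln (real k)) = (real k)\<^sup>2" using elim(3) by (simp add: exp_double)
        finally show ?thesis by (simp add: inverse_eq_divide)
      qed
      finally show ?thesis .
    qed
    also have "sqrt (real (r ^ 2) ^ (n * n * r) * q ^ k) \<le> 1 / (real k)\<^sup>2"
    proof -
      have rpos: "0 < real r" using r1 by simp
      have "real (r ^ 2) ^ (n * n * r) = exp (2 * ln (real r)) ^ (n * n * r)"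
        using rpos by (simp add: exp_double)
      also have "\<dots> = exp (2 * (real (n * n) * real r * ln (real r)))"
        by (simp add: exp_of_nat_mult[symmetric] algebra_simps)
      also have "\<dots> \<le> exp (2 * (real (n * n) * \<rho> * ln \<rho>))"
      proof -
        have "real r * ln (real r) \<le> \<rho> * ln \<rho>"
          using r1 r_upper rpos by (intro mult_mono) auto
        then have "real (n * n) * (real r * ln (real r)) \<le> real (n * n) * (\<rho> * ln \<rho>)"
          by (rule mult_left_mono) simp
        then show ?thesis by (simp add: mult.assoc)
      qed
      finally have 1: "real (r ^ 2) ^ (n * n * r) \<le> exp (2 * (real (n * n) * \<rho> * ln \<rho>))" .
      have "q ^ k \<le> exp (- (1 / ((real K)\<^sup>2 * \<rho> ^ 18))) ^ k" using q_le q0 by (rule power_mono)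
      also have "\<dots> = exp (2 * (- (k / (2 * (real K)\<^sup>2 * \<rho> ^ 18))))"
        by (simp add: exp_of_nat_mult[symmetric])
      finally have 2: "q ^ k \<le> exp (2 * (- (k / (2 * (real K)\<^sup>2 * \<rho> ^ 18))))" .
      have "real (r ^ 2) ^ (n * n * r) * q ^ k
          \<le> exp (2 * (real (n * n) * \<rho> * ln \<rho>)) * exp (2 * (- (k / (2 * (real K)\<^sup>2 * \<rho> ^ 18))))"
        using 1 2 q0 by (intro mult_mono) auto
      also have "\<dots> = (exp (real (n * n) * \<rho> * ln \<rho> - k / (2 * (real K)\<^sup>2 * \<rho> ^ 18)))\<^sup>2"
        by (simp add: exp_double[symmetric] exp_add[symmetric] right_diff_distrib)
      finally have "sqrt (real (r ^ 2) ^ (n * n * r) * q ^ k)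
          \<le> exp (real (n * n) * \<rho> * ln \<rho> - k / (2 * (real K)\<^sup>2 * \<rho> ^ 18))"
        by (intro real_le_lsqrt) auto
      also have "\<dots> \<le> 1 / (real k)\<^sup>2" using elim(4) unfolding \<rho>_def .
      finally show ?thesis .
    qed
    finally show ?case by simp
  qed
qed

end

theorem theorem1p2:
  fixes n :: nat and S :: "int mat set" and M :: "'w measure" and \<xi> :: "nat \<Rightarrow> 'w \<Rightarrow> int mat"
  assumes n2: "n \<ge> 2"
    and S_sub: "S \<subseteq> SL_int n"
    and S_fin: "finite S"
    and S_sym: "\<forall>A\<in>S. \<exists>B\<in>S. A * B = 1\<^sub>m n"
    and S_gen: "gen_by n S = SL_int n"
    and P: "prob_space M"
    and indep: "prob_space.indep_vars M (\<lambda>_. count_space UNIV) \<xi> {1..}"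
    and valued: "\<forall>k\<ge>1. \<forall>w\<in>space M. \<xi> k w \<in> S"
    and unif: "\<forall>k\<ge>1. \<forall>s\<in>S. measure M {w \<in> space M. \<xi> k w = s} = 1 / real (card S)"
  shows "AE w in M. finite {k. \<not> irreducible (charpoly_T (walk n \<xi> k w))}"
proof -
  interpret prob_space M by (rule P)
  interpret SL_generators n S by unfold_locales (use assms in auto)
  have "AE w in M. finite {k. walk n \<xi> k w \<in> splits_in n d}" if d: "0 < d" "d < n" for d
  proof -
    \<comment> \<open>The index is shifted because \<open>walk_distribution\<close> concerns
      positive times.\<close>
    define A where "A k = {w \<in> space M. walk n \<xi> (Suc k) w \<in> splits_in n d}" for k
    have meas: "A k \<in> events" for k
      unfolding A_def by (rule walk_distribution(1)[OF indep valued unif S_fin]) simp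
    have prob: "prob (A k) = card {xs \<in> words S (Suc k). mprod n xs \<in> splits_in n d} / card S ^ Suc k" for k
      unfolding A_def by (rule walk_distribution(2)[OF indep valued unif S_fin]) simp
    have "\<forall>\<^sub>F k in sequentially. card {xs \<in> words S (Suc k). mprod n xs \<in> splits_in n d} / card S ^ Suc k
        \<le> 2 / (real (Suc k))\<^sup>2"
      using splits_in_summable_bound[OF d] by (subst eventually_sequentially_Suc)
    then have "\<forall>\<^sub>F k in sequentially. norm (prob (A k)) \<le> 2 / (real (Suc k))\<^sup>2"
      unfolding prob by simp
    moreover have "summable (\<lambda>k. 2 / (real (Suc k))\<^sup>2)"
      using summable_mult[OF inverse_squares_sums[THEN sums_summable], of 2] by (simp add: add.commute)
    ultimately have "summable (\<lambda>k. prob (A k))" by (rule summable_comparison_test_ev)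
    then have "AE w in M. eventually (\<lambda>k. w \<in> space M - A k) sequentially"
      by (intro borel_cantelli_AE1 meas) (auto simp: emeasure_eq_measure)
    then show ?thesis
    proof (eventually_elim)
      case (elim w)
      then obtain N where N: "\<And>k. k \<ge> N \<Longrightarrow> w \<in> space M - A k" by (auto simp: eventually_sequentially)
      \<comment> \<open>Time k carries the event of index k - 1, so the times excluded are those
        beyond N.\<close>
      have "{k. walk n \<xi> k w \<in> splits_in n d} \<subseteq> {..N}"
      proof
        fix k assume k: "k \<in> {k. walk n \<xi> k w \<in> splits_in n d}"
        show "k \<in> {..N}"
        proof (rule ccontr)
          assume "k \<notin> {..N}"
          then obtain j where j: "k = Suc j" "j \<ge> N" by (cases k) auto
          then show False using N[OF j(2)] k by (simp add: A_def)
        qed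
      qed
      then show ?case by (rule finite_subset) simp
    qed
  qed
  then have "AE w in M. \<forall>d\<in>{0<..<n}. finite {k. walk n \<xi> k w \<in> splits_in n d}"
    by (subst AE_finite_all) auto
  moreover have "AE w in M. w \<in> space M" by (rule AE_space)
  ultimately show ?thesis
  proof eventually_elim
    case (elim w)
    have car: "walk n \<xi> k w \<in> carrier_mat n n" for k
      unfolding walk_eq_mprod by (rule mprod_carrier) (use valued elim in auto)
    have "{k. \<not> irreducible (charpoly_T (walk n \<xi> k w))} \<subseteq> (\<Union>d\<in>{0<..<n}. {k. walk n \<xi> k w \<in> splits_in n d})"
      using reducible_splits_in[OF car] n2 by fastforce
    moreover have "finite (\<Union>d\<in>{0<..<n}. {k. walk n \<xi> k w \<in> splits_in n d})" using elim by auto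
    ultimately show ?case by (rule finite_subset)
  qed
qed

end
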